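(* Let $r$ be a graphon that is bounded away from $0$ and $1$ (there is $\delta>0$ with $\delta\le r\le1-\delta$) and non-negative definite (i.e. the integral operator $\mathcal T_r$ on $L^2([0,1])$, $(\mathcal T_ru)(x)=\int_{[0,1]}r(x,y)u(y)\,dy$, is non-negative definite). Let $(r_N)_{N\in\mathbb N}$ be graphons $r_N\colon[0,1]^2\to(0,1)$ such that $r_N$ is constant on the blocks $[\frac{i-1}{N},\frac iN)\times[\frac{j-1}{N},\frac jN)$, $1\le i,j\le N$, with $\lim_{N\to\infty}r_N(x,y)=r(x,y)$ for all $(x,y)\in[0,1]^2$ and $\lim_{N\to\infty}\|r_N-r\|_\infty=0$. Let $G_N$ be the inhomogeneous Erdős–Rényi random graph on $[N]$ with reference graphon $r_N$, let $\lambda_N$ be the largest eigenvalue of its Laplacian matrix $L_N$, let $\mathbb P^*_N$ be the law of $\lambda_N$, and let $C_r=\|\mathcal L_r\|$. Then for every $\beta\in[C_r,1]$, $$\lim_{N\to\infty}N^{-1}\log\mathbb P^*_N(\lambda_N/N\ge\beta)=-\widehat\psi_r(\beta),\qquad\text{with}\quad \widehat\psi_r(\beta)=\inf_{x\in[0,1]}J_r(x,\beta).$$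
   Context: A graphon is a measurable function $h\colon[0,1]^2\to[0,1]$ with $h(x,y)=h(y,x)$ for all $x,y$. The Laplacian operator $\mathcal L_h$ on $L^2([0,1])$ is $(\mathcal L_hu)(x)=\int_{[0,1]}h(x,y)[u(x)-u(y)]\,dy$, and $\|\mathcal L_h\|$ is its operator norm. Random graph: in the inhomogeneous Erdős–Rényi random graph $G_N$ with vertex set $[N]=\{1,\dots,N\}$ and reference graphon $r_N$, each pair $i\ne j$ is connected by an edge with probability equal to the value of $r_N$ on the block $[\frac{i-1}{N},\frac iN)\times[\frac{j-1}{N},\frac jN)$, independently over pairs. $A_N$ is the adjacency matrix, $D_N$ the diagonal matrix of degrees, $L_N=D_N-A_N$. Rate function: $\mathcal R(a\mid b)=a\log\frac ab+(1-a)\log\frac{1-a}{1-b}$ for $a\in[0,1]$, $b\in(0,1)$, with $0\log0=0$. For $x\in[0,1]$, $$J_r(x,\beta)=\int_{[0,1]}\mathcal R\big(\widehat r_\beta(x,y)\mid r(x,y)\big)\,dy,\qquad \widehat r_\beta(x,y)=\frac{e^{\theta(x,\beta)}r(x,y)}{e^{\theta(x,\beta)}r(x,y)+[1-r(x,y)]},$$ where $\theta(x,\beta)$ is chosen such that $\int_{[0,1]}\widehat r_\beta(x,y)\,dy=\beta$ for every $x\in[0,1]$. For $\beta=1$ one takes $\theta(x,1)=\infty$, i.e. $\widehat r_1\equiv1$.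
   Formalization: The last block in each coordinate is taken closed at 1, so that the blocks cover all of [0,1]²; with half-open blocks the values of r on x=1 or y=1 are arbitrary and can lower the infimum over x∈[0,1], making the claim false. *)

theory Defs
  imports
    "HOL-Probability.Probability"
    "HOL-Probability.Essential_Supremum"
    "HOL-Probability.Product_PMF"
    "Jordan_Normal_Form.Spectral_Radius"
begin

text \<open>Graphons are curried functions on the reals; only their values on the unit square matter.\<close>

abbreviation unit_interval :: "real measure" where
  "unit_interval \<equiv> restrict_space lborel {0..1}"

definition graphon :: "(real \<Rightarrow> real \<Rightarrow> real) \<Rightarrow> bool" where
  "graphon h \<longleftrightarrow>
     (\<lambda>(x, y). h x y) \<in> borel_measurable (unit_interval \<Otimes>\<^sub>M unit_interval) \<and>
     (\<forall>x\<in>{0..1}. \<forall>y\<in>{0..1}. 0 \<le> h x y \<and> h x y \<le> 1 \<and> h x y = h y x)"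

text \<open>
  The Hilbert space of square-integrable functions on the unit interval is represented by its
  functions rather than by classes modulo null sets; all quantities below respect
  almost-everywhere equality.
\<close>

definition L2 :: "(real \<Rightarrow> real) set" where
  "L2 = {u \<in> borel_measurable unit_interval. integrable unit_interval (\<lambda>x. (u x)\<^sup>2)}"

definition L2_inner :: "(real \<Rightarrow> real) \<Rightarrow> (real \<Rightarrow> real) \<Rightarrow> real" where
  "L2_inner u v = (\<integral>x. u x * v x \<partial>unit_interval)"

definition L2_norm :: "(real \<Rightarrow> real) \<Rightarrow> real" where
  "L2_norm u = sqrt (L2_inner u u)"

text \<open>As for \<open>onorm\<close>, functions of norm zero contribute the quotient \<open>0\<close>.\<close>

definition L2_onorm :: "((real \<Rightarrow> real) \<Rightarrow> real \<Rightarrow> real) \<Rightarrow> real" where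
  "L2_onorm T = (SUP u\<in>L2. L2_norm (T u) / L2_norm u)"

definition integral_operator :: "(real \<Rightarrow> real \<Rightarrow> real) \<Rightarrow> (real \<Rightarrow> real) \<Rightarrow> real \<Rightarrow> real" where
  "integral_operator h u x = (\<integral>y. h x y * u y \<partial>unit_interval)"

definition laplacian_operator :: "(real \<Rightarrow> real \<Rightarrow> real) \<Rightarrow> (real \<Rightarrow> real) \<Rightarrow> real \<Rightarrow> real" where
  "laplacian_operator h u x = (\<integral>y. h x y * (u x - u y) \<partial>unit_interval)"

definition nonneg_definite :: "(real \<Rightarrow> real \<Rightarrow> real) \<Rightarrow> bool" where
  "nonneg_definite h \<longleftrightarrow> (\<forall>u\<in>L2. 0 \<le> L2_inner u (integral_operator h u))"

text \<open>
  Vertices are numbered from \<open>0\<close>, so vertex \<open>i < N\<close> owns the interval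
  \<open>[i/N, (i+1)/N)\<close>. The last interval is closed on the right, so that the
  intervals partition the whole of \<open>[0,1]\<close>: otherwise the values of a block graphon at
  \<open>x = 1\<close> would be unconstrained, although the infimum in \<open>rate_inf\<close> sees them.
\<close>

definition block :: "nat \<Rightarrow> nat \<Rightarrow> real set" where
  "block N i = (if Suc i = N then {real i / real N .. 1}
                else {real i / real N ..< real (Suc i) / real N})"

definition block_constant :: "nat \<Rightarrow> (real \<Rightarrow> real \<Rightarrow> real) \<Rightarrow> bool" where
  "block_constant N h \<longleftrightarrow>
     (\<forall>i<N. \<forall>j<N. (\<lambda>(x, y). h x y) constant_on (block N i \<times> block N j))"

text \<open>
  A graph on \<open>{0..<N}\<close> is given by the indicators of its edges \<open>{i, j}\<close>, indexed by
  the ordered pairs with \<open>i < j\<close>. The edge probability is the value of the block graphon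
  at the lower left corner of the block.
\<close>

definition erdos_renyi :: "nat \<Rightarrow> (real \<Rightarrow> real \<Rightarrow> real) \<Rightarrow> (nat \<times> nat \<Rightarrow> bool) pmf" where
  "erdos_renyi N h =
     Pi_pmf {(i, j). i < j \<and> j < N} False
       (\<lambda>(i, j). bernoulli_pmf (h (real i / real N) (real j / real N)))"

definition adjacent :: "(nat \<times> nat \<Rightarrow> bool) \<Rightarrow> nat \<Rightarrow> nat \<Rightarrow> bool" where
  "adjacent G i j \<longleftrightarrow> (i < j \<and> G (i, j)) \<or> (j < i \<and> G (j, i))"

definition adjacency_matrix :: "nat \<Rightarrow> (nat \<times> nat \<Rightarrow> bool) \<Rightarrow> real mat" where
  "adjacency_matrix N G = mat N N (\<lambda>(i, j). if adjacent G i j then 1 else 0)"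

definition degree_matrix :: "nat \<Rightarrow> (nat \<times> nat \<Rightarrow> bool) \<Rightarrow> real mat" where
  "degree_matrix N G =
     mat N N (\<lambda>(i, j). if i = j then real (card {k. k < N \<and> adjacent G i k}) else 0)"

definition laplacian_matrix :: "nat \<Rightarrow> (nat \<times> nat \<Rightarrow> bool) \<Rightarrow> real mat" where
  "laplacian_matrix N G = degree_matrix N G - adjacency_matrix N G"

definition largest_eigenvalue :: "real mat \<Rightarrow> real" where
  "largest_eigenvalue A = Max (spectrum A)"

definition eigenvalue_law :: "nat \<Rightarrow> (real \<Rightarrow> real \<Rightarrow> real) \<Rightarrow> real pmf" where
  "eigenvalue_law N h =
     map_pmf (\<lambda>G. largest_eigenvalue (laplacian_matrix N G)) (erdos_renyi N h)"

text \<open>The convention \<open>0 * log 0 = 0\<close> holds since \<open>ln 0\<close> is a real number.\<close>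

definition rel_entropy :: "real \<Rightarrow> real \<Rightarrow> real" where
  "rel_entropy a b = a * ln (a / b) + (1 - a) * ln ((1 - a) / (1 - b))"

definition tilt :: "real \<Rightarrow> real \<Rightarrow> real" where
  "tilt t b = exp t * b / (exp t * b + (1 - b))"

text \<open>For \<open>r\<close> bounded away from \<open>0\<close> and \<open>1\<close> and \<open>0 < \<beta> < 1\<close> the tilting
  parameter exists and is unique.\<close>

definition tilt_parameter :: "(real \<Rightarrow> real \<Rightarrow> real) \<Rightarrow> real \<Rightarrow> real \<Rightarrow> real" where
  "tilt_parameter r x \<beta> = (THE t. (\<integral>y. tilt t (r x y) \<partial>unit_interval) = \<beta>)"

text \<open>The case \<open>\<beta> = 1\<close> corresponds to an infinite tilting parameter.\<close>

definition tilted_graphon :: "(real \<Rightarrow> real \<Rightarrow> real) \<Rightarrow> real \<Rightarrow> real \<Rightarrow> real \<Rightarrow> real" where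
  "tilted_graphon r \<beta> x y = (if \<beta> = 1 then 1 else tilt (tilt_parameter r x \<beta>) (r x y))"

definition rate_J :: "(real \<Rightarrow> real \<Rightarrow> real) \<Rightarrow> real \<Rightarrow> real \<Rightarrow> real" where
  "rate_J r x \<beta> = (\<integral>y. rel_entropy (tilted_graphon r \<beta> x y) (r x y) \<partial>unit_interval)"

definition rate_inf :: "(real \<Rightarrow> real \<Rightarrow> real) \<Rightarrow> real \<Rightarrow> real" where
  "rate_inf r \<beta> = (INF x\<in>{0..1}. rate_J r x \<beta>)"

end

theory Submission
  imports Defs "HOL-Real_Asymp.Real_Asymp"
begin

text \<open>
  The largest eigenvalue of the Laplacian is at least every vertex degree, and tilting the edge
  probabilities at the vertex next to \<open>x N\<close> so that its degree becomes \<open>\<beta> N\<close> costs \<open>N J\<^sub>r(x, \<beta>)\<close>.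
  Conversely \<open>\<lambda>\<^sub>N\<close> is at most the maximal degree plus the top of the spectrum of \<open>-A\<^sub>N\<close>. The mean of
  \<open>A\<^sub>N\<close> is non-negative definite up to \<open>o(N)\<close>, and its fluctuations are \<open>o(N)\<close> in operator norm with
  probability \<open>1 - exp (-c N\<^sup>2)\<close>, because the operator norm is controlled by the \<open>4\<^sup>N\<close> sign cuts.
  So up to superexponentially small probability some degree exceeds \<open>(\<beta> - o(1)) N\<close>, and Chernoff's
  bound and the union bound apply. The bound \<open>C\<^sub>r \<le> \<beta>\<close> enters only through the degree function, which
  is at most \<open>\<beta>\<close>, so that all tilting parameters are non-negative.
\<close>

unbundle no inner_syntax

section \<open>Rayleigh quotients of symmetric matrices\<close>

text \<open>The obstacle is null sets: the essential supremum controls \<open>rN N - r\<close> only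
  almost everywhere, while \<open>rate_inf\<close> is an infimum over all points. Each block has
  positive measure and \<open>rN N\<close> is constant on it, so every vertex can be represented by
  a good point of its block; this yields the upper bound uniformly over the vertices. The lower
  bound fixes one nearly optimal point and follows the vertex of its block, where dominated
  convergence along the section applies.

  The union bound also requires bounded tilting parameters, since comparing cumulants at parameter t
  costs a factor of order exp t. For \<beta> < 1 the bound \<delta> \<le> r provides this. For
  \<beta> = 1 the optimal parameter is infinite and is truncated at a level that depends only on
  \<delta> and the tolerated error. The lower bound at \<beta> = 1 is special too: no degree exceeds
  N - 1, so bounding the eigenvalue by a degree never reaches N. A vertex joined to all others still
  produces the eigenvalue N, and the probability of this star can be bounded directly.\<close>

lemma scalar_prod_mat_vec_symmetric:
  fixes A :: "real mat"
  assumes A: "A \<in> carrier_mat n n" and sym: "transpose_mat A = A"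
    and v: "v \<in> carrier_vec n" and w: "w \<in> carrier_vec n"
  shows "v \<bullet> (A *\<^sub>v w) = w \<bullet> (A *\<^sub>v v)"
proof -
  have "w \<bullet> (A *\<^sub>v v) = (transpose_mat A *\<^sub>v w) \<bullet> v"
    using transpose_vec_mult_scalar[OF A v w] by simp
  also have "\<dots> = v \<bullet> (A *\<^sub>v w)"
    unfolding sym using A v w by (intro comm_scalar_prod[of _ n]) auto
  finally show ?thesis by simp
qed

text \<open>The form at v + t w is a nonnegative quadratic polynomial in t, so its discriminant is
  not positive. The form may be degenerate, hence the separate case of a vanishing leading
  coefficient.\<close>

lemma semidefinite_Cauchy_Schwarz:
  fixes B :: "real mat"
  assumes B: "B \<in> carrier_mat n n" and sym: "transpose_mat B = B"
    and psd: "\<And>x. x \<in> carrier_vec n \<Longrightarrow> 0 \<le> x \<bullet> (B *\<^sub>v x)"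
    and v: "v \<in> carrier_vec n" and w: "w \<in> carrier_vec n"
  shows "(v \<bullet> (B *\<^sub>v w))\<^sup>2 \<le> (v \<bullet> (B *\<^sub>v v)) * (w \<bullet> (B *\<^sub>v w))"
proof -
  let ?a = "v \<bullet> (B *\<^sub>v v)" and ?b = "v \<bullet> (B *\<^sub>v w)" and ?c = "w \<bullet> (B *\<^sub>v w)"
  have expand: "0 \<le> ?a + 2 * t * ?b + t\<^sup>2 * ?c" for t
  proof -
    have Bv: "B *\<^sub>v v \<in> carrier_vec n" and Bw: "B *\<^sub>v w \<in> carrier_vec n"
      using B v w by auto
    have tw: "t \<cdot>\<^sub>v w \<in> carrier_vec n" using w by auto
    have "B *\<^sub>v (v + t \<cdot>\<^sub>v w) = B *\<^sub>v v + t \<cdot>\<^sub>v (B *\<^sub>v w)"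
      using mult_add_distrib_mat_vec[OF B v tw] mult_mat_vec[OF B w] by simp
    moreover have "(v + t \<cdot>\<^sub>v w) \<bullet> (B *\<^sub>v v + t \<cdot>\<^sub>v (B *\<^sub>v w)) =
      ?a + t * ?b + (t * (w \<bullet> (B *\<^sub>v v)) + t * (t * ?c))"
      using v w Bv Bw tw
      by (simp add: add_scalar_prod_distrib[of _ n] scalar_prod_add_distrib[of _ n] algebra_simps)
    moreover have "w \<bullet> (B *\<^sub>v v) = ?b"
      using scalar_prod_mat_vec_symmetric[OF B sym v w] by simp
    moreover have "0 \<le> (v + t \<cdot>\<^sub>v w) \<bullet> (B *\<^sub>v (v + t \<cdot>\<^sub>v w))"
      using v tw by (intro psd) auto
    ultimately show ?thesis by (simp add: power2_eq_square algebra_simps)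
  qed
  have c: "0 \<le> ?c" by (rule psd[OF w])
  show ?thesis
  proof (cases "?c = 0")
    case True
    have "?b = 0"
    proof (rule ccontr)
      assume "?b \<noteq> 0"
      \<comment> \<open>The polynomial is now affine in t, and this t gives it the value -1.\<close>
      with expand[of "- (?a + 1) / (2 * ?b)"] True show False by (simp add: field_simps)
    qed
    then show ?thesis using True by simp
  next
    case False
    with c have "?c > 0" by simp
    with expand[of "- ?b / ?c"] show ?thesis
      by (simp add: field_simps power2_eq_square)
  qed
qed

lemma quadratic_form_bound:
  fixes A :: "real mat"
  assumes A: "A \<in> carrier_mat n n"
  shows "\<exists>K>0. \<forall>v\<in>carrier_vec n. \<bar>v \<bullet> (A *\<^sub>v v)\<bar> \<le> K * (v \<bullet> v)"
proof -
  \<comment> \<open>The summand 1 keeps \<open>K\<close> positive even for the zero matrix; the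
    bound for the inverse matrix later serves as a divisor.\<close>
  define K where "K = 1 + (\<Sum>i<n. \<Sum>j<n. \<bar>A $$ (i, j)\<bar>)"
  have "\<bar>v \<bullet> (A *\<^sub>v v)\<bar> \<le> K * (v \<bullet> v)" if v: "v \<in> carrier_vec n" for v
  proof -
    have vv: "v \<bullet> v = (\<Sum>i<n. (v $ i)\<^sup>2)"
      using v by (simp add: scalar_prod_def power2_eq_square atLeast0LessThan)
    have le: "(v $ i)\<^sup>2 \<le> v \<bullet> v" if "i < n" for i
      unfolding vv using that by (intro member_le_sum) auto
    have prod_le: "\<bar>v $ i * v $ j\<bar> \<le> v \<bullet> v" if "i < n" "j < n" for i j
    proof -
      have "2 * \<bar>v $ i * v $ j\<bar> \<le> (v $ i)\<^sup>2 + (v $ j)\<^sup>2"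
        using sum_squares_bound[of "\<bar>v $ i\<bar>" "\<bar>v $ j\<bar>"] by (simp add: abs_mult)
      with le[OF that(1)] le[OF that(2)] show ?thesis by simp
    qed
    have "v \<bullet> (A *\<^sub>v v) = (\<Sum>i<n. \<Sum>j<n. A $$ (i, j) * (v $ i * v $ j))"
      using v A by (simp add: scalar_prod_def atLeast0LessThan sum_distrib_left mult_ac)
    also have "\<bar>\<dots>\<bar> \<le> (\<Sum>i<n. \<Sum>j<n. \<bar>A $$ (i, j)\<bar> * (v \<bullet> v))"
      using prod_le
      by (intro order_trans[OF sum_abs] sum_mono) (auto simp: abs_mult intro!: mult_left_mono)
    also have "\<dots> = (K - 1) * (v \<bullet> v)"
      by (simp add: K_def sum_distrib_right)
    also have "\<dots> \<le> K * (v \<bullet> v)"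
      unfolding vv by (intro mult_right_mono sum_nonneg) auto
    finally show ?thesis .
  qed
  moreover have "K > 0"
    unfolding K_def by (intro add_pos_nonneg sum_nonneg) auto
  ultimately show ?thesis by blast
qed

text \<open>
  The supremum \<open>q\<close> of the Rayleigh quotients is an eigenvalue: otherwise \<open>q I - A\<close> is invertible,
  and the Cauchy--Schwarz inequality of this semidefinite form, applied to \<open>v\<close> and
  \<open>(q I - A)\<^sup>-\<^sup>1 v\<close>, bounds it away from \<open>0\<close>.
\<close>

lemma symmetric_Rayleigh_eigenvalue:
  fixes A :: "real mat"
  assumes A: "A \<in> carrier_mat n n" and sym: "transpose_mat A = A" and n: "n > 0"
  shows "\<exists>q. eigenvalue A q \<and> (\<forall>v\<in>carrier_vec n. v \<bullet> (A *\<^sub>v v) \<le> q * (v \<bullet> v))"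
proof -
  define R where "R = (\<lambda>v. (v \<bullet> (A *\<^sub>v v)) / (v \<bullet> v)) ` {v \<in> carrier_vec n. v \<bullet> v > 0}"
  define q where "q = Sup R"
  have vv_pos: "v \<bullet> v > 0" if "v \<in> carrier_vec n" "v \<noteq> 0\<^sub>v n" for v :: "real vec"
    using conjugate_square_greater_0_vec[OF that(1)] that(2) by (simp add: vec_conjugate_real)
  have e0: "unit_vec n 0 \<bullet> (unit_vec n 0 :: real vec) = 1"
    using n by (simp add: scalar_prod_left_unit)
  have R_ne: "R \<noteq> {}"
    using e0 unfolding R_def by (auto intro!: exI[of _ "unit_vec n 0"])
  obtain K where K: "\<And>v. v \<in> carrier_vec n \<Longrightarrow> \<bar>v \<bullet> (A *\<^sub>v v)\<bar> \<le> K * (v \<bullet> v)"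
    using quadratic_form_bound[OF A] by blast
  have bdd: "bdd_above R"
    unfolding R_def using K by (auto simp: bdd_above_def field_simps intro!: exI[of _ K] dest: abs_le_D1)
  have le_q: "v \<bullet> (A *\<^sub>v v) \<le> q * (v \<bullet> v)" if v: "v \<in> carrier_vec n" for v
  proof (cases "v = 0\<^sub>v n")
    case True
    then show ?thesis using A by simp
  next
    case False
    then have "v \<bullet> v > 0" using vv_pos[OF v] by simp
    then have "(v \<bullet> (A *\<^sub>v v)) / (v \<bullet> v) \<le> q"
      unfolding q_def using v by (intro cSup_upper[OF _ bdd]) (auto simp: R_def)
    with \<open>v \<bullet> v > 0\<close> show ?thesis by (simp add: field_simps)
  qed
  have "eigenvalue A q"
  proof (rule ccontr)
    assume no: "\<not> eigenvalue A q"
    define B where "B = q \<cdot>\<^sub>m 1\<^sub>m n - A"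
    have B: "B \<in> carrier_mat n n" using A by (auto simp: B_def)
    have Bv: "B *\<^sub>v v = q \<cdot>\<^sub>v v - A *\<^sub>v v" if v: "v \<in> carrier_vec n" for v
      using v A by (intro eq_vecI) (auto simp: B_def scalar_prod_def left_diff_distrib
        sum_subtractf if_distrib[of "\<lambda>x. x * _"] if_distrib[of "\<lambda>x. q * x"] cong: if_cong)
    have vBv: "v \<bullet> (B *\<^sub>v v) = q * (v \<bullet> v) - v \<bullet> (A *\<^sub>v v)" if v: "v \<in> carrier_vec n" for v
      using v A by (subst Bv[OF v], subst scalar_prod_minus_distrib[of _ n]) auto
    have symB: "transpose_mat B = B"
    proof -
      have "A $$ (j, i) = A $$ (i, j)" if "i < n" "j < n" for i j
        using arg_cong[OF sym, of "\<lambda>M. M $$ (i, j)"] that A by simp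
      then show ?thesis
        using A by (intro eq_matI) (auto simp: B_def)
    qed
    have "det B \<noteq> 0"
    proof
      assume "det B = 0"
      then obtain v where v: "v \<in> carrier_vec n" "v \<noteq> 0\<^sub>v n" "B *\<^sub>v v = 0\<^sub>v n"
        using det_0_iff_vec_prod_zero[OF B] by blast
      have "q \<cdot>\<^sub>v v - A *\<^sub>v v = 0\<^sub>v n"
        using v Bv by simp
      then have "A *\<^sub>v v = q \<cdot>\<^sub>v v"
      proof (intro eq_vecI)
        fix i assume "i < dim_vec (q \<cdot>\<^sub>v v)"
        then have i: "i < n" using v by simp
        then have "(q \<cdot>\<^sub>v v - A *\<^sub>v v) $ i = 0"
          unfolding \<open>q \<cdot>\<^sub>v v - A *\<^sub>v v = 0\<^sub>v n\<close> by simp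
        then show "(A *\<^sub>v v) $ i = (q \<cdot>\<^sub>v v) $ i" using i v A by simp
      qed (use v A in auto)
      with v no A show False unfolding eigenvalue_def eigenvector_def by auto
    qed
    then have "B \<in> Units (ring_mat TYPE(real) n ())"
      by (rule det_non_zero_imp_unit[OF B])
    then obtain C where C: "C \<in> carrier_mat n n" and BC: "B * C = 1\<^sub>m n"
      unfolding Units_def ring_mat_def by auto
    obtain L where L: "L > 0" "\<And>v. v \<in> carrier_vec n \<Longrightarrow> \<bar>v \<bullet> (C *\<^sub>v v)\<bar> \<le> L * (v \<bullet> v)"
      using quadratic_form_bound[OF C] by blast
    have psd: "0 \<le> x \<bullet> (B *\<^sub>v x)" if "x \<in> carrier_vec n" for x
      using le_q[OF that] vBv[OF that] by simp
    have "y \<le> q - 1 / L" if "y \<in> R" for y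
    proof -
      from that obtain v where v: "v \<in> carrier_vec n" "v \<bullet> v > 0"
        and y: "y = (v \<bullet> (A *\<^sub>v v)) / (v \<bullet> v)" by (auto simp: R_def)
      define w where "w = C *\<^sub>v v"
      have w: "w \<in> carrier_vec n" using C v by (auto simp: w_def)
      have Bw: "B *\<^sub>v w = v"
        unfolding w_def using B C v BC by (subst assoc_mult_mat_vec[symmetric, of _ n n _ n]) auto
      have "(v \<bullet> v)\<^sup>2 \<le> (v \<bullet> (B *\<^sub>v v)) * (w \<bullet> v)"
        using semidefinite_Cauchy_Schwarz[OF B symB psd v(1) w] unfolding Bw .
      also have "\<dots> \<le> (v \<bullet> (B *\<^sub>v v)) * (L * (v \<bullet> v))"
      proof (intro mult_left_mono psd v)
        have "w \<bullet> v = v \<bullet> (C *\<^sub>v v)" unfolding w_def using C v by (intro comm_scalar_prod) auto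
        with L(2)[OF v(1)] show "w \<bullet> v \<le> L * (v \<bullet> v)" by simp
      qed
      finally have "v \<bullet> v \<le> L * (v \<bullet> (B *\<^sub>v v))"
        using v(2) by (simp add: power2_eq_square mult_ac)
      with v L(1) show ?thesis unfolding y vBv[OF v(1)] by (simp add: field_simps)
    qed
    then have "q \<le> q - 1 / L"
      unfolding q_def using R_ne by (intro cSup_least) auto
    with L(1) show False by simp
  qed
  with le_q show ?thesis by blast
qed

text \<open>\<open>Max\<close> is meaningful only on finite nonempty sets. The Rayleigh supremum is
  a real eigenvalue, so the spectrum is nonempty, and being below its maximum it transfers its
  variational bound to \<open>largest_eigenvalue\<close>.\<close>

lemma symmetric_Max_spectrum:
  fixes A :: "real mat"
  assumes A: "A \<in> carrier_mat n n" and sym: "transpose_mat A = A" and n: "n > 0"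
  shows "eigenvalue A (largest_eigenvalue A)"
    and "eigenvalue A k \<Longrightarrow> k \<le> largest_eigenvalue A"
    and "v \<in> carrier_vec n \<Longrightarrow> v \<bullet> (A *\<^sub>v v) \<le> largest_eigenvalue A * (v \<bullet> v)"
proof -
  have fin: "finite (spectrum A)" by (rule card_finite_spectrum[OF A])
  obtain q where q: "eigenvalue A q" "\<And>v. v \<in> carrier_vec n \<Longrightarrow> v \<bullet> (A *\<^sub>v v) \<le> q * (v \<bullet> v)"
    using symmetric_Rayleigh_eigenvalue[OF A sym n] by blast
  have "spectrum A \<noteq> {}" using q(1) by (auto simp: spectrum_def)
  then show "eigenvalue A (largest_eigenvalue A)"
    using Max_in[OF fin] by (auto simp: spectrum_def largest_eigenvalue_def)
  show ub: "k \<le> largest_eigenvalue A" if "eigenvalue A k" for k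
    using Max_ge[OF fin] that by (auto simp: spectrum_def largest_eigenvalue_def)
  show "v \<bullet> (A *\<^sub>v v) \<le> largest_eigenvalue A * (v \<bullet> v)" if v: "v \<in> carrier_vec n"
  proof -
    have "v \<bullet> v \<ge> 0"
      by (simp add: scalar_prod_def sum_nonneg)
    then show ?thesis
      using q(2)[OF v] ub[OF q(1)] by (meson mult_right_mono order_trans)
  qed
qed

section \<open>Sums of independent Bernoulli variables\<close>

lemma exp_le_quadratic:
  fixes x :: real
  assumes "\<bar>x\<bar> \<le> 1"
  shows "exp x \<le> 1 + x + x\<^sup>2"
proof (cases "x \<ge> 0")
  case True
  then show ?thesis using assms by (intro exp_bound) auto
next
  case False
  have pos: "1 - x > 0" using False by simp
  have "exp (- x) \<ge> 1 - x" using exp_ge_add_one_self[of "- x"] by simp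
  then have "(1 - x) * exp x \<le> 1"
    using mult_right_mono[of "1 - x" "exp (- x)" "exp x"] by (simp add: exp_minus)
  \<comment> \<open>For negative x the inequality reduces to 1 - x^3 \<ge> 1, after bounding exp x
    by 1 / (1 - x).\<close>
  also have "1 \<le> (1 - x) * (1 + x + x\<^sup>2)"
  proof -
    have "x ^ 3 \<le> 0" using False by (simp add: power_le_zero_eq)
    moreover have "(1 - x) * (1 + x + x\<^sup>2) = 1 - x ^ 3"
      by (simp add: algebra_simps power2_eq_square power3_eq_cube)
    ultimately show ?thesis by simp
  qed
  finally show ?thesis using pos by simp
qed

text \<open>Markov's inequality for the exponential, factorised by independence. The moment
  generating functions stay exact: the sharp rate for degrees comes from this product, while the
  cuts only need the cruder estimate derived next.\<close>

lemma exponential_Markov_bernoulli_sum: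
  fixes c p :: "'e \<Rightarrow> real"
  assumes E: "finite E" and p: "\<And>e. e \<in> E \<Longrightarrow> 0 \<le> p e \<and> p e \<le> 1"
  shows "measure_pmf.prob (Pi_pmf E False (\<lambda>e. bernoulli_pmf (p e)))
           {G. a \<le> (\<Sum>e\<in>E. c e * of_bool (G e))}
         \<le> exp (- a) * (\<Prod>e\<in>E. 1 - p e + p e * exp (c e))"
proof -
  let ?P = "Pi_pmf E False (\<lambda>e. bernoulli_pmf (p e))"
  let ?X = "\<lambda>G. \<Sum>e\<in>E. c e * of_bool (G e)"
  have expX: "exp (?X G) = (\<Prod>e\<in>E. exp (c e * of_bool (G e)))" for G
    by (rule exp_sum[OF E])
  have int1: "integrable (measure_pmf (bernoulli_pmf (p e))) (f :: bool \<Rightarrow> real)" for e f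
    by (rule integrable_measure_pmf_finite) (rule finite_subset[OF subset_UNIV], simp)
  have int: "integrable (measure_pmf ?P) (\<lambda>G. exp (?X G))"
    unfolding expX by (rule integrable_prod_Pi_pmf[OF E int1])
  have "measure_pmf.prob ?P {G. a \<le> ?X G} = measure_pmf.expectation ?P (indicator {G. a \<le> ?X G})"
    by simp
  also have "\<dots> \<le> measure_pmf.expectation ?P (\<lambda>G. exp (- a) * exp (?X G))"
  proof (rule integral_mono)
    show "integrable (measure_pmf ?P) (\<lambda>G. exp (- a) * exp (?X G))"
      using int by simp
    fix G
    show "indicator {G. a \<le> ?X G} G \<le> exp (- a) * exp (?X G)"
      by (auto simp: indicator_def simp flip: exp_add)
  qed (simp add: measure_pmf.emeasure_eq_measure)
  also have "\<dots> = exp (- a) * measure_pmf.expectation ?P (\<lambda>G. exp (?X G))"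
    by simp
  also have "measure_pmf.expectation ?P (\<lambda>G. exp (?X G)) =
      (\<Prod>e\<in>E. measure_pmf.expectation (bernoulli_pmf (p e)) (\<lambda>b. exp (c e * of_bool b)))"
    unfolding expX by (rule expectation_prod_Pi_pmf[OF E int1]) simp
  also have "\<dots> = (\<Prod>e\<in>E. 1 - p e + p e * exp (c e))"
    using p by (intro prod.cong refl) (subst integral_bernoulli_pmf, auto)
  finally show ?thesis .
qed

text \<open>Second-order bound on each moment generating function; the restriction on
  \<open>l\<close> keeps every exponent in the range of \<open>exp_le_quadratic\<close>. Callers
  choose \<open>l\<close> to minimise the quadratic exponent.\<close>

lemma bernoulli_sum_concentration:
  fixes c p :: "'e \<Rightarrow> real"
  assumes E: "finite E" and p: "\<And>e. e \<in> E \<Longrightarrow> 0 \<le> p e \<and> p e \<le> 1"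
    and l: "0 \<le> l" "\<And>e. e \<in> E \<Longrightarrow> l * \<bar>c e\<bar> \<le> 1"
  shows "measure_pmf.prob (Pi_pmf E False (\<lambda>e. bernoulli_pmf (p e)))
           {G. s \<le> (\<Sum>e\<in>E. c e * (of_bool (G e) - p e))}
         \<le> exp (- l * s + l\<^sup>2 * (\<Sum>e\<in>E. (c e)\<^sup>2))"
proof -
  let ?P = "Pi_pmf E False (\<lambda>e. bernoulli_pmf (p e))"
  define a where "a = l * s + (\<Sum>e\<in>E. l * c e * p e)"
  have "{G. s \<le> (\<Sum>e\<in>E. c e * (of_bool (G e) - p e))} \<subseteq> {G. a \<le> (\<Sum>e\<in>E. l * c e * of_bool (G e))}"
  proof safe
    fix G assume "s \<le> (\<Sum>e\<in>E. c e * (of_bool (G e) - p e))"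
    then have "l * s \<le> l * (\<Sum>e\<in>E. c e * (of_bool (G e) - p e))"
      by (rule mult_left_mono[OF _ l(1)])
    then show "a \<le> (\<Sum>e\<in>E. l * c e * of_bool (G e))"
      by (simp add: a_def sum_distrib_left right_diff_distrib sum_subtractf mult_ac)
  qed
  then have "measure_pmf.prob ?P {G. s \<le> (\<Sum>e\<in>E. c e * (of_bool (G e) - p e))}
      \<le> measure_pmf.prob ?P {G. a \<le> (\<Sum>e\<in>E. l * c e * of_bool (G e))}"
    by (rule measure_pmf.finite_measure_mono) simp
  also have "\<dots> \<le> exp (- a) * (\<Prod>e\<in>E. 1 - p e + p e * exp (l * c e))"
    by (rule exponential_Markov_bernoulli_sum[OF E p])
  also have "(\<Prod>e\<in>E. 1 - p e + p e * exp (l * c e)) \<le> (\<Prod>e\<in>E. exp (l * c e * p e + (l * c e)\<^sup>2))"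
  proof (rule prod_mono, safe)
    fix e assume e: "e \<in> E"
    then show "0 \<le> 1 - p e + p e * exp (l * c e)" using p[OF e] by simp
    have "\<bar>l * c e\<bar> \<le> 1" using l(1) l(2)[OF e] by (simp add: abs_mult)
    then have "p e * exp (l * c e) \<le> p e * (1 + l * c e + (l * c e)\<^sup>2)"
      using p[OF e] by (intro mult_left_mono exp_le_quadratic) auto
    also have "\<dots> \<le> p e + l * c e * p e + (l * c e)\<^sup>2"
      using p[OF e] mult_right_mono[of "p e" 1 "(l * c e)\<^sup>2"] by (simp add: algebra_simps)
    finally have "1 - p e + p e * exp (l * c e) \<le> 1 + (l * c e * p e + (l * c e)\<^sup>2)"
      by simp
    also have "\<dots> \<le> exp (l * c e * p e + (l * c e)\<^sup>2)"
      by (rule exp_ge_add_one_self)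
    finally show "1 - p e + p e * exp (l * c e) \<le> exp (l * c e * p e + (l * c e)\<^sup>2)" .
  qed
  also have "exp (- a) * (\<Prod>e\<in>E. exp (l * c e * p e + (l * c e)\<^sup>2)) =
      exp (- l * s + l\<^sup>2 * (\<Sum>e\<in>E. (c e)\<^sup>2))"
    unfolding exp_sum[OF E, symmetric] exp_add[symmetric]
    by (simp add: a_def sum.distrib sum_distrib_left power_mult_distrib)
  finally show ?thesis by simp
qed

section \<open>Change of measure to tilted edge probabilities\<close>

lemma tilt_pos: "0 < b \<Longrightarrow> b < 1 \<Longrightarrow> 0 < tilt t b"
  unfolding tilt_def by (intro divide_pos_pos add_pos_pos) auto

lemma one_minus_tilt: "0 < b \<Longrightarrow> b < 1 \<Longrightarrow> 1 - tilt t b = (1 - b) / (1 - b + b * exp t)"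
proof -
  assume "0 < b" "b < 1"
  then have "exp t * b + (1 - b) > 0" by (intro add_pos_pos) auto
  then show ?thesis by (simp add: tilt_def field_simps)
qed

lemma tilt_less_1: "0 < b \<Longrightarrow> b < 1 \<Longrightarrow> tilt t b < 1"
proof -
  assume b: "0 < b" "b < 1"
  then have "0 < (1 - b) / (1 - b + b * exp t)" by (intro divide_pos_pos add_pos_pos) auto
  with one_minus_tilt[OF b, of t] show ?thesis by simp
qed

text \<open>The density of the original law with respect to the tilted one is the normalising
  product times exp of minus the tilting sum, which is bounded below on A because the sum is bounded
  above there.\<close>

lemma tilted_measure_lower_bound:
  fixes c p :: "'e \<Rightarrow> real"
  assumes E: "finite E" and p: "\<And>e. e \<in> E \<Longrightarrow> 0 < p e \<and> p e < 1"
    and A: "\<And>G. G \<in> A \<Longrightarrow> (\<Sum>e\<in>E. c e * of_bool (G e)) \<le> b"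
  shows "measure_pmf.prob (Pi_pmf E False (\<lambda>e. bernoulli_pmf (tilt (c e) (p e)))) A *
           (exp (- b) * (\<Prod>e\<in>E. 1 - p e + p e * exp (c e)))
         \<le> measure_pmf.prob (Pi_pmf E False (\<lambda>e. bernoulli_pmf (p e))) A"
proof -
  let ?P = "Pi_pmf E False (\<lambda>e. bernoulli_pmf (p e))"
  let ?Q = "Pi_pmf E False (\<lambda>e. bernoulli_pmf (tilt (c e) (p e)))"
  let ?Z = "\<lambda>e. 1 - p e + p e * exp (c e)"
  \<comment> \<open>Configurations that take the default value outside E: a finite set carrying all
    the mass, so both probabilities become finite sums.\<close>
  define S where "S = PiE_dflt E False (\<lambda>_. UNIV :: bool set)"
  have finS: "finite S" unfolding S_def by (intro finite_PiE_dflt E) simp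
  have Z: "?Z e > 0" if "e \<in> E" for e
    using p[OF that] by (intro add_pos_pos) auto
  have pmf_eq: "pmf ?P G = pmf ?Q G * ((\<Prod>e\<in>E. ?Z e) * exp (- (\<Sum>e\<in>E. c e * of_bool (G e))))"
    if G: "G \<in> S" for G
  proof -
    have out: "G e = False" if "e \<notin> E" for e
      using G that by (auto simp: S_def PiE_dflt_def)
    have factor: "pmf (bernoulli_pmf (p e)) (G e) =
        pmf (bernoulli_pmf (tilt (c e) (p e))) (G e) * (?Z e * exp (- (c e * of_bool (G e))))"
      if e: "e \<in> E" for e
    proof -
      have q: "0 \<le> tilt (c e) (p e)" "tilt (c e) (p e) \<le> 1"
        using tilt_pos[of "p e" "c e"] tilt_less_1[of "p e" "c e"] p[OF e] by auto
      show ?thesis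
      proof (cases "G e")
        case True
        have "tilt (c e) (p e) * ?Z e = exp (c e) * p e"
          using Z[OF e] by (simp add: tilt_def field_simps)
        then have "tilt (c e) (p e) * (?Z e * exp (- c e)) = p e"
          by (simp add: exp_minus field_simps)
        with True p[OF e] q show ?thesis by simp
      next
        case False
        have "(1 - tilt (c e) (p e)) * ?Z e = 1 - p e"
          using p[OF e] Z[OF e] by (subst one_minus_tilt) auto
        with False p[OF e] q show ?thesis by simp
      qed
    qed
    have "pmf ?P G = (\<Prod>e\<in>E. pmf (bernoulli_pmf (p e)) (G e))"
      by (rule pmf_Pi'[OF E out])
    also have "\<dots> = (\<Prod>e\<in>E. pmf (bernoulli_pmf (tilt (c e) (p e))) (G e) *
        (?Z e * exp (- (c e * of_bool (G e)))))"
      by (rule prod.cong[OF refl factor])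
    also have "\<dots> = (\<Prod>e\<in>E. pmf (bernoulli_pmf (tilt (c e) (p e))) (G e)) *
        ((\<Prod>e\<in>E. ?Z e) * exp (- (\<Sum>e\<in>E. c e * of_bool (G e))))"
      by (simp add: prod.distrib exp_sum[OF E] flip: sum_negf)
    also have "(\<Prod>e\<in>E. pmf (bernoulli_pmf (tilt (c e) (p e))) (G e)) = pmf ?Q G"
      by (rule pmf_Pi'[OF E out, symmetric])
    finally show ?thesis .
  qed
  have QS: "measure_pmf.prob ?Q A = measure_pmf.prob ?Q (A \<inter> S)"
    by (intro measure_prob_cong_0)
      (auto simp: S_def PiE_dflt_def intro!: pmf_Pi_outside[OF E])
  have "measure_pmf.prob ?Q A * (exp (- b) * (\<Prod>e\<in>E. ?Z e)) =
      (\<Sum>G\<in>A \<inter> S. pmf ?Q G * ((\<Prod>e\<in>E. ?Z e) * exp (- b)))"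
    unfolding QS using finS by (simp add: measure_measure_pmf_finite sum_distrib_right sum_distrib_left mult_ac)
  also have "\<dots> \<le> (\<Sum>G\<in>A \<inter> S. pmf ?P G)"
  proof (rule sum_mono)
    fix G assume G: "G \<in> A \<inter> S"
    show "pmf ?Q G * ((\<Prod>e\<in>E. ?Z e) * exp (- b)) \<le> pmf ?P G"
      unfolding pmf_eq[OF IntD2[OF G]] using A[OF IntD1[OF G]] Z
      by (intro mult_left_mono prod_nonneg) (auto intro: less_imp_le)
  qed
  also have "\<dots> = measure_pmf.prob ?P (A \<inter> S)"
    using finS by (simp add: measure_measure_pmf_finite)
  also have "\<dots> \<le> measure_pmf.prob ?P A"
    by (intro measure_pmf.finite_measure_mono) auto
  finally show ?thesis .
qed

section \<open>Integration over blocks of the unit interval\<close>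

interpretation unit_interval: prob_space unit_interval
  by (rule prob_spaceI) (simp add: emeasure_restrict_space)

lemma space_unit_interval [simp]: "space unit_interval = {0..1}"
  by (simp add: space_restrict_space)

lemma AE_unit_intervalI: "(\<And>x. x \<in> {0..1} \<Longrightarrow> P x) \<Longrightarrow> AE x in unit_interval. P x"
  by (rule AE_I2) simp

lemma integrable_unit_interval_bounded:
  fixes f :: "real \<Rightarrow> real"
  assumes "f \<in> borel_measurable unit_interval" "\<And>x. x \<in> {0..1} \<Longrightarrow> \<bar>f x\<bar> \<le> B"
  shows "integrable unit_interval f"
  using assms by (intro unit_interval.integrable_const_bound[of _ B] AE_unit_intervalI) auto

lemma integral_unit_interval_mono:
  fixes f g :: "real \<Rightarrow> real"
  assumes "integrable unit_interval f" "integrable unit_interval g"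
    "\<And>x. x \<in> {0..1} \<Longrightarrow> f x \<le> g x"
  shows "(\<integral>x. f x \<partial>unit_interval) \<le> (\<integral>x. g x \<partial>unit_interval)"
  using assms by (intro integral_mono) auto

lemma integral_unit_interval_bounds:
  fixes f :: "real \<Rightarrow> real"
  assumes "integrable unit_interval f" "\<And>x. x \<in> {0..1} \<Longrightarrow> a \<le> f x \<and> f x \<le> b"
  shows "a \<le> (\<integral>x. f x \<partial>unit_interval)" "(\<integral>x. f x \<partial>unit_interval) \<le> b"
  using integral_unit_interval_mono[of "\<lambda>_. a" f] integral_unit_interval_mono[of f "\<lambda>_. b"] assms
    unit_interval.prob_space by auto

lemma abs_integral_unit_interval_le:
  fixes f :: "real \<Rightarrow> real"
  assumes "AE x in unit_interval. \<bar>f x\<bar> \<le> b" "f \<in> borel_measurable unit_interval"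
  shows "\<bar>\<integral>x. f x \<partial>unit_interval\<bar> \<le> b"
proof -
  have int: "integrable unit_interval f"
    using assms by (intro unit_interval.integrable_const_bound[of _ b]) auto
  then have "\<bar>\<integral>x. f x \<partial>unit_interval\<bar> \<le> (\<integral>x. \<bar>f x\<bar> \<partial>unit_interval)"
    using integral_norm_bound[of unit_interval f] by simp
  also have "\<dots> \<le> (\<integral>x. b \<partial>unit_interval)"
    using assms(1) int by (intro integral_mono_AE) auto
  finally show ?thesis using unit_interval.prob_space by simp
qed

section \<open>Blocks, vertices and step functions\<close>

lemma AE_subset_unit_interval_not_null:
  assumes "AE x in unit_interval. P x" "B \<in> sets unit_interval" "emeasure unit_interval B > 0"
  shows "\<exists>x\<in>B. P x"
proof (rule ccontr)
  assume no: "\<not> (\<exists>x\<in>B. P x)"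
  have "AE x in unit_interval. x \<notin> B"
    using assms(1) by eventually_elim (use no in auto)
  then have "emeasure unit_interval B = 0"
    using assms(2) by (subst (asm) AE_iff_null_sets[symmetric]) (auto simp: null_sets_def)
  with assms(3) show False by simp
qed

text \<open>The cap at N - 1 sends x = 1 to the last block, which is closed on the right.\<close>

definition block_index :: "nat \<Rightarrow> real \<Rightarrow> nat" where
  "block_index N x = min (nat \<lfloor>real N * x\<rfloor>) (N - 1)"

lemma block_index:
  assumes N: "N \<ge> 1" and x: "x \<in> {0..1}"
  shows "block_index N x < N" "x \<in> block N (block_index N x)"
proof -
  show lt: "block_index N x < N" using N by (simp add: block_index_def)
  have Npos: "real N > 0" using N by simp
  have fl: "real (nat \<lfloor>real N * x\<rfloor>) \<le> real N * x" "real N * x < real (nat \<lfloor>real N * x\<rfloor>) + 1"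
    using x Npos by (auto simp: of_nat_nat floor_le_iff)
  show "x \<in> block N (block_index N x)"
  proof (cases "nat \<lfloor>real N * x\<rfloor> \<le> N - 1")
    case True
    then have eq: "block_index N x = nat \<lfloor>real N * x\<rfloor>" by (simp add: block_index_def)
    then show ?thesis using fl Npos x by (auto simp: block_def field_simps)
  next
    case False
    then have eq: "block_index N x = N - 1" by (simp add: block_index_def)
    from False have "real (N - 1) \<le> real (nat \<lfloor>real N * x\<rfloor>)" by simp
    with fl(1) have "real (N - 1) \<le> real N * x" by simp
    then show ?thesis using eq N x Npos by (auto simp: block_def field_simps)
  qed
qed

lemma block_index_eq:
  assumes i: "i < N" and x: "x \<in> block N i"
  shows "block_index N x = i"
proof -
  have Npos: "real N > 0" using i by simp
  show ?thesis
  proof (cases "Suc i = N")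
    case True
    then have "real i \<le> real N * x" using x Npos by (auto simp: block_def field_simps)
    then have "int i \<le> \<lfloor>real N * x\<rfloor>" by (simp add: le_floor_iff)
    then show ?thesis using True by (auto simp: block_index_def)
  next
    case False
    then have "real i \<le> real N * x" "real N * x < real i + 1"
      using x Npos by (auto simp: block_def field_simps)
    then have "\<lfloor>real N * x\<rfloor> = int i" by (simp add: floor_eq_iff)
    then show ?thesis using i by (auto simp: block_index_def)
  qed
qed

lemma block_subset: "i < N \<Longrightarrow> block N i \<subseteq> {0..1}"
proof
  fix x assume i: "i < N" and "x \<in> block N i"
  moreover have "real (Suc i) / real N \<le> 1" using i by simp
  ultimately have "real i / real N \<le> x" "x \<le> 1"
    using less_le_trans[of x "real (Suc i) / real N" 1]
    by (auto simp: block_def split: if_splits simp del: of_nat_Suc)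
  then show "x \<in> {0..1}" using order_trans[of 0 "real i / real N" x] by simp
qed

lemma left_endpoint_in_block: "i < N \<Longrightarrow> real i / real N \<in> block N i"
  by (auto simp: block_def field_simps)

lemma left_endpoint_in_unit: "i < N \<Longrightarrow> real i / real N \<in> {0..1}"
  using block_subset left_endpoint_in_block by blast

lemma sets_block: "i < N \<Longrightarrow> block N i \<in> sets unit_interval"
  using block_subset[of i N] by (simp add: sets_restrict_space_iff) (simp add: block_def)

lemma emeasure_block: "i < N \<Longrightarrow> emeasure unit_interval (block N i) = ennreal (1 / real N)"
proof -
  assume i: "i < N"
  have "emeasure unit_interval (block N i) = emeasure lborel (block N i)"
    using block_subset[OF i] by (intro emeasure_restrict_space) auto
  also have "\<dots> = ennreal (1 / real N)"
  proof (cases "Suc i = N")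
    case True
    moreover have "1 - real i / real N = 1 / real N" using True by (auto simp: field_simps)
    moreover have "real i / real N \<le> 1" using i by simp
    ultimately show ?thesis by (simp add: block_def)
  next
    case False
    moreover have "real (Suc i) / real N - real i / real N = 1 / real N"
      by (simp add: diff_divide_distrib[symmetric])
    moreover have "real i / real N \<le> real (Suc i) / real N" by (simp add: divide_right_mono)
    ultimately show ?thesis by (simp add: block_def del: of_nat_Suc)
  qed
  finally show ?thesis .
qed

text \<open>Every use of the essential supremum hypothesis at a vertex passes through this: the
  block has positive measure, so it contains a good point, and block constancy transports what holds
  there to the whole block.\<close>

lemma AE_unit_interval_block:
  assumes "AE x in unit_interval. P x" "i < N"
  shows "\<exists>x\<in>block N i. P x"
  using assms by (intro AE_subset_unit_interval_not_null sets_block) (auto simp: emeasure_block)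

text \<open>The dictionary between averages over vertices and integrals over the unit interval;
  integrability and measurability of step functions come with it.\<close>

lemma has_bochner_integral_step:
  fixes F :: "nat \<Rightarrow> real"
  assumes N: "N \<ge> 1"
  shows "has_bochner_integral unit_interval (\<lambda>x. F (block_index N x)) ((\<Sum>i<N. F i) / real N)"
proof -
  have "has_bochner_integral unit_interval (\<lambda>x. \<Sum>i<N. F i * indicator (block N i) x)
      (\<Sum>i<N. F i * measure unit_interval (block N i))"
    by (intro has_bochner_integral_sum has_bochner_integral_mult_right
        has_bochner_integral_real_indicator) (auto simp: sets_block emeasure_block)
  also have "(\<Sum>i<N. F i * measure unit_interval (block N i)) = (\<Sum>i<N. F i) / real N"
    by (simp add: measure_def emeasure_block sum_divide_distrib)
  finally have step: "has_bochner_integral unit_interval (\<lambda>x. \<Sum>i<N. F i * indicator (block N i) x)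
      ((\<Sum>i<N. F i) / real N)" .
  have "(\<Sum>i<N. F i * indicator (block N i) x) = F (block_index N x)"
    if "x \<in> space unit_interval" for x
  proof -
    from that have x: "x \<in> {0..1}" by simp
    have "(\<Sum>i<N. F i * indicator (block N i) x) = (\<Sum>i<N. if i = block_index N x then F i else 0)"
    proof (rule sum.cong[OF refl])
      fix i assume "i \<in> {..<N}"
      then have "x \<in> block N i \<longleftrightarrow> i = block_index N x"
        using block_index_eq[of i N x] block_index(2)[OF N x] by blast
      then show "F i * indicator (block N i) x = (if i = block_index N x then F i else 0)"
        by (simp add: indicator_def)
    qed
    then show ?thesis
      using block_index[OF N x] by simp
  qed
  then show ?thesis
    by (rule iffD1[OF has_bochner_integral_cong[OF refl _ refl] step])
qed

lemma integral_step:
  fixes F :: "nat \<Rightarrow> real"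
  shows "N \<ge> 1 \<Longrightarrow> (\<integral>x. F (block_index N x) \<partial>unit_interval) = (\<Sum>i<N. F i) / real N"
  using has_bochner_integral_step by (rule has_bochner_integral_integral_eq)

lemma integrable_step:
  fixes F :: "nat \<Rightarrow> real"
  shows "N \<ge> 1 \<Longrightarrow> integrable unit_interval (\<lambda>x. F (block_index N x))"
  using has_bochner_integral_step integrable.intros by blast

lemma measurable_step:
  fixes F :: "nat \<Rightarrow> real"
  shows "N \<ge> 1 \<Longrightarrow> (\<lambda>x. F (block_index N x)) \<in> borel_measurable unit_interval"
  using integrable_step by (rule borel_measurable_integrable)

lemma block_constant_eq:
  assumes bc: "block_constant N h" and N: "N \<ge> 1" and x: "x \<in> {0..1}" and y: "y \<in> {0..1}"
  shows "h x y = h (real (block_index N x) / real N) (real (block_index N y) / real N)"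
proof -
  let ?i = "block_index N x" and ?j = "block_index N y"
  note ij = block_index[OF N x] block_index[OF N y]
  have "(\<lambda>(x, y). h x y) constant_on (block N ?i \<times> block N ?j)"
    using bc ij by (auto simp: block_constant_def)
  then obtain c where "\<And>z. z \<in> block N ?i \<times> block N ?j \<Longrightarrow> (\<lambda>(x, y). h x y) z = c"
    unfolding constant_on_def by blast
  from this[of "(x, y)"] this[of "(real ?i / real N, real ?j / real N)"] show ?thesis
    using ij left_endpoint_in_block by auto
qed

lemma graphon_section_measurable:
  assumes "graphon h" "x \<in> {0..1}"
  shows "(\<lambda>y. h x y) \<in> borel_measurable unit_interval"
proof -
  have "(\<lambda>(x, y). h x y) \<in> borel_measurable (unit_interval \<Otimes>\<^sub>M unit_interval)"
    using assms(1) by (simp add: graphon_def)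
  from measurable_compose[OF measurable_Pair1' this, of x] assms(2) show ?thesis
    by simp
qed

lemma graphon_bounds: "graphon h \<Longrightarrow> x \<in> {0..1} \<Longrightarrow> y \<in> {0..1} \<Longrightarrow> 0 \<le> h x y \<and> h x y \<le> 1"
  by (simp add: graphon_def)

lemma graphon_sym: "graphon h \<Longrightarrow> x \<in> {0..1} \<Longrightarrow> y \<in> {0..1} \<Longrightarrow> h x y = h y x"
  by (simp add: graphon_def)

section \<open>Cumulants, tilting and the rate function\<close>

text \<open>The logarithmic moment generating function of a Bernoulli variable with mean
  \<open>b\<close>. Its derivative in \<open>t\<close> is \<open>tilt t b\<close>.\<close>

definition cumulant :: "real \<Rightarrow> real \<Rightarrow> real" where
  "cumulant t b = ln (1 - b + b * exp t)"

lemma cumulant_arg_pos: "0 \<le> b \<Longrightarrow> b \<le> 1 \<Longrightarrow> 0 < 1 - b + b * exp (t::real)"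
  by (cases "b = 1") (auto intro: add_pos_nonneg)

lemma cumulant_mono_diff:
  assumes b: "0 \<le> b" "b \<le> 1" and st: "s \<le> t"
  shows "cumulant s b \<le> cumulant t b" "cumulant t b \<le> cumulant s b + (t - s)"
proof -
  note pos = cumulant_arg_pos[OF b]
  show "cumulant s b \<le> cumulant t b"
    unfolding cumulant_def using pos[of s] st b by (intro ln_mono) (auto intro: mult_left_mono)
  have "1 - b \<le> exp (t - s) * (1 - b)"
    using b st mult_right_mono[of 1 "exp (t - s)" "1 - b"] by simp
  moreover have "exp t = exp (t - s) * exp s" by (simp flip: exp_add)
  ultimately have "1 - b + b * exp t \<le> exp (t - s) * (1 - b + b * exp s)"
    by (simp add: algebra_simps)
  then have "cumulant t b \<le> ln (exp (t - s) * (1 - b + b * exp s))"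
    unfolding cumulant_def using pos[of t] by (intro ln_mono) auto
  also have "\<dots> = cumulant s b + (t - s)"
    unfolding cumulant_def using pos[of s] by (subst ln_mult) auto
  finally show "cumulant t b \<le> cumulant s b + (t - s)" .
qed

lemma cumulant_0 [simp]: "cumulant 0 b = 0"
  by (simp add: cumulant_def)

lemma cumulant_bounds:
  assumes "0 \<le> b" "b \<le> 1" "0 \<le> t"
  shows "0 \<le> cumulant t b" "cumulant t b \<le> t"
  using cumulant_mono_diff[OF assms] by simp_all

text \<open>Follows from ln z \<le> z - 1 for the ratio of the two arguments, whose denominator is
  at least 1 because t \<ge> 0. The constant grows with t, which is why the parameters have to be
  bounded before \<open>rN N\<close> is compared with \<open>r\<close>.\<close>

lemma cumulant_Lipschitz:
  assumes b: "0 \<le> b" "b \<le> 1" and c: "0 \<le> c" "c \<le> 1" and t: "0 \<le> t"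
  shows "cumulant t b - cumulant t c \<le> (exp t - 1) * \<bar>b - c\<bar>"
proof -
  have c1: "1 \<le> 1 - c + c * exp t"
    using c t mult_left_mono[of 1 "exp t" c] by simp
  have "cumulant t b - cumulant t c = ln ((1 - b + b * exp t) / (1 - c + c * exp t))"
    unfolding cumulant_def using cumulant_arg_pos[OF b, of t] cumulant_arg_pos[OF c, of t]
    by (simp add: ln_div)
  also have "\<dots> \<le> (1 - b + b * exp t) / (1 - c + c * exp t) - 1"
    using cumulant_arg_pos[OF b, of t] cumulant_arg_pos[OF c, of t]
    by (intro ln_le_minus_one divide_pos_pos)
  also have "\<dots> = (exp t - 1) * (b - c) / (1 - c + c * exp t)"
    using c1 by (simp add: field_simps)
  also have "\<dots> \<le> (exp t - 1) * \<bar>b - c\<bar> / (1 - c + c * exp t)"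
    using c1 t by (intro divide_right_mono mult_left_mono) auto
  also have "\<dots> \<le> (exp t - 1) * \<bar>b - c\<bar> / 1"
    using c1 t by (intro divide_left_mono) auto
  finally show ?thesis by simp
qed

lemma continuous_on_cumulant: "continuous_on {0..1} (cumulant t)"
  unfolding cumulant_def[abs_def]
  by (intro continuous_intros) (metis atLeastAtMost_iff cumulant_arg_pos less_irrefl)

lemma tilt_eq: "tilt t b = exp t * b / (1 - b + b * exp t)"
  by (simp add: tilt_def algebra_simps)

lemma tilt_bounds: "0 \<le> b \<Longrightarrow> b \<le> 1 \<Longrightarrow> 0 \<le> tilt t b \<and> tilt t b \<le> 1"
  using cumulant_arg_pos[of b t] by (simp add: tilt_eq field_simps)

lemma tilt_0 [simp]: "tilt 0 b = b"
  by (simp add: tilt_def)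

lemma continuous_on_tilt: "continuous_on {0..1} (tilt t)"
  unfolding tilt_eq[abs_def]
  by (intro continuous_intros) (metis atLeastAtMost_iff cumulant_arg_pos less_irrefl)

lemma tilt_mono:
  assumes "0 \<le> b" "b \<le> c" "c \<le> 1"
  shows "tilt t b \<le> tilt t c"
  using assms cumulant_arg_pos[of b t] cumulant_arg_pos[of c t]
  by (simp add: tilt_eq divide_simps) (simp add: algebra_simps)

lemma tilt_diff:
  assumes b: "0 \<le> b" "b \<le> 1"
  shows "tilt t b - tilt s b =
    (exp t - exp s) * b * (1 - b) / ((1 - b + b * exp t) * (1 - b + b * exp s))"
  using cumulant_arg_pos[OF b, of s] cumulant_arg_pos[OF b, of t]
  by (simp add: tilt_eq divide_simps) (simp add: algebra_simps)

lemma tilt_strict_mono: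
  assumes "0 < b" "b < 1" "s < t"
  shows "tilt s b < tilt t b"
proof -
  have "0 < (exp t - exp s) * b * (1 - b) / ((1 - b + b * exp t) * (1 - b + b * exp s))"
    using assms by (intro divide_pos_pos mult_pos_pos cumulant_arg_pos) auto
  with tilt_diff[of b t s] assms show ?thesis by simp
qed

lemma tilt_Lipschitz:
  assumes b: "0 \<le> b" "b \<le> 1" and st: "s \<le> t"
  shows "tilt s b \<le> tilt t b" "tilt t b \<le> tilt s b + (t - s)"
proof -
  note pos = cumulant_arg_pos[OF b]
  have "0 \<le> (exp t - exp s) * b * (1 - b) / ((1 - b + b * exp t) * (1 - b + b * exp s))"
    using b st by (intro divide_nonneg_nonneg mult_nonneg_nonneg less_imp_le[OF pos]) auto
  with tilt_diff[OF b, of t s] show "tilt s b \<le> tilt t b" by simp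
  \<comment> \<open>After scaling, the numerator is that of \<open>tilt s b\<close> while the
    denominator is larger; the scaling itself changes the tilt by at most t - s.\<close>
  have "exp (s - t) * tilt t b = exp s * b / (1 - b + b * exp t)"
    by (simp add: tilt_eq exp_diff)
  also have "\<dots> \<le> exp s * b / (1 - b + b * exp s)"
    using b st pos[of s] pos[of t] by (intro divide_left_mono) (auto intro!: mult_left_mono)
  finally have "exp (s - t) * tilt t b \<le> tilt s b" by (simp add: tilt_eq)
  moreover have "1 - exp (s - t) \<le> t - s"
    using exp_ge_add_one_self[of "s - t"] by linarith
  then have "(1 - exp (s - t)) * tilt t b \<le> (t - s) * 1"
    using tilt_bounds[OF b, of t] st by (intro mult_mono) auto
  ultimately show "tilt t b \<le> tilt s b + (t - s)"
    by (simp add: algebra_simps)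
qed

text \<open>Legendre duality: the entropy of a tilted Bernoulli law is t times its mean minus the
  cumulant. This is the exponent that appears both in the Chernoff bound and in the change of
  measure.\<close>

lemma rel_entropy_tilt:
  assumes b: "0 < b" "b < 1"
  shows "rel_entropy (tilt t b) b = t * tilt t b - cumulant t b"
proof -
  have Z: "0 < 1 - b + b * exp t" using b by (intro cumulant_arg_pos) auto
  have "tilt t b / b = exp t / (1 - b + b * exp t)"
    using b by (simp add: tilt_eq)
  then have 1: "ln (tilt t b / b) = t - cumulant t b"
    using Z by (simp add: cumulant_def ln_div)
  have "(1 - tilt t b) / (1 - b) = 1 / (1 - b + b * exp t)"
    using b by (simp add: one_minus_tilt)
  then have 2: "ln ((1 - tilt t b) / (1 - b)) = - cumulant t b"
    using Z by (simp add: cumulant_def ln_div)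
  show ?thesis unfolding rel_entropy_def 1 2 by (simp add: algebra_simps)
qed

lemma measurable_cumulant [measurable (raw)]:
  assumes [measurable]: "f \<in> borel_measurable M"
  shows "(\<lambda>x. cumulant t (f x)) \<in> borel_measurable M"
  unfolding cumulant_def by measurable

lemma measurable_tilt [measurable (raw)]:
  assumes [measurable]: "f \<in> borel_measurable M"
  shows "(\<lambda>x. tilt t (f x)) \<in> borel_measurable M"
  unfolding tilt_def by measurable

lemma integrable_cumulant:
  assumes "f \<in> borel_measurable unit_interval" "\<And>y. y \<in> {0..1} \<Longrightarrow> 0 \<le> f y \<and> f y \<le> 1" "0 \<le> t"
  shows "integrable unit_interval (\<lambda>y. cumulant t (f y))"
proof (rule integrable_unit_interval_bounded[where B = t])
  fix y :: real assume "y \<in> {0..1}"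
  then show "\<bar>cumulant t (f y)\<bar> \<le> t"
    using assms(2)[of y] cumulant_bounds[of "f y" t] assms(3) by simp
qed (use assms(1) in measurable)

lemma integrable_tilt:
  assumes "f \<in> borel_measurable unit_interval" "\<And>y. y \<in> {0..1} \<Longrightarrow> 0 \<le> f y \<and> f y \<le> 1"
  shows "integrable unit_interval (\<lambda>y. tilt t (f y))"
proof (rule integrable_unit_interval_bounded[where B = 1])
  fix y :: real assume "y \<in> {0..1}"
  then show "\<bar>tilt t (f y)\<bar> \<le> 1" using assms(2)[of y] tilt_bounds[of "f y" t] by simp
qed (use assms(1) in measurable)

text \<open>The tilt that moves the constant \<open>\<delta>\<close> to \<open>\<beta>\<close>; larger values need less tilting.\<close>

definition tilt_cap :: "real \<Rightarrow> real \<Rightarrow> real" where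
  "tilt_cap \<delta> \<beta> = ln (\<beta> * (1 - \<delta>) / (\<delta> * (1 - \<beta>)))"

lemma tilt_tilt_cap:
  assumes "0 < \<delta>" "\<delta> \<le> \<beta>" "\<beta> < 1"
  shows "tilt (tilt_cap \<delta> \<beta>) \<delta> = \<beta>" "0 \<le> tilt_cap \<delta> \<beta>"
proof -
  have "0 < \<beta> * (1 - \<delta>) / (\<delta> * (1 - \<beta>))"
    using assms by (intro divide_pos_pos mult_pos_pos) auto
  then have e: "exp (tilt_cap \<delta> \<beta>) = \<beta> * (1 - \<delta>) / (\<delta> * (1 - \<beta>))"
    by (simp add: tilt_cap_def)
  have e2: "exp (tilt_cap \<delta> \<beta>) * \<delta> = \<beta> * (1 - \<delta>) / (1 - \<beta>)"
    unfolding e using assms by (simp add: field_simps)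
  have e3: "\<beta> * (1 - \<delta>) / (1 - \<beta>) + (1 - \<delta>) = (1 - \<delta>) / (1 - \<beta>)"
    using assms by (simp add: field_simps)
  show "tilt (tilt_cap \<delta> \<beta>) \<delta> = \<beta>"
    unfolding tilt_def e2 e3 using assms by simp
  have "1 \<le> \<beta> * (1 - \<delta>) / (\<delta> * (1 - \<beta>))"
    using assms by (simp add: field_simps)
  then show "0 \<le> tilt_cap \<delta> \<beta>" by (simp add: tilt_cap_def)
qed

section \<open>The tilting parameter and the Legendre form of the rate function\<close>

lemma tilted_mean_strict_mono:
  assumes f: "f \<in> borel_measurable unit_interval" "\<And>y. y \<in> {0..1} \<Longrightarrow> 0 < f y \<and> f y < 1"
    and st: "s < t"
  shows "(\<integral>y. tilt s (f y) \<partial>unit_interval) < (\<integral>y. tilt t (f y) \<partial>unit_interval)"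
  using f st by (intro unit_interval.integral_less_AE_space integrable_tilt AE_unit_intervalI tilt_strict_mono)
    (auto simp: less_imp_le unit_interval.emeasure_space_1[unfolded space_unit_interval])

text \<open>Supplies the continuity for the intermediate value theorem and later limits how far a
  slightly larger parameter overshoots the target mean.\<close>

lemma tilted_mean_Lipschitz:
  assumes f: "f \<in> borel_measurable unit_interval" "\<And>y. y \<in> {0..1} \<Longrightarrow> 0 \<le> f y \<and> f y \<le> 1"
    and st: "s \<le> t"
  shows "(\<integral>y. tilt s (f y) \<partial>unit_interval) \<le> (\<integral>y. tilt t (f y) \<partial>unit_interval)"
    and "(\<integral>y. tilt t (f y) \<partial>unit_interval) \<le> (\<integral>y. tilt s (f y) \<partial>unit_interval) + (t - s)"
proof -
  note int = integrable_tilt[OF f]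
  show "(\<integral>y. tilt s (f y) \<partial>unit_interval) \<le> (\<integral>y. tilt t (f y) \<partial>unit_interval)"
    using f(2) tilt_Lipschitz(1)[OF _ _ st] by (intro integral_unit_interval_mono int) auto
  have "(\<integral>y. tilt t (f y) \<partial>unit_interval) \<le> (\<integral>y. tilt s (f y) + (t - s) \<partial>unit_interval)"
    using f(2) tilt_Lipschitz(2)[OF _ _ st]
    by (intro integral_unit_interval_mono int Bochner_Integration.integrable_add) auto
  also have "\<dots> = (\<integral>y. tilt s (f y) \<partial>unit_interval) + (t - s)"
    using int unit_interval.prob_space by (subst Bochner_Integration.integral_add) auto
  finally show "(\<integral>y. tilt t (f y) \<partial>unit_interval) \<le> (\<integral>y. tilt s (f y) \<partial>unit_interval) + (t - s)" .
qed

text \<open>Intermediate value theorem between 0, where the mean is at most \<beta> by hypothesis,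
  and the cap, where every value of f is tilted at least to \<beta>. The cap depends only on
  \<delta> and \<beta>, so the parameter is bounded uniformly over all sections.\<close>

lemma tilt_parameter_exists:
  assumes f: "f \<in> borel_measurable unit_interval" "\<And>y. y \<in> {0..1} \<Longrightarrow> \<delta> \<le> f y \<and> f y \<le> 1 - \<delta>"
    and \<delta>: "0 < \<delta>" and mean: "(\<integral>y. f y \<partial>unit_interval) \<le> \<beta>" and \<beta>: "\<beta> < 1"
  shows "\<exists>t. 0 \<le> t \<and> t \<le> tilt_cap \<delta> \<beta> \<and> (\<integral>y. tilt t (f y) \<partial>unit_interval) = \<beta>"
proof -
  have f01: "0 \<le> f y \<and> f y \<le> 1" if "y \<in> {0..1}" for y using f(2)[OF that] \<delta> by auto
  have d1: "\<delta> \<le> 1 - \<delta>" using f(2)[of 0] by auto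
  let ?m = "\<lambda>t. \<integral>y. tilt t (f y) \<partial>unit_interval"
  have "\<delta> \<le> (\<integral>y. f y \<partial>unit_interval)"
    using integral_unit_interval_bounds(1)[of f \<delta> "1 - \<delta>"] integrable_tilt[OF f(1) f01, of 0] f(2) by simp
  with mean have "\<delta> \<le> \<beta>" by simp
  note cap = tilt_tilt_cap[OF \<delta> this \<beta>]
  have "tilt (tilt_cap \<delta> \<beta>) \<delta> \<le> ?m (tilt_cap \<delta> \<beta>)"
    using f(2) \<delta> d1 f01 tilt_bounds
    by (intro integral_unit_interval_bounds(1)[where b = 1] integrable_tilt f(1)) (auto intro!: tilt_mono)
  then have ge: "\<beta> \<le> ?m (tilt_cap \<delta> \<beta>)" using cap by simp
  have le: "?m 0 \<le> \<beta>" using mean by simp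
  have "1-lipschitz_on UNIV ?m"
  proof (rule lipschitz_onI)
    fix s t :: real
    show "dist (?m s) (?m t) \<le> 1 * dist s t"
      using tilted_mean_Lipschitz[OF f(1) f01, of s t] tilted_mean_Lipschitz[OF f(1) f01, of t s]
      by (cases "s \<le> t") (auto simp: dist_real_def)
  qed simp
  then have "continuous_on {0..tilt_cap \<delta> \<beta>} ?m"
    using lipschitz_on_continuous_on continuous_on_subset by blast
  from IVT'[OF le ge cap(2) this] show ?thesis by auto
qed

lemma tilt_parameter:
  assumes f: "(\<lambda>y. r x y) \<in> borel_measurable unit_interval"
      "\<And>y. y \<in> {0..1} \<Longrightarrow> \<delta> \<le> r x y \<and> r x y \<le> 1 - \<delta>"
    and \<delta>: "0 < \<delta>" and mean: "(\<integral>y. r x y \<partial>unit_interval) \<le> \<beta>" and \<beta>: "\<beta> < 1"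
  shows "0 \<le> tilt_parameter r x \<beta>" "tilt_parameter r x \<beta> \<le> tilt_cap \<delta> \<beta>"
    "(\<integral>y. tilt (tilt_parameter r x \<beta>) (r x y) \<partial>unit_interval) = \<beta>"
proof -
  obtain t where t: "0 \<le> t" "t \<le> tilt_cap \<delta> \<beta>" "(\<integral>y. tilt t (r x y) \<partial>unit_interval) = \<beta>"
    using tilt_parameter_exists[OF f \<delta> mean \<beta>] by blast
  have r01: "0 < r x y \<and> r x y < 1" if "y \<in> {0..1}" for y using f(2)[OF that] \<delta> by auto
  have "tilt_parameter r x \<beta> = t"
    unfolding tilt_parameter_def
  proof (rule the_equality)
    fix s assume "(\<integral>y. tilt s (r x y) \<partial>unit_interval) = \<beta>"
    then show "s = t"
      using tilted_mean_strict_mono[OF f(1) r01, of s t] tilted_mean_strict_mono[OF f(1) r01, of t s] t(3)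
      by (cases s t rule: linorder_cases) auto
  qed (rule t)
  with t show "0 \<le> tilt_parameter r x \<beta>" "tilt_parameter r x \<beta> \<le> tilt_cap \<delta> \<beta>"
    "(\<integral>y. tilt (tilt_parameter r x \<beta>) (r x y) \<partial>unit_interval) = \<beta>" by simp_all
qed

lemma rate_J_less_1:
  assumes f: "(\<lambda>y. r x y) \<in> borel_measurable unit_interval"
      "\<And>y. y \<in> {0..1} \<Longrightarrow> \<delta> \<le> r x y \<and> r x y \<le> 1 - \<delta>"
    and \<delta>: "0 < \<delta>" and mean: "(\<integral>y. r x y \<partial>unit_interval) \<le> \<beta>" and \<beta>: "\<beta> < 1"
  shows "rate_J r x \<beta> = tilt_parameter r x \<beta> * \<beta> -
    (\<integral>y. cumulant (tilt_parameter r x \<beta>) (r x y) \<partial>unit_interval)"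
proof -
  let ?t = "tilt_parameter r x \<beta>"
  note t = tilt_parameter[where r = r and x = x, OF f \<delta> mean \<beta>]
  have r01: "0 \<le> r x y \<and> r x y \<le> 1" if "y \<in> {0..1}" for y using f(2)[OF that] \<delta> by auto
  have "rate_J r x \<beta> = (\<integral>y. ?t * tilt ?t (r x y) - cumulant ?t (r x y) \<partial>unit_interval)"
    unfolding rate_J_def using \<beta> f(2) \<delta>
    by (intro Bochner_Integration.integral_cong refl) (force simp: tilted_graphon_def intro!: rel_entropy_tilt)
  also have "\<dots> = ?t * (\<integral>y. tilt ?t (r x y) \<partial>unit_interval) - (\<integral>y. cumulant ?t (r x y) \<partial>unit_interval)"
    using integrable_tilt[OF f(1) r01] integrable_cumulant[OF f(1) r01 t(1)] by simp
  finally show ?thesis using t(3) by simp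
qed

lemma rate_J_1: "rate_J r x 1 = (\<integral>y. - ln (r x y) \<partial>unit_interval)" 
  if "\<And>y. y \<in> {0..1} \<Longrightarrow> 0 < r x y"
  unfolding rate_J_def using that
  by (intro Bochner_Integration.integral_cong refl) (simp add: tilted_graphon_def rel_entropy_def ln_div)

text \<open>The order of quantifiers matters: \<open>T\<close> is chosen before \<open>r\<close> and
  \<open>x\<close>, so one error estimate serves all vertices. For \<beta> < 1 the tilting parameter
  attains the rate exactly. For \<beta> = 1 the supremum over t is approached only as t tends to
  infinity, and \<epsilon> pays for stopping at \<open>T\<close>.\<close>

lemma rate_J_le_Legendre:
  assumes \<delta>: "0 < \<delta>" and \<beta>: "\<beta> \<le> 1" and \<epsilon>: "0 < \<epsilon>"
  shows "\<exists>T\<ge>0. \<forall>r x. (\<lambda>y. r x y) \<in> borel_measurable unit_interval \<longrightarrow>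
      (\<forall>y\<in>{0..1}. \<delta> \<le> r x y \<and> r x y \<le> 1 - \<delta>) \<longrightarrow> (\<integral>y. r x y \<partial>unit_interval) \<le> \<beta> \<longrightarrow>
      (\<exists>t. 0 \<le> t \<and> t \<le> T \<and>
        rate_J r x \<beta> - \<epsilon> \<le> t * \<beta> - (\<integral>y. cumulant t (r x y) \<partial>unit_interval))"
proof (cases "\<beta> = 1")
  case False
  with \<beta> have \<beta>: "\<beta> < 1" by simp
  \<comment> \<open>The maximum with 0 makes the bound nonnegative even if no section satisfies the
    hypotheses.\<close>
  have "\<exists>t. 0 \<le> t \<and> t \<le> max 0 (tilt_cap \<delta> \<beta>) \<and>
        rate_J r x \<beta> - \<epsilon> \<le> t * \<beta> - (\<integral>y. cumulant t (r x y) \<partial>unit_interval)"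
    if "(\<lambda>y. r x y) \<in> borel_measurable unit_interval"
      "\<forall>y\<in>{0..1}. \<delta> \<le> r x y \<and> r x y \<le> 1 - \<delta>" "(\<integral>y. r x y \<partial>unit_interval) \<le> \<beta>" for r x
    using that \<epsilon> tilt_parameter[of r x \<delta> \<beta>] rate_J_less_1[of r x \<delta> \<beta>] \<delta> \<beta>
    by (intro exI[of _ "tilt_parameter r x \<beta>"]) auto
  then show ?thesis by (intro exI[of _ "max 0 (tilt_cap \<delta> \<beta>)"]) auto
next
  case True
  \<comment> \<open>At \<open>T\<close> the cumulant differs from ln b + T by at most (1 - b) exp (-
    T) / b, which is at most \<epsilon> because b \<ge> \<delta>.\<close>
  define T where "T = max 0 (- ln (\<delta> * \<epsilon>))"
  have T: "exp (- T) \<le> \<delta> * \<epsilon>"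
  proof -
    have "exp (- T) \<le> exp (ln (\<delta> * \<epsilon>))" by (simp add: T_def)
    then show ?thesis using \<delta> \<epsilon> by simp
  qed
  have "rate_J r x \<beta> - \<epsilon> \<le> T * \<beta> - (\<integral>y. cumulant T (r x y) \<partial>unit_interval)"
    if m: "(\<lambda>y. r x y) \<in> borel_measurable unit_interval"
      and b: "\<forall>y\<in>{0..1}. \<delta> \<le> r x y \<and> r x y \<le> 1 - \<delta>" for r x
  proof -
    have "cumulant T b \<le> ln b + T + \<epsilon>" if b: "\<delta> \<le> b" "b \<le> 1 - \<delta>" for b
    proof -
      have b0: "0 < b" using b \<delta> by simp
      have "1 - b + b * exp T = b * exp T * (1 + (1 - b) * exp (- T) / b)"
        using b0 by (simp add: field_simps exp_minus)
      moreover have "0 < 1 + (1 - b) * exp (- T) / b"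
        using b0 b \<delta> by (intro add_pos_nonneg divide_nonneg_pos mult_nonneg_nonneg) auto
      ultimately have "cumulant T b = ln b + T + ln (1 + (1 - b) * exp (- T) / b)"
        using b0 by (simp add: cumulant_def ln_mult)
      also have "ln (1 + (1 - b) * exp (- T) / b) \<le> (1 - b) * exp (- T) / b"
        using b0 b \<delta> by (intro ln_add_one_self_le_self divide_nonneg_pos mult_nonneg_nonneg) auto
      also have "\<dots> \<le> 1 * (\<delta> * \<epsilon>) / \<delta>"
        using b0 b \<delta> \<epsilon> T by (intro frac_le mult_mono) auto
      finally show ?thesis using \<delta> by simp
    qed
    note ub = this
    have r01: "0 \<le> r x y \<and> r x y \<le> 1" if "y \<in> {0..1}" for y using bspec[OF b that] \<delta> by simp
    have lnb: "\<bar>ln (r x y)\<bar> \<le> - ln \<delta>" if "y \<in> {0..1}" for y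
    proof -
      have "ln \<delta> \<le> ln (r x y)" "ln (r x y) \<le> 0" using bspec[OF b that] \<delta> by simp_all
      then show ?thesis by simp
    qed
    have lnint: "integrable unit_interval (\<lambda>y. ln (r x y))"
      using m lnb by (intro integrable_unit_interval_bounded[where B = "- ln \<delta>"]) auto
    have "(\<integral>y. cumulant T (r x y) \<partial>unit_interval) \<le> (\<integral>y. ln (r x y) + (T + \<epsilon>) \<partial>unit_interval)"
      using m r01 lnint ub b
      by (intro integral_unit_interval_mono integrable_cumulant Bochner_Integration.integrable_add)
        (auto simp: T_def add.assoc)
    also have "\<dots> = (\<integral>y. ln (r x y) \<partial>unit_interval) + (T + \<epsilon>)"
      using lnint unit_interval.prob_space by (subst Bochner_Integration.integral_add) auto
    also have "(\<integral>y. ln (r x y) \<partial>unit_interval) = - rate_J r x \<beta>"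
    proof -
      have "0 < r x y" if "y \<in> {0..1}" for y using bspec[OF b that] \<delta> by simp
      then show ?thesis unfolding True by (subst rate_J_1) auto
    qed
    finally show ?thesis using True by simp
  qed
  moreover have "T \<ge> 0" by (simp add: T_def)
  ultimately show ?thesis by (intro exI[of _ T]) auto
qed

text \<open>Room above \<open>\<beta>\<close> is what lets the law of large numbers give degree at least \<open>\<beta> N\<close> under the tilt.\<close>

lemma overshooting_tilt:
  assumes f: "(\<lambda>y. r x y) \<in> borel_measurable unit_interval"
      "\<And>y. y \<in> {0..1} \<Longrightarrow> \<delta> \<le> r x y \<and> r x y \<le> 1 - \<delta>"
    and \<delta>: "0 < \<delta>" and mean: "(\<integral>y. r x y \<partial>unit_interval) \<le> \<beta>" and \<beta>: "\<beta> < 1" and \<epsilon>: "0 < \<epsilon>"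
  shows "\<exists>t\<ge>0. \<beta> < (\<integral>y. tilt t (r x y) \<partial>unit_interval) \<and>
    t * (\<integral>y. tilt t (r x y) \<partial>unit_interval) - (\<integral>y. cumulant t (r x y) \<partial>unit_interval)
      \<le> rate_J r x \<beta> + \<epsilon>"
proof -
  let ?s = "tilt_parameter r x \<beta>"
  let ?m = "\<lambda>t. \<integral>y. tilt t (r x y) \<partial>unit_interval"
  let ?L = "\<lambda>t. \<integral>y. cumulant t (r x y) \<partial>unit_interval"
  note s = tilt_parameter[where r = r and x = x, OF f \<delta> mean \<beta>]
  \<comment> \<open>Raising the parameter by \<eta> raises the mean by at most \<eta> and hence the
    exponent by at most \<eta> (s + \<beta> + \<eta>), where \<beta> + \<eta> \<le> 2.\<close>
  define \<eta> where "\<eta> = min 1 (\<epsilon> / (?s + 2))"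
  have \<eta>: "0 < \<eta>" "\<eta> \<le> 1" using s(1) \<epsilon> by (auto simp: \<eta>_def)
  have \<eta>2: "\<eta> * (?s + 2) \<le> \<epsilon>"
  proof -
    have "\<eta> \<le> \<epsilon> / (?s + 2)" by (simp add: \<eta>_def)
    then show ?thesis using s(1) by (simp add: field_simps)
  qed
  have r01: "0 < r x y \<and> r x y < 1" if "y \<in> {0..1}" for y using f(2)[OF that] \<delta> by auto
  then have r01': "0 \<le> r x y \<and> r x y \<le> 1" if "y \<in> {0..1}" for y using that by force
  have "?m ?s < ?m (?s + \<eta>)"
    by (rule tilted_mean_strict_mono[OF f(1) r01]) (use \<eta> in auto)
  then have m1: "\<beta> < ?m (?s + \<eta>)" using s(3) by simp
  have m2: "?m (?s + \<eta>) \<le> \<beta> + \<eta>"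
    using tilted_mean_Lipschitz(2)[OF f(1) r01', of ?s "?s + \<eta>"] \<eta> s(3) by simp
  have L: "?L ?s \<le> ?L (?s + \<eta>)"
    using cumulant_mono_diff(1)[of _ ?s "?s + \<eta>"] r01' \<eta> s(1)
    by (intro integral_unit_interval_mono integrable_cumulant f(1)) auto
  have "(?s + \<eta>) * ?m (?s + \<eta>) \<le> (?s + \<eta>) * (\<beta> + \<eta>)"
    using m2 s(1) \<eta> by (intro mult_left_mono) auto
  also have "\<dots> = ?s * \<beta> + \<eta> * (?s + \<beta> + \<eta>)" by (simp add: algebra_simps)
  also have "\<eta> * (?s + \<beta> + \<eta>) \<le> \<eta> * (?s + 2)"
    using \<eta> \<beta> by (intro mult_left_mono) auto
  finally have "(?s + \<eta>) * ?m (?s + \<eta>) - ?L (?s + \<eta>) \<le> rate_J r x \<beta> + \<epsilon>"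
    using L \<eta>2 rate_J_less_1[where r = r and x = x, OF f \<delta> mean \<beta>] by simp
  with m1 s(1) \<eta>(1) show ?thesis by (intro exI[of _ "?s + \<eta>"]) auto
qed

section \<open>Degrees and cuts of the random graph\<close>

definition edges :: "nat \<Rightarrow> (nat \<times> nat) set" where
  "edges N = {(i, j). i < j \<and> j < N}"

definition edge :: "nat \<Rightarrow> nat \<Rightarrow> nat \<times> nat" where
  "edge i k = (min i k, max i k)"

definition incident :: "nat \<Rightarrow> nat \<times> nat \<Rightarrow> bool" where
  "incident i e \<longleftrightarrow> fst e = i \<or> snd e = i"

definition degree_of :: "nat \<Rightarrow> (nat \<times> nat \<Rightarrow> bool) \<Rightarrow> nat \<Rightarrow> real" where
  "degree_of N G i = real (card {k. k < N \<and> adjacent G i k})"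

lemma edges_subset: "edges N \<subseteq> {..<N} \<times> {..<N}"
  by (auto simp: edges_def)

lemma finite_edges [simp, intro]: "finite (edges N)"
  by (rule finite_subset[OF edges_subset]) simp

lemma card_edges_le: "card (edges N) \<le> N\<^sup>2"
  using card_mono[OF _ edges_subset, of N] by (simp add: power2_eq_square)

lemma adjacent_edge: "adjacent G i k \<longleftrightarrow> i \<noteq> k \<and> G (edge i k)"
  by (auto simp: adjacent_def edge_def min_def max_def)

lemma bij_betw_edge:
  assumes "i < N"
  shows "bij_betw (edge i) ({..<N} - {i}) {e \<in> edges N. incident i e}"
  unfolding bij_betw_def
proof
  show "inj_on (edge i) ({..<N} - {i})"
    by (auto simp: inj_on_def edge_def min_def max_def split: if_splits)
  show "edge i ` ({..<N} - {i}) = {e \<in> edges N. incident i e}"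
  proof safe
    fix a b assume "(a, b) \<in> edges N" "incident i (a, b)"
    then consider "a = i" "i < b" "b < N" | "b = i" "a < i"
      by (auto simp: edges_def incident_def)
    then show "(a, b) \<in> edge i ` ({..<N} - {i})"
    proof cases
      case 1
      then show ?thesis by (intro image_eqI[of _ _ b]) (auto simp: edge_def)
    next
      case 2
      then show ?thesis using assms by (intro image_eqI[of _ _ a]) (auto simp: edge_def)
    qed
  qed (use assms in \<open>auto simp: edges_def edge_def incident_def\<close>)
qed

lemma sum_incident:
  fixes f :: "nat \<times> nat \<Rightarrow> real"
  assumes "i < N"
  shows "(\<Sum>e\<in>edges N. of_bool (incident i e) * f e) = (\<Sum>k\<in>{..<N} - {i}. f (edge i k))"
proof -
  have "(\<Sum>e\<in>edges N. of_bool (incident i e) * f e) = (\<Sum>e\<in>{e \<in> edges N. incident i e}. f e)"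
    unfolding sum.inter_filter[OF finite_edges] by (intro sum.cong) auto
  also have "\<dots> = (\<Sum>k\<in>{..<N} - {i}. f (edge i k))"
    by (rule sum.reindex_bij_betw[OF bij_betw_edge[OF assms], symmetric])
  finally show ?thesis .
qed

text \<open>Turns a degree into a linear form in the independent edge indicators, so that the
  estimates for Bernoulli sums apply.\<close>

lemma degree_of_eq:
  assumes "i < N"
  shows "degree_of N G i = (\<Sum>e\<in>edges N. of_bool (incident i e) * of_bool (G e))"
proof -
  have "{k. k < N \<and> adjacent G i k} = {k \<in> {..<N} - {i}. G (edge i k)}"
    by (auto simp: adjacent_edge)
  then have "degree_of N G i = (\<Sum>k\<in>{..<N} - {i}. of_bool (G (edge i k)))"
    by (simp add: degree_of_def sum.If_cases of_bool_def Int_def)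
  then show ?thesis using sum_incident[OF assms, of "\<lambda>e. of_bool (G e)"] by simp
qed

section \<open>Tail bounds for degrees and cuts\<close>

locale edge_probabilities =
  fixes N :: nat and p :: "nat \<Rightarrow> nat \<Rightarrow> real"
  assumes p_bounds: "\<And>i j. i < N \<Longrightarrow> j < N \<Longrightarrow> 0 < p i j \<and> p i j < 1"
    and p_sym: "\<And>i j. i < N \<Longrightarrow> j < N \<Longrightarrow> p i j = p j i"
begin

definition random_graph :: "(nat \<times> nat \<Rightarrow> bool) pmf" where
  "random_graph = Pi_pmf (edges N) False (\<lambda>e. bernoulli_pmf (p (fst e) (snd e)))"

lemma p_edge: "i < N \<Longrightarrow> k < N \<Longrightarrow> p (fst (edge i k)) (snd (edge i k)) = p i k"
  using p_sym by (auto simp: edge_def min_def max_def)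

lemma p_edges: "e \<in> edges N \<Longrightarrow> 0 < p (fst e) (snd e) \<and> p (fst e) (snd e) < 1"
  using p_bounds by (auto simp: edges_def)

lemma prod_cumulant_incident:
  assumes i: "i < N"
  shows "(\<Prod>e\<in>edges N. 1 - p (fst e) (snd e) + p (fst e) (snd e) * exp (t * of_bool (incident i e)))
    = exp (\<Sum>k\<in>{..<N} - {i}. cumulant t (p i k))"
proof -
  have "1 - p (fst e) (snd e) + p (fst e) (snd e) * exp (t * of_bool (incident i e))
      = exp (of_bool (incident i e) * cumulant t (p (fst e) (snd e)))" if "e \<in> edges N" for e
    using p_edges[OF that] cumulant_arg_pos[of "p (fst e) (snd e)" t] by (simp add: cumulant_def)
  then have "(\<Prod>e\<in>edges N. 1 - p (fst e) (snd e) + p (fst e) (snd e) * exp (t * of_bool (incident i e)))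
      = (\<Prod>e\<in>edges N. exp (of_bool (incident i e) * cumulant t (p (fst e) (snd e))))"
    by (rule prod.cong[OF refl])
  also have "\<dots> = exp (\<Sum>k\<in>{..<N} - {i}. cumulant t (p (fst (edge i k)) (snd (edge i k))))"
    unfolding exp_sum[OF finite_edges, symmetric] sum_incident[OF i] ..
  also have "(\<Sum>k\<in>{..<N} - {i}. cumulant t (p (fst (edge i k)) (snd (edge i k)))) =
      (\<Sum>k\<in>{..<N} - {i}. cumulant t (p i k))"
    using p_edge[OF i] by (intro sum.cong) auto
  finally show ?thesis .
qed

text \<open>Chernoff's bound. The sum on the right includes the value p i i, which belongs to no
  edge, so that it is a full block average; the extra term is nonnegative since t \<ge> 0.\<close>

lemma degree_upper_tail:
  assumes i: "i < N" and t: "0 \<le> t"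
  shows "measure_pmf.prob random_graph {G. a \<le> degree_of N G i}
    \<le> exp (- (t * a) + (\<Sum>k<N. cumulant t (p i k)))"
proof -
  have "{G. a \<le> degree_of N G i} \<subseteq>
      {G. t * a \<le> (\<Sum>e\<in>edges N. t * of_bool (incident i e) * of_bool (G e))}"
  proof safe
    fix G assume "a \<le> degree_of N G i"
    from mult_left_mono[OF this t]
    show "t * a \<le> (\<Sum>e\<in>edges N. t * of_bool (incident i e) * of_bool (G e))"
      by (simp only: degree_of_eq[OF i] sum_distrib_left mult.assoc)
  qed
  then have "measure_pmf.prob random_graph {G. a \<le> degree_of N G i} \<le>
      measure_pmf.prob random_graph {G. t * a \<le> (\<Sum>e\<in>edges N. t * of_bool (incident i e) * of_bool (G e))}"
    by (rule measure_pmf.finite_measure_mono) simp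
  also have "\<dots> \<le> exp (- (t * a)) * exp (\<Sum>k\<in>{..<N} - {i}. cumulant t (p i k))"
    unfolding random_graph_def prod_cumulant_incident[OF i, symmetric] using p_edges
    by (intro exponential_Markov_bernoulli_sum) (auto simp: less_imp_le)
  also have "\<dots> \<le> exp (- (t * a)) * exp (\<Sum>k<N. cumulant t (p i k))"
    using p_bounds[OF i] cumulant_bounds(1)[OF _ _ t]
    by (simp, intro sum_mono2) (auto simp: less_imp_le)
  finally show ?thesis by (simp flip: exp_add)
qed

text \<open>Tilting only the edges at i moves the mean degree close to m. The tilted degree stays
  within \<eta> N of its mean with high probability, and on that window the likelihood ratio is
  bounded below.\<close>

lemma degree_lower_bound:
  assumes i: "i < N" and t: "0 \<le> t" and \<eta>: "0 \<le> \<eta>" "\<eta> \<le> 2"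
  defines "m \<equiv> \<Sum>k<N. tilt t (p i k)"
  shows "(1 - 2 * exp (- \<eta>\<^sup>2 * real N / 4)) *
      exp ((\<Sum>k<N. cumulant t (p i k)) - t - t * (m + \<eta> * real N))
    \<le> measure_pmf.prob random_graph {G. m - 1 - \<eta> * real N \<le> degree_of N G i}"
proof -
  define q where "q e = tilt (t * of_bool (incident i e)) (p (fst e) (snd e))" for e
  define Q where "Q = Pi_pmf (edges N) False (\<lambda>e. bernoulli_pmf (q e))"
  \<comment> \<open>The true tilted mean omits the diagonal. It differs from \<open>m\<close> by at
    most 1, whence the 1 in the event; the cumulant of the diagonal is at most t, whence the extra t
    in the exponent.\<close>
  define m' where "m' = (\<Sum>k\<in>{..<N} - {i}. tilt t (p i k))"
  have q: "0 \<le> q e \<and> q e \<le> 1" if "e \<in> edges N" for e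
    unfolding q_def using p_edges[OF that] by (intro tilt_bounds) auto
  have mean: "(\<Sum>e\<in>edges N. of_bool (incident i e) * q e) = m'"
    unfolding m'_def sum_incident[OF i] q_def
    using p_edge[OF i] by (intro sum.cong) (auto simp: incident_def edge_def min_def max_def)
  have m: "m = tilt t (p i i) + m'"
    unfolding m_def m'_def using i by (subst sum.remove[of _ i]) auto
  have mm': "m - 1 \<le> m'" "m' \<le> m"
    using m tilt_bounds[of "p i i" t] p_bounds[OF i i] by auto
  have sq: "(\<Sum>e\<in>edges N. (x * of_bool (incident i e))\<^sup>2) \<le> real N" if "\<bar>x\<bar> = 1" for x :: real
  proof -
    have "x\<^sup>2 = 1" using that by (metis power2_abs one_power2)
    then have "(\<Sum>e\<in>edges N. (x * of_bool (incident i e))\<^sup>2) = (\<Sum>e\<in>edges N. of_bool (incident i e) * 1)"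
      by (intro sum.cong refl) (auto simp: power_mult_distrib)
    also have "\<dots> = real (card ({..<N} - {i}))"
      unfolding sum_incident[OF i] by simp
    also have "\<dots> \<le> real N" using card_mono[of "{..<N}" "{..<N} - {i}"] by simp
    finally show ?thesis .
  qed
  \<comment> \<open>The sign x treats both tails at once. The choice l = \<eta> / 2 minimises - l
    \<eta> + l^2, and \<eta> \<le> 2 makes it admissible.\<close>
  have tail: "measure_pmf.prob Q {G. \<eta> * real N \<le> x * (degree_of N G i - m')}
      \<le> exp (- \<eta>\<^sup>2 * real N / 4)" if x: "\<bar>x\<bar> = 1" for x
  proof -
    have "x * (degree_of N G i - m') = (\<Sum>e\<in>edges N. (x * of_bool (incident i e)) * (of_bool (G e) - q e))" for G
      unfolding degree_of_eq[OF i] mean[symmetric]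
      by (simp only: right_diff_distrib sum_distrib_left sum_subtractf mult.assoc)
    then have "measure_pmf.prob Q {G. \<eta> * real N \<le> x * (degree_of N G i - m')}
        \<le> exp (- (\<eta> / 2) * (\<eta> * real N) + (\<eta> / 2)\<^sup>2 * (\<Sum>e\<in>edges N. (x * of_bool (incident i e))\<^sup>2))"
      unfolding Q_def using q \<eta> x
      by (simp only:) (intro bernoulli_sum_concentration, auto simp: abs_mult)
    also have "\<dots> \<le> exp (- (\<eta> / 2) * (\<eta> * real N) + (\<eta> / 2)\<^sup>2 * real N)"
      using mult_left_mono[OF sq[OF x], of "(\<eta> / 2)\<^sup>2"] by simp
    also have "- (\<eta> / 2) * (\<eta> * real N) + (\<eta> / 2)\<^sup>2 * real N = - \<eta>\<^sup>2 * real N / 4"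
      by (simp add: power2_eq_square field_simps)
    finally show ?thesis .
  qed
  define A where "A = {G. \<bar>degree_of N G i - m'\<bar> < \<eta> * real N}"
  have "1 = measure_pmf.prob Q (A \<union> ({G. \<eta> * real N \<le> 1 * (degree_of N G i - m')} \<union>
      {G. \<eta> * real N \<le> (- 1) * (degree_of N G i - m')}))"
  proof -
    have "A \<union> ({G. \<eta> * real N \<le> 1 * (degree_of N G i - m')} \<union>
        {G. \<eta> * real N \<le> (- 1) * (degree_of N G i - m')}) = UNIV"
      by (auto simp: A_def abs_if)
    then show ?thesis using measure_pmf.prob_space[of Q] by simp
  qed
  also have "\<dots> \<le> measure_pmf.prob Q A + (exp (- \<eta>\<^sup>2 * real N / 4) + exp (- \<eta>\<^sup>2 * real N / 4))"
    by (intro order_trans[OF measure_Un_le] add_mono tail order_refl) auto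
  finally have QA: "1 - 2 * exp (- \<eta>\<^sup>2 * real N / 4) \<le> measure_pmf.prob Q A"
    by simp
  have ub: "(\<Sum>e\<in>edges N. t * of_bool (incident i e) * of_bool (G e)) \<le> t * (m + \<eta> * real N)"
    if "G \<in> A" for G
  proof -
    have "degree_of N G i \<le> m + \<eta> * real N" using that mm' by (auto simp: A_def)
    from mult_left_mono[OF this t] show ?thesis
      by (simp only: degree_of_eq[OF i] sum_distrib_left mult.assoc)
  qed
  have le: "exp ((\<Sum>k<N. cumulant t (p i k)) - t - t * (m + \<eta> * real N)) \<le>
      exp (- (t * (m + \<eta> * real N))) * exp (\<Sum>k\<in>{..<N} - {i}. cumulant t (p i k))"
  proof -
    have "(\<Sum>k<N. cumulant t (p i k)) = cumulant t (p i i) + (\<Sum>k\<in>{..<N} - {i}. cumulant t (p i k))"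
      using i by (subst sum.remove[of _ i]) auto
    with cumulant_bounds(2)[of "p i i" t] p_bounds[OF i i] t show ?thesis
      by (simp flip: exp_add)
  qed
  have "(1 - 2 * exp (- \<eta>\<^sup>2 * real N / 4)) *
      exp ((\<Sum>k<N. cumulant t (p i k)) - t - t * (m + \<eta> * real N))
    \<le> measure_pmf.prob Q A *
      (exp (- (t * (m + \<eta> * real N))) * exp (\<Sum>k\<in>{..<N} - {i}. cumulant t (p i k)))"
    by (rule order_trans[OF mult_right_mono[OF QA] mult_left_mono[OF le]]) auto
  also have "\<dots> \<le> measure_pmf.prob random_graph A"
    unfolding random_graph_def Q_def q_def prod_cumulant_incident[OF i, symmetric]
    by (rule tilted_measure_lower_bound[OF finite_edges p_edges ub])
  also have "\<dots> \<le> measure_pmf.prob random_graph {G. m - 1 - \<eta> * real N \<le> degree_of N G i}"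
    using mm' by (intro measure_pmf.finite_measure_mono) (auto simp: A_def)
  finally show ?thesis .
qed

text \<open>Replaces the change of measure when the tilt is infinite: the presence of all edges at i
  is a product event. The diagonal term on the left only lowers it, because its logarithm is
  negative.\<close>

lemma full_degree_probability:
  assumes i: "i < N"
  shows "exp (\<Sum>k<N. ln (p i k))
    \<le> measure_pmf.prob random_graph {G. \<forall>k<N. k \<noteq> i \<longrightarrow> adjacent G i k}"
proof -
  define B where "B e = (if incident i e then {True} else UNIV)" for e
  have "exp (\<Sum>k<N. ln (p i k)) \<le> exp (\<Sum>k\<in>{..<N} - {i}. ln (p i k))"
    using i p_bounds[OF i i] by (subst sum.remove[of _ i]) auto
  also have "(\<Sum>k\<in>{..<N} - {i}. ln (p i k)) =
      (\<Sum>e\<in>edges N. of_bool (incident i e) * ln (p (fst e) (snd e)))"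
    unfolding sum_incident[OF i] using p_edge[OF i] by (intro sum.cong) auto
  also have "exp \<dots> = (\<Prod>e\<in>edges N. measure_pmf.prob (bernoulli_pmf (p (fst e) (snd e))) (B e))"
    unfolding exp_sum[OF finite_edges]
  proof (rule prod.cong[OF refl])
    fix e assume "e \<in> edges N"
    from p_edges[OF this]
    show "exp (of_bool (incident i e) * ln (p (fst e) (snd e))) =
        measure_pmf.prob (bernoulli_pmf (p (fst e) (snd e))) (B e)"
      by (auto simp: B_def measure_pmf_single)
  qed
  also have "\<dots> = measure_pmf.prob random_graph (Pi (edges N) B)"
    unfolding random_graph_def by (rule measure_Pi_pmf_Pi[OF finite_edges, symmetric])
  also have "\<dots> \<le> measure_pmf.prob random_graph {G. \<forall>k<N. k \<noteq> i \<longrightarrow> adjacent G i k}"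
  proof (intro measure_pmf.finite_measure_mono)
    show "Pi (edges N) B \<subseteq> {G. \<forall>k<N. k \<noteq> i \<longrightarrow> adjacent G i k}"
    proof safe
      fix G k assume G: "G \<in> Pi (edges N) B" and k: "k < N" "k \<noteq> i"
      have "edge i k \<in> {e \<in> edges N. incident i e}"
        using bij_betw_edge[OF i] k by (auto simp: bij_betw_def)
      then have "edge i k \<in> edges N" "incident i (edge i k)" by simp_all
      with Pi_mem[OF G, of "edge i k"] have "G (edge i k)" by (simp add: B_def)
      with k show "adjacent G i k" by (simp add: adjacent_edge)
    qed
  qed simp
  finally show ?thesis .
qed

text \<open>The mean minus the adjacency matrix, since the Laplacian contains the adjacency matrix
  with a negative sign. The diagonal vanishes because there are no loops.\<close>

definition centred :: "(nat \<times> nat \<Rightarrow> bool) \<Rightarrow> nat \<Rightarrow> nat \<Rightarrow> real" where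
  "centred G i j = (if i = j then 0 else p i j - of_bool (adjacent G i j))"

lemma sum_pairs_edges:
  fixes f :: "nat \<Rightarrow> nat \<Rightarrow> real"
  assumes "\<And>i. f i i = 0"
  shows "(\<Sum>i<N. \<Sum>j<N. f i j) = (\<Sum>e\<in>edges N. f (fst e) (snd e) + f (snd e) (fst e))"
proof -
  have "(\<Sum>i<N. \<Sum>j<N. f i j) = (\<Sum>(i, j)\<in>{..<N} \<times> {..<N}. f i j)"
    by (simp add: sum.cartesian_product)
  also have "\<dots> = (\<Sum>(i, j)\<in>edges N \<union> prod.swap ` edges N. f i j)"
  proof (rule sum.mono_neutral_right)
    show "\<forall>x\<in>{..<N} \<times> {..<N} - (edges N \<union> prod.swap ` edges N). (case x of (i, j) \<Rightarrow> f i j) = 0"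
    proof
      fix x assume x: "x \<in> {..<N} \<times> {..<N} - (edges N \<union> prod.swap ` edges N)"
      obtain i j where ij: "x = (i, j)" by (cases x)
      have *: "i \<in> {..<N}" "j \<in> {..<N}" "(i, j) \<notin> edges N" "(i, j) \<notin> prod.swap ` edges N"
        using x unfolding ij by simp_all
      have "i = j"
      proof (rule ccontr)
        assume "i \<noteq> j"
        with * have "j < i" by (auto simp: edges_def)
        then have "(j, i) \<in> edges N" using * by (auto simp: edges_def)
        then have "(i, j) \<in> prod.swap ` edges N" by force
        with * show False by simp
      qed
      with assms ij show "(case x of (i, j) \<Rightarrow> f i j) = 0" by simp
    qed
  qed (auto simp: edges_def)
  also have "\<dots> = (\<Sum>(i, j)\<in>edges N. f i j) + (\<Sum>(i, j)\<in>prod.swap ` edges N. f i j)"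
    by (intro sum.union_disjoint finite_imageI finite_edges) (auto simp: edges_def)
  also have "(\<Sum>(i, j)\<in>prod.swap ` edges N. f i j) = (\<Sum>e\<in>edges N. f (snd e) (fst e))"
    by (subst sum.reindex) (auto simp: case_prod_beta intro!: inj_on_subset[OF inj_swap])
  finally show ?thesis by (simp add: sum.distrib case_prod_beta)
qed

lemma cut_tail:
  fixes s u :: "nat \<Rightarrow> real"
  assumes s: "\<And>i. \<bar>s i\<bar> \<le> 1" and u: "\<And>i. \<bar>u i\<bar> \<le> 1" and \<eta>: "0 \<le> \<eta>" "\<eta> \<le> 4"
  shows "measure_pmf.prob random_graph
      {G. \<eta> * (real N)\<^sup>2 \<le> (\<Sum>i<N. \<Sum>j<N. s i * u j * centred G i j)}
    \<le> exp (- \<eta>\<^sup>2 * (real N)\<^sup>2 / 16)"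
proof -
  \<comment> \<open>An edge occurs in both orders, so its coefficient is at most 2 and the squares
    sum to at most 4 N^2. The parameter \<eta> / 8 used below minimises - l \<eta> + 4 l^2.\<close>
  define c where "c e = - (s (fst e) * u (snd e) + s (snd e) * u (fst e))" for e
  have prod_le: "\<bar>s i * u j\<bar> \<le> 1" for i j
    using mult_mono[OF s[of i] u[of j]] by (simp add: abs_mult)
  have c: "\<bar>c e\<bar> \<le> 2" for e
    using prod_le[of "fst e" "snd e"] prod_le[of "snd e" "fst e"] unfolding c_def by linarith
  have c2: "(c e)\<^sup>2 \<le> 4" for e
    using power_mono[OF c[of e], of 2] by simp
  have "(\<Sum>e\<in>edges N. (c e)\<^sup>2) \<le> 4 * real (card (edges N))"
    using sum_mono[of "edges N" "\<lambda>e. (c e)\<^sup>2" "\<lambda>_. 4"] c2 by (simp add: mult.commute)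
  also have "\<dots> \<le> 4 * (real N)\<^sup>2"
    using card_edges_le[of N] by (simp flip: of_nat_power)
  finally have csum: "(\<Sum>e\<in>edges N. (c e)\<^sup>2) \<le> 4 * (real N)\<^sup>2" .
  have "(\<Sum>i<N. \<Sum>j<N. s i * u j * centred G i j) =
      (\<Sum>e\<in>edges N. c e * (of_bool (G e) - p (fst e) (snd e)))" for G
  proof (subst sum_pairs_edges)
    show "(\<Sum>e\<in>edges N. s (fst e) * u (snd e) * centred G (fst e) (snd e) +
        s (snd e) * u (fst e) * centred G (snd e) (fst e)) =
      (\<Sum>e\<in>edges N. c e * (of_bool (G e) - p (fst e) (snd e)))"
    proof (rule sum.cong[OF refl])
      have ring: "a * (x - g) + b * (x - g) = - (a + b) * (g - x)" for a b x g :: real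
        by (simp add: algebra_simps)
      fix e assume e: "e \<in> edges N"
      then obtain i j where ij: "e = (i, j)" "i < j" "j < N" by (auto simp: edges_def)
      then have "p j i = p i j" using p_sym[of j i] by simp
      with ij have centred: "centred G i j = p i j - of_bool (G e)" "centred G j i = p i j - of_bool (G e)"
        by (auto simp: centred_def adjacent_def)
      show "s (fst e) * u (snd e) * centred G (fst e) (snd e) +
          s (snd e) * u (fst e) * centred G (snd e) (fst e) = c e * (of_bool (G e) - p (fst e) (snd e))"
        unfolding ij(1) c_def fst_conv snd_conv centred[unfolded ij(1)] by (rule ring)
    qed
  qed (simp add: centred_def)
  then have "measure_pmf.prob random_graph
      {G. \<eta> * (real N)\<^sup>2 \<le> (\<Sum>i<N. \<Sum>j<N. s i * u j * centred G i j)}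
    \<le> exp (- (\<eta> / 8) * (\<eta> * (real N)\<^sup>2) + (\<eta> / 8)\<^sup>2 * (\<Sum>e\<in>edges N. (c e)\<^sup>2))"
    unfolding random_graph_def
  proof (simp only:, intro bernoulli_sum_concentration)
    fix e assume "e \<in> edges N"
    show "\<eta> / 8 * \<bar>c e\<bar> \<le> 1"
      using mult_mono[of "\<eta> / 8" "1 / 2" "\<bar>c e\<bar>" 2] c[of e] \<eta> by simp
  qed (use p_edges \<eta> in \<open>auto simp: less_imp_le\<close>)
  also have "\<dots> \<le> exp (- (\<eta> / 8) * (\<eta> * (real N)\<^sup>2) + (\<eta> / 8)\<^sup>2 * (4 * (real N)\<^sup>2))"
    using mult_left_mono[OF csum, of "(\<eta> / 8)\<^sup>2"] by simp
  also have "- (\<eta> / 8) * (\<eta> * (real N)\<^sup>2) + (\<eta> / 8)\<^sup>2 * (4 * (real N)\<^sup>2) = - \<eta>\<^sup>2 * (real N)\<^sup>2 / 16"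
    by (simp add: power2_eq_square field_simps)
  finally show ?thesis .
qed

text \<open>Signs rather than 0/1 indicators, because the sign vectors are the vertices of the cube
  on which bilinear forms are maximised.\<close>

definition sign_cut :: "(nat \<times> nat \<Rightarrow> bool) \<Rightarrow> nat set \<Rightarrow> nat set \<Rightarrow> real" where
  "sign_cut G S T = (\<Sum>i<N. \<Sum>j<N. (if i \<in> S then 1 else - 1) * (if j \<in> T then 1 else - 1) * centred G i j)"

lemma all_cuts_tail:
  assumes \<eta>: "0 \<le> \<eta>" "\<eta> \<le> 4"
  shows "measure_pmf.prob random_graph
      {G. \<exists>S\<subseteq>{..<N}. \<exists>T\<subseteq>{..<N}. \<eta> * (real N)\<^sup>2 \<le> sign_cut G S T}
    \<le> 4 ^ N * exp (- \<eta>\<^sup>2 * (real N)\<^sup>2 / 16)"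
proof -
  let ?I = "Pow {..<N} \<times> Pow {..<N}"
  let ?A = "\<lambda>(S, T). {G. \<eta> * (real N)\<^sup>2 \<le> sign_cut G S T}"
  have "{G. \<exists>S\<subseteq>{..<N}. \<exists>T\<subseteq>{..<N}. \<eta> * (real N)\<^sup>2 \<le> sign_cut G S T} = (\<Union>x\<in>?I. ?A x)"
    by auto
  then have "measure_pmf.prob random_graph
      {G. \<exists>S\<subseteq>{..<N}. \<exists>T\<subseteq>{..<N}. \<eta> * (real N)\<^sup>2 \<le> sign_cut G S T}
    \<le> (\<Sum>x\<in>?I. measure_pmf.prob random_graph (?A x))"
    using measure_pmf.finite_measure_subadditive_finite[of ?I ?A random_graph] by simp
  also have "\<dots> \<le> (\<Sum>x\<in>?I. exp (- \<eta>\<^sup>2 * (real N)\<^sup>2 / 16))"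
  proof (rule sum_mono)
    fix x assume "x \<in> ?I"
    obtain S T where x: "x = (S, T)" by (cases x)
    show "measure_pmf.prob random_graph (?A x) \<le> exp (- \<eta>\<^sup>2 * (real N)\<^sup>2 / 16)"
      unfolding x prod.case sign_cut_def by (rule cut_tail[OF _ _ \<eta>]) auto
  qed
  also have "\<dots> = 4 ^ N * exp (- \<eta>\<^sup>2 * (real N)\<^sup>2 / 16)"
    by (simp add: card_cartesian_product card_Pow power_mult_distrib[symmetric])
  finally show ?thesis .
qed

end

section \<open>The largest eigenvalue of the Laplacian matrix\<close>

text \<open>The form is linear in each argument separately: with \<open>b\<close> fixed, each
  \<open>a i\<close> is replaced by the sign of its coefficient, then the same is done to
  \<open>b\<close> with the new signs in place.\<close>

lemma bilinear_le_signs: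
  fixes M :: "nat \<Rightarrow> nat \<Rightarrow> real"
  assumes a: "\<And>i. i < N \<Longrightarrow> \<bar>a i\<bar> \<le> 1" and b: "\<And>i. i < N \<Longrightarrow> \<bar>b i\<bar> \<le> 1"
  shows "\<exists>S\<subseteq>{..<N}. \<exists>T\<subseteq>{..<N}. (\<Sum>i<N. \<Sum>j<N. a i * b j * M i j) \<le>
    (\<Sum>i<N. \<Sum>j<N. (if i \<in> S then 1 else - 1) * (if j \<in> T then 1 else - 1) * M i j)"
proof -
  have half: "\<exists>S\<subseteq>{..<N}. (\<Sum>i<N. x i * c i) \<le> (\<Sum>i<N. (if i \<in> S then 1 else - 1) * c i)"
    if x: "\<And>i. i < N \<Longrightarrow> \<bar>x i\<bar> \<le> 1" for x c :: "nat \<Rightarrow> real"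
  proof (intro exI conjI)
    show "{i. i < N \<and> 0 \<le> c i} \<subseteq> {..<N}" by auto
    show "(\<Sum>i<N. x i * c i) \<le> (\<Sum>i<N. (if i \<in> {i. i < N \<and> 0 \<le> c i} then 1 else - 1) * c i)"
    proof (rule sum_mono)
      fix i assume "i \<in> {..<N}"
      then have "x i * c i \<le> 1 * \<bar>c i\<bar>"
        using mult_mono[OF x[of i] order_refl, of "\<bar>c i\<bar>"] abs_ge_self[of "x i * c i"]
        by (simp add: abs_mult)
      with \<open>i \<in> {..<N}\<close> show "x i * c i \<le> (if i \<in> {i. i < N \<and> 0 \<le> c i} then 1 else - 1) * c i"
        by auto
    qed
  qed
  obtain S where S: "S \<subseteq> {..<N}" "(\<Sum>i<N. a i * (\<Sum>j<N. b j * M i j)) \<le>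
      (\<Sum>i<N. (if i \<in> S then 1 else - 1) * (\<Sum>j<N. b j * M i j))"
    using half[where x = a and c = "\<lambda>i. \<Sum>j<N. b j * M i j"] a by auto
  define s :: "nat \<Rightarrow> real" where "s i = (if i \<in> S then 1 else - 1)" for i
  obtain T where T: "T \<subseteq> {..<N}" "(\<Sum>j<N. b j * (\<Sum>i<N. s i * M i j)) \<le>
      (\<Sum>j<N. (if j \<in> T then 1 else - 1) * (\<Sum>i<N. s i * M i j))"
    using half[where x = b and c = "\<lambda>j. \<Sum>i<N. s i * M i j"] b by auto
  have "(\<Sum>i<N. \<Sum>j<N. a i * b j * M i j) = (\<Sum>i<N. a i * (\<Sum>j<N. b j * M i j))"
    by (simp add: sum_distrib_left mult.assoc)
  also have "\<dots> \<le> (\<Sum>i<N. s i * (\<Sum>j<N. b j * M i j))"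
    using S(2) unfolding s_def .
  also have "\<dots> = (\<Sum>j<N. b j * (\<Sum>i<N. s i * M i j))"
    unfolding sum_distrib_left by (subst sum.swap) (simp add: mult_ac)
  also have "\<dots> \<le> (\<Sum>j<N. (if j \<in> T then 1 else - 1) * (\<Sum>i<N. s i * M i j))"
    by (rule T(2))
  also have "\<dots> = (\<Sum>i<N. \<Sum>j<N. s i * (if j \<in> T then 1 else - 1) * M i j)"
    unfolding sum_distrib_left by (subst sum.swap) (simp only: mult_ac)
  finally have "(\<Sum>i<N. \<Sum>j<N. a i * b j * M i j) \<le>
      (\<Sum>i<N. \<Sum>j<N. (if i \<in> S then 1 else - 1) * (if j \<in> T then 1 else - 1) * M i j)"
    unfolding s_def .
  then show ?thesis by (intro exI[of _ S] exI[of _ T] conjI S(1) T(1))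
qed

text \<open>
  The fourth power of the form is at most the squared Hilbert--Schmidt norm of \<open>M\<^sup>T M\<close>, a sum
  over 4-cycles; fixing two opposite indices leaves a bilinear form in \<open>M\<close> on the unit cube.
\<close>

lemma quadratic_form_fourth_power_le:
  fixes M :: "nat \<Rightarrow> nat \<Rightarrow> real"
  assumes M: "\<And>i j. i < N \<Longrightarrow> j < N \<Longrightarrow> \<bar>M i j\<bar> \<le> 1" and v: "(\<Sum>i<N. (v i)\<^sup>2) = 1"
    and K: "\<And>a b. (\<And>i. i < N \<Longrightarrow> \<bar>a i\<bar> \<le> 1) \<Longrightarrow> (\<And>i. i < N \<Longrightarrow> \<bar>b i\<bar> \<le> 1) \<Longrightarrow>
      (\<Sum>i<N. \<Sum>j<N. a i * b j * M i j) \<le> K"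
  shows "(\<Sum>i<N. \<Sum>j<N. v i * v j * M i j) ^ 4 \<le> (real N)\<^sup>2 * K"
proof -
  define W where "W k l = (\<Sum>i<N. M i k * M i l)" for k l
  let ?Q = "\<Sum>i<N. \<Sum>j<N. v i * v j * M i j"
  let ?R = "\<Sum>i<N. (\<Sum>j<N. v j * M i j)\<^sup>2"
  have "?Q = (\<Sum>i<N. v i * (\<Sum>j<N. v j * M i j))"
    by (simp add: sum_distrib_left mult.assoc)
  then have QR: "?Q\<^sup>2 \<le> ?R"
    using Cauchy_Schwarz_ineq_sum[of v "\<lambda>i. \<Sum>j<N. v j * M i j" "{..<N}"] v by simp
  have R: "?R = (\<Sum>k<N. \<Sum>l<N. v k * v l * W k l)"
  proof -
    have "?R = (\<Sum>i<N. \<Sum>k<N. \<Sum>l<N. v k * M i k * (v l * M i l))"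
      by (simp add: power2_eq_square sum_product)
    also have "\<dots> = (\<Sum>k<N. \<Sum>i<N. \<Sum>l<N. v k * M i k * (v l * M i l))"
      by (rule sum.swap)
    also have "\<dots> = (\<Sum>k<N. \<Sum>l<N. \<Sum>i<N. v k * M i k * (v l * M i l))"
      by (rule sum.cong[OF refl], rule sum.swap)
    also have "\<dots> = (\<Sum>k<N. \<Sum>l<N. v k * v l * W k l)"
      by (simp add: W_def sum_distrib_left mult_ac)
    finally show ?thesis .
  qed
  have "?R\<^sup>2 \<le> (\<Sum>k<N. \<Sum>l<N. (v k * v l)\<^sup>2) * (\<Sum>k<N. \<Sum>l<N. (W k l)\<^sup>2)"
    using Cauchy_Schwarz_ineq_sum[of "\<lambda>(k, l). v k * v l" "\<lambda>(k, l). W k l" "{..<N} \<times> {..<N}"]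
    unfolding R sum.cartesian_product by (simp add: case_prod_beta)
  also have "(\<Sum>k<N. \<Sum>l<N. (v k * v l)\<^sup>2) = 1"
    by (simp add: power_mult_distrib v flip: sum_product)
  \<comment> \<open>With \<open>j\<close> and \<open>l\<close> outermost, the inner sum is the
    bilinear form of \<open>M\<close> at the vectors \<open>M i l * M j l\<close> in
    \<open>i\<close> and \<open>M j k\<close> in \<open>k\<close>, whose entries are bounded by
    1.\<close>
  also have "(\<Sum>k<N. \<Sum>l<N. (W k l)\<^sup>2) = (\<Sum>j<N. \<Sum>l<N. \<Sum>i<N. \<Sum>k<N. (M i l * M j l) * M j k * M i k)"
  proof -
    have "(\<Sum>k<N. \<Sum>l<N. (W k l)\<^sup>2) = (\<Sum>k<N. \<Sum>l<N. \<Sum>i<N. \<Sum>j<N. M i k * M i l * (M j k * M j l))"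
      by (simp add: W_def power2_eq_square sum_product)
    also have "\<dots> = (\<Sum>l<N. \<Sum>k<N. \<Sum>i<N. \<Sum>j<N. M i k * M i l * (M j k * M j l))"
      by (rule sum.swap)
    also have "\<dots> = (\<Sum>l<N. \<Sum>k<N. \<Sum>j<N. \<Sum>i<N. M i k * M i l * (M j k * M j l))"
      by (rule sum.cong[OF refl], rule sum.cong[OF refl], rule sum.swap)
    also have "\<dots> = (\<Sum>l<N. \<Sum>j<N. \<Sum>k<N. \<Sum>i<N. M i k * M i l * (M j k * M j l))"
      by (rule sum.cong[OF refl], rule sum.swap)
    also have "\<dots> = (\<Sum>j<N. \<Sum>l<N. \<Sum>k<N. \<Sum>i<N. M i k * M i l * (M j k * M j l))"
      by (rule sum.swap)
    also have "\<dots> = (\<Sum>j<N. \<Sum>l<N. \<Sum>i<N. \<Sum>k<N. M i k * M i l * (M j k * M j l))"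
      by (rule sum.cong[OF refl], rule sum.cong[OF refl], rule sum.swap)
    finally show ?thesis by (simp add: mult_ac)
  qed
  also have "\<dots> \<le> (\<Sum>j<N. \<Sum>l<N. K)"
  proof (intro sum_mono K)
    fix i j l assume "j \<in> {..<N}" "l \<in> {..<N}" "i < N"
    then show "\<bar>M i l * M j l\<bar> \<le> 1"
      using mult_mono[OF M[of i l] M[of j l]] by (simp add: abs_mult)
  qed (use M in auto)
  also have "1 * (\<Sum>j<N. \<Sum>l<N. K) = (real N)\<^sup>2 * K"
    by (simp add: power2_eq_square)
  finally have "?R\<^sup>2 \<le> (real N)\<^sup>2 * K" by simp
  moreover have "(?Q\<^sup>2)\<^sup>2 \<le> ?R\<^sup>2"
    using QR by (intro power_mono) auto
  moreover have "?Q ^ 4 = (?Q\<^sup>2)\<^sup>2" by (simp flip: power_mult)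
  ultimately show ?thesis by linarith
qed

section \<open>The Laplacian matrix and its quadratic form\<close>

lemma laplacian_carrier: "laplacian_matrix N G \<in> carrier_mat N N"
  unfolding laplacian_matrix_def adjacency_matrix_def by (intro minus_carrier_mat mat_carrier)

lemma adjacent_sym: "adjacent G i j \<longleftrightarrow> adjacent G j i"
  by (auto simp: adjacent_def)

lemma laplacian_entry: "i < N \<Longrightarrow> j < N \<Longrightarrow> laplacian_matrix N G $$ (i, j) =
    (if i = j then degree_of N G i else 0) - of_bool (adjacent G i j)"
  by (simp add: laplacian_matrix_def adjacency_matrix_def degree_matrix_def degree_of_def)

lemma laplacian_symmetric: "transpose_mat (laplacian_matrix N G) = laplacian_matrix N G"
proof (rule eq_matI)
  fix i j assume "i < dim_row (laplacian_matrix N G)" "j < dim_col (laplacian_matrix N G)"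
  then have "i < N" "j < N" using laplacian_carrier[of N G] by auto
  then show "transpose_mat (laplacian_matrix N G) $$ (i, j) = laplacian_matrix N G $$ (i, j)"
    using laplacian_carrier[of N G] adjacent_sym[of G i j] by (simp add: laplacian_entry)
qed (use laplacian_carrier[of N G] in auto)

lemma laplacian_mult_vec:
  assumes v: "v \<in> carrier_vec N" and i: "i < N"
  shows "(laplacian_matrix N G *\<^sub>v v) $ i =
    degree_of N G i * v $ i - (\<Sum>j<N. of_bool (adjacent G i j) * v $ j)"
proof -
  have "(laplacian_matrix N G *\<^sub>v v) $ i = (\<Sum>j<N. laplacian_matrix N G $$ (i, j) * v $ j)"
    using v i laplacian_carrier[of N G] by (auto simp: scalar_prod_def atLeast0LessThan intro!: sum.cong)
  also have "\<dots> = (\<Sum>j<N. (if j = i then degree_of N G i * v $ i else 0) - of_bool (adjacent G i j) * v $ j)"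
    using i by (intro sum.cong refl) (auto simp: laplacian_entry left_diff_distrib)
  also have "\<dots> = degree_of N G i * v $ i - (\<Sum>j<N. of_bool (adjacent G i j) * v $ j)"
    using i by (simp add: sum_subtractf)
  finally show ?thesis .
qed

text \<open>The Rayleigh quotient at a unit vector is a diagonal entry of the Laplacian.\<close>

lemma degree_le_largest_eigenvalue:
  assumes i: "i < N"
  shows "degree_of N G i \<le> largest_eigenvalue (laplacian_matrix N G)"
proof -
  let ?L = "laplacian_matrix N G" and ?e = "unit_vec N i :: real vec"
  have n: "N > 0" using i by simp
  have e: "?e \<in> carrier_vec N" by simp
  have Le: "?L *\<^sub>v ?e \<in> carrier_vec N" using laplacian_carrier[of N G] by auto
  have "?e \<bullet> (?L *\<^sub>v ?e) = (?L *\<^sub>v ?e) $ i"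
    using i Le by (simp add: scalar_prod_left_unit)
  also have "\<dots> = degree_of N G i * ?e $ i - (\<Sum>j<N. of_bool (adjacent G i j) * ?e $ j)"
    by (rule laplacian_mult_vec[OF e i])
  also have "(\<Sum>j<N. of_bool (adjacent G i j) * ?e $ j) = 0"
    using i by (intro sum.neutral) (auto simp: adjacent_def unit_vec_def)
  finally have "?e \<bullet> (?L *\<^sub>v ?e) = degree_of N G i" using i by simp
  moreover have "?e \<bullet> ?e = 1" using i by (simp add: scalar_prod_left_unit)
  ultimately show ?thesis
    using symmetric_Max_spectrum(3)[OF laplacian_carrier laplacian_symmetric n e, of G] by simp
qed

text \<open>The eigenvector is \<open>N e\<^sub>i - 1\<close>.\<close>

lemma full_degree_largest_eigenvalue:
  assumes i: "i < N" and N: "N \<ge> 2" and full: "\<forall>k<N. k \<noteq> i \<longrightarrow> adjacent G i k"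
  shows "real N \<le> largest_eigenvalue (laplacian_matrix N G)"
proof -
  let ?L = "laplacian_matrix N G"
  define v where "v = vec N (\<lambda>k. if k = i then real N - 1 else - 1)"
  have v: "v \<in> carrier_vec N" by (simp add: v_def)
  have vk: "v $ k = (if k = i then real N else 0) - 1" if "k < N" for k
    using that by (simp add: v_def)
  have sum_adj: "(\<Sum>j<N. of_bool (adjacent G k j)) = degree_of N G k" for k
    by (simp add: degree_of_def of_bool_def sum.If_cases Int_def)
  have "?L *\<^sub>v v = real N \<cdot>\<^sub>v v"
  proof (rule eq_vecI)
    fix k assume "k < dim_vec (real N \<cdot>\<^sub>v v)"
    then have k: "k < N" by (simp add: v_def)
    have "(\<Sum>j<N. of_bool (adjacent G k j) * v $ j) =
        (\<Sum>j<N. (if j = i then real N * of_bool (adjacent G k i) else 0) - of_bool (adjacent G k j))"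
      by (intro sum.cong refl) (auto simp: vk)
    also have "\<dots> = real N * of_bool (adjacent G k i) - degree_of N G k"
      using i by (simp only: sum_subtractf sum_adj) simp
    finally have eq: "(?L *\<^sub>v v) $ k =
        degree_of N G k * v $ k - (real N * of_bool (adjacent G k i) - degree_of N G k)"
      by (simp add: laplacian_mult_vec[OF v k])
    show "(?L *\<^sub>v v) $ k = (real N \<cdot>\<^sub>v v) $ k"
    proof (cases "k = i")
      case True
      have "{k. k < N \<and> adjacent G i k} = {..<N} - {i}"
        using full by (auto simp: adjacent_def)
      then have deg: "degree_of N G i = real N - 1"
        using i by (simp add: degree_of_def of_nat_diff)
      have vi: "v $ i = real N - 1" using vk[OF i] by simp
      have "\<not> adjacent G i i" by (simp add: adjacent_def)
      then show ?thesis
        unfolding eq unfolding True using i v by (simp add: deg vi) (simp add: algebra_simps)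
    next
      case False
      then have "adjacent G k i" using full k adjacent_sym[of G k i] by simp
      then show ?thesis unfolding eq using False k v vk[OF k] by simp
    qed
  qed (use v laplacian_carrier[of N G] in auto)
  \<comment> \<open>Its entry at i is N - 1, which is nonzero because N \<ge> 2.\<close>
  moreover have "v \<noteq> 0\<^sub>v N"
  proof
    assume "v = 0\<^sub>v N"
    then have "v $ i = 0" using i by simp
    then show False using vk[OF i] N by simp
  qed
  ultimately have "eigenvalue ?L (real N)"
    unfolding eigenvalue_def eigenvector_def using v laplacian_carrier[of N G] by auto
  then show ?thesis
    using symmetric_Max_spectrum(2)[OF laplacian_carrier laplacian_symmetric] i by simp
qed

lemma largest_eigenvalue_laplacian_form:
  assumes N: "N > 0"
  shows "\<exists>v. (\<Sum>i<N. (v i)\<^sup>2) = 1 \<and> largest_eigenvalue (laplacian_matrix N G) =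
    (\<Sum>i<N. degree_of N G i * (v i)\<^sup>2) - (\<Sum>i<N. \<Sum>j<N. v i * v j * of_bool (adjacent G i j))"
proof -
  let ?L = "laplacian_matrix N G"
  let ?l = "largest_eigenvalue ?L"
  have "eigenvalue ?L ?l"
    by (rule symmetric_Max_spectrum(1)[OF laplacian_carrier laplacian_symmetric N])
  then obtain w where w: "w \<in> carrier_vec N" "w \<noteq> 0\<^sub>v N" "?L *\<^sub>v w = ?l \<cdot>\<^sub>v w"
    unfolding eigenvalue_def eigenvector_def using laplacian_carrier[of N G] by auto
  define c where "c = (\<Sum>i<N. (w $ i)\<^sup>2)"
  have c: "c > 0"
  proof -
    obtain i where i: "i < N" "w $ i \<noteq> 0"
      using w(1,2) by (metis carrier_vecD eq_vecI index_zero_vec)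
    have "0 < (w $ i)\<^sup>2" using i by simp
    also have "\<dots> \<le> c" unfolding c_def using i by (intro member_le_sum) auto
    finally show ?thesis .
  qed
  define v where "v i = w $ i / sqrt c" for i
  have vv: "v i * v j = w $ i * w $ j / c" for i j
    using c by (simp add: v_def)
  then have v2: "(v i)\<^sup>2 = (w $ i)\<^sup>2 / c" for i
    by (simp add: power2_eq_square)
  have "?l * c = (\<Sum>i<N. w $ i * (?l \<cdot>\<^sub>v w) $ i)"
    using w(1) by (simp add: c_def sum_distrib_left power2_eq_square mult_ac)
  also have "\<dots> = (\<Sum>i<N. w $ i * (degree_of N G i * w $ i - (\<Sum>j<N. of_bool (adjacent G i j) * w $ j)))"
    unfolding w(3)[symmetric] by (intro sum.cong refl) (simp add: laplacian_mult_vec[OF w(1)])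
  also have "\<dots> = (\<Sum>i<N. degree_of N G i * (w $ i)\<^sup>2) - (\<Sum>i<N. \<Sum>j<N. w $ i * w $ j * of_bool (adjacent G i j))"
    unfolding right_diff_distrib sum_subtractf sum_distrib_left power2_eq_square
    by (simp only: mult_ac)
  finally have l: "?l = ((\<Sum>i<N. degree_of N G i * (w $ i)\<^sup>2) -
      (\<Sum>i<N. \<Sum>j<N. w $ i * w $ j * of_bool (adjacent G i j))) / c"
    using c by (simp add: field_simps)
  have "(\<Sum>i<N. (v i)\<^sup>2) = 1"
    unfolding v2 sum_divide_distrib[symmetric] c_def[symmetric] using c by simp
  moreover have "?l = (\<Sum>i<N. degree_of N G i * (v i)\<^sup>2) -
      (\<Sum>i<N. \<Sum>j<N. v i * v j * of_bool (adjacent G i j))"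
    unfolding l v2 vv diff_divide_distrib sum_divide_distrib by simp
  ultimately show ?thesis by blast
qed

context edge_probabilities
begin

text \<open>At a unit top eigenvector the degree part is at most d, and - A splits into the centred
  matrix plus the diagonal of p minus p itself. These three contribute at most \<eta> N, 1 and
  \<kappa>. The cuts are measured against \<eta>^4 because they control the fourth power of the
  form.\<close>

lemma largest_eigenvalue_le:
  assumes N: "N \<ge> 1" and deg: "\<And>i. i < N \<Longrightarrow> degree_of N G i \<le> d"
    and cuts: "\<And>S T. S \<subseteq> {..<N} \<Longrightarrow> T \<subseteq> {..<N} \<Longrightarrow> sign_cut G S T \<le> \<eta> ^ 4 * (real N)\<^sup>2"
    and \<eta>: "0 \<le> \<eta>"
    and psd: "\<And>v. - \<kappa> * (\<Sum>i<N. (v i)\<^sup>2) \<le> (\<Sum>i<N. \<Sum>j<N. v i * v j * p i j)"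
  shows "largest_eigenvalue (laplacian_matrix N G) \<le> d + \<kappa> + 1 + \<eta> * real N"
proof -
  obtain v where v: "(\<Sum>i<N. (v i)\<^sup>2) = 1" and l: "largest_eigenvalue (laplacian_matrix N G) =
      (\<Sum>i<N. degree_of N G i * (v i)\<^sup>2) - (\<Sum>i<N. \<Sum>j<N. v i * v j * of_bool (adjacent G i j))"
    using largest_eigenvalue_laplacian_form[of N G] N by auto
  have "(\<Sum>i<N. degree_of N G i * (v i)\<^sup>2) \<le> (\<Sum>i<N. d * (v i)\<^sup>2)"
    using deg by (intro sum_mono mult_right_mono) auto
  then have 1: "(\<Sum>i<N. degree_of N G i * (v i)\<^sup>2) \<le> d"
    by (simp add: v flip: sum_distrib_left)
  have entry: "\<bar>centred G i j\<bar> \<le> 1" if "i < N" "j < N" for i j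
    using p_bounds[OF that] by (auto simp: centred_def)
  have "(\<Sum>i<N. \<Sum>j<N. v i * v j * centred G i j) ^ 4 \<le> (real N)\<^sup>2 * (\<eta> ^ 4 * (real N)\<^sup>2)"
  proof (rule quadratic_form_fourth_power_le[OF entry v])
    fix a b :: "nat \<Rightarrow> real"
    assume ab: "\<And>i. i < N \<Longrightarrow> \<bar>a i\<bar> \<le> 1" "\<And>i. i < N \<Longrightarrow> \<bar>b i\<bar> \<le> 1"
    have "\<exists>S\<subseteq>{..<N}. \<exists>T\<subseteq>{..<N}. (\<Sum>i<N. \<Sum>j<N. a i * b j * centred G i j) \<le> sign_cut G S T"
      unfolding sign_cut_def by (rule bilinear_le_signs[OF ab])
    then obtain S T where ST: "S \<subseteq> {..<N}" "T \<subseteq> {..<N}"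
      "(\<Sum>i<N. \<Sum>j<N. a i * b j * centred G i j) \<le> sign_cut G S T"
      by blast
    with cuts[OF ST(1,2)] show "(\<Sum>i<N. \<Sum>j<N. a i * b j * centred G i j) \<le> \<eta> ^ 4 * (real N)\<^sup>2"
      by linarith
  qed
  also have "\<dots> = (\<eta> * real N) ^ 4"
    unfolding power_mult_distrib by (simp flip: power_add)
  finally have "(\<Sum>i<N. \<Sum>j<N. v i * v j * centred G i j) ^ Suc 3 \<le> (\<eta> * real N) ^ Suc 3"
    by (simp del: power_Suc)
  then have 2: "(\<Sum>i<N. \<Sum>j<N. v i * v j * centred G i j) \<le> \<eta> * real N"
    using \<eta> by (rule power_le_imp_le_base[OF _ mult_nonneg_nonneg]) simp
  \<comment> \<open>The centred matrix has zero diagonal whereas p does not; the difference is the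
    correction bounded by 1.\<close>
  have "(\<Sum>i<N. \<Sum>j<N. v i * v j * centred G i j) =
      (\<Sum>i<N. \<Sum>j<N. v i * v j * p i j - v i * v j * of_bool (adjacent G i j) -
        (if j = i then (v i)\<^sup>2 * p i i else 0))"
    by (intro sum.cong refl) (auto simp: centred_def adjacent_def power2_eq_square right_diff_distrib)
  also have "\<dots> = (\<Sum>i<N. \<Sum>j<N. v i * v j * p i j) -
      (\<Sum>i<N. \<Sum>j<N. v i * v j * of_bool (adjacent G i j)) - (\<Sum>i<N. (v i)\<^sup>2 * p i i)"
    by (simp add: sum_subtractf)
  finally have 3: "- (\<Sum>i<N. \<Sum>j<N. v i * v j * of_bool (adjacent G i j)) =
      (\<Sum>i<N. \<Sum>j<N. v i * v j * centred G i j) + (\<Sum>i<N. (v i)\<^sup>2 * p i i) -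
      (\<Sum>i<N. \<Sum>j<N. v i * v j * p i j)" by linarith
  have "(\<Sum>i<N. (v i)\<^sup>2 * p i i) \<le> (\<Sum>i<N. (v i)\<^sup>2 * 1)"
    using p_bounds by (intro sum_mono mult_left_mono) (auto simp: less_imp_le)
  then have 4: "(\<Sum>i<N. (v i)\<^sup>2 * p i i) \<le> 1" using v by simp
  have 5: "- \<kappa> \<le> (\<Sum>i<N. \<Sum>j<N. v i * v j * p i j)" using psd[of v] unfolding v by simp
  show ?thesis using l 1 2 3 4 5 by linarith
qed

end

section \<open>Graphon operators and convergence of block averages\<close>

lemma square_integral_le_integral_square:
  fixes u :: "real \<Rightarrow> real"
  assumes u: "u \<in> L2"
  shows "integrable unit_interval u" "(\<integral>x. \<bar>u x\<bar> \<partial>unit_interval)\<^sup>2 \<le> (\<integral>x. (u x)\<^sup>2 \<partial>unit_interval)"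
proof -
  have m [measurable]: "u \<in> borel_measurable unit_interval"
    and sq: "integrable unit_interval (\<lambda>x. (u x)\<^sup>2)" using u by (auto simp: L2_def)
  show int: "integrable unit_interval u"
    by (rule unit_interval.square_integrable_imp_integrable[OF m sq])
  have "0 \<le> unit_interval.variance (\<lambda>x. \<bar>u x\<bar>)"
    by (rule unit_interval.variance_positive)
  also have "\<dots> = (\<integral>x. \<bar>u x\<bar>\<^sup>2 \<partial>unit_interval) - (\<integral>x. \<bar>u x\<bar> \<partial>unit_interval)\<^sup>2"
    using int sq by (intro unit_interval.variance_eq) auto
  finally show "(\<integral>x. \<bar>u x\<bar> \<partial>unit_interval)\<^sup>2 \<le> (\<integral>x. (u x)\<^sup>2 \<partial>unit_interval)" by simp
qed

text \<open>Only boundedness matters: it makes the real-valued supremum in \<open>L2_onorm\<close>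
  an actual upper bound. The constant arises from (a + b)^2 \<le> 2 a^2 + 2 b^2 and the comparison
  of the L1 and L2 norms.\<close>

lemma laplacian_operator_ratio_le:
  assumes h: "graphon h" and u: "u \<in> L2"
  shows "L2_norm (laplacian_operator h u) / L2_norm u \<le> 2"
proof -
  define q where "q = (\<integral>x. (u x)\<^sup>2 \<partial>unit_interval)"
  define c where "c = (\<integral>x. \<bar>u x\<bar> \<partial>unit_interval)"
  have sq: "integrable unit_interval (\<lambda>x. (u x)\<^sup>2)" using u by (simp add: L2_def)
  note int = square_integral_le_integral_square[OF u]
  have cq: "c\<^sup>2 \<le> q" using int(2) by (simp add: c_def q_def)
  have c0: "0 \<le> c" by (simp add: c_def)
  have q0: "0 \<le> q" by (simp add: q_def)
  have L: "\<bar>laplacian_operator h u x\<bar> \<le> \<bar>u x\<bar> + c" if x: "x \<in> {0..1}" for x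
  proof -
    have "\<bar>laplacian_operator h u x\<bar> \<le> (\<integral>y. \<bar>h x y * (u x - u y)\<bar> \<partial>unit_interval)"
      unfolding laplacian_operator_def using integral_norm_bound[of unit_interval "\<lambda>y. h x y * (u x - u y)"]
      by simp
    also have "\<dots> \<le> (\<integral>y. \<bar>u x\<bar> + \<bar>u y\<bar> \<partial>unit_interval)"
    proof (rule integral_mono')
      fix y assume "y \<in> space unit_interval"
      then have "0 \<le> h x y \<and> h x y \<le> 1" using graphon_bounds[OF h x] by simp
      then have "\<bar>h x y * (u x - u y)\<bar> \<le> 1 * \<bar>u x - u y\<bar>"
        unfolding abs_mult by (intro mult_right_mono) auto
      then show "\<bar>h x y * (u x - u y)\<bar> \<le> \<bar>u x\<bar> + \<bar>u y\<bar>"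
        by (rule order_trans) (use abs_triangle_ineq4[of "u x" "u y"] in simp)
    qed (use int(1) in auto)
    also have "\<dots> = \<bar>u x\<bar> + c"
      unfolding c_def using int(1) unit_interval.prob_space
      by (subst Bochner_Integration.integral_add) auto
    finally show ?thesis .
  qed
  have "(\<integral>x. (laplacian_operator h u x)\<^sup>2 \<partial>unit_interval) \<le> (\<integral>x. 2 * (u x)\<^sup>2 + 2 * q \<partial>unit_interval)"
  proof (rule integral_mono')
    fix x assume "x \<in> space unit_interval"
    then have "\<bar>laplacian_operator h u x\<bar>\<^sup>2 \<le> (\<bar>u x\<bar> + c)\<^sup>2"
      using L[of x] by (intro power_mono) auto
    also have "\<dots> \<le> 2 * (u x)\<^sup>2 + 2 * c\<^sup>2"
      using sum_squares_bound[of "\<bar>u x\<bar>" c] by (simp add: power2_sum)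
    finally show "(laplacian_operator h u x)\<^sup>2 \<le> 2 * (u x)\<^sup>2 + 2 * q" using cq by simp
  qed (use sq q0 in auto)
  also have "\<dots> = 2\<^sup>2 * q"
    using sq unit_interval.prob_space
    by (subst Bochner_Integration.integral_add) (auto simp: q_def)
  finally have "L2_norm (laplacian_operator h u) \<le> sqrt (2\<^sup>2 * q)"
    unfolding L2_norm_def L2_inner_def by (simp add: power2_eq_square)
  also have "\<dots> = 2 * L2_norm u"
    unfolding L2_norm_def L2_inner_def real_sqrt_mult q_def by (simp add: power2_eq_square)
  finally have "L2_norm (laplacian_operator h u) \<le> 2 * L2_norm u" .
  moreover have "0 \<le> L2_norm u" by (simp add: L2_norm_def L2_inner_def)
  ultimately show ?thesis by (cases "L2_norm u = 0") (auto simp: field_simps)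
qed

lemma laplacian_operator_ratio_le_onorm:
  assumes h: "graphon h" and u: "u \<in> L2"
  shows "L2_norm (laplacian_operator h u) / L2_norm u \<le> L2_onorm (laplacian_operator h)"
  unfolding L2_onorm_def using laplacian_operator_ratio_le[OF h]
  by (intro cSUP_upper[OF u] bdd_aboveI2[where M = 2])

lemma L2_onorm_laplacian_nonneg:
  assumes h: "graphon h"
  shows "0 \<le> L2_onorm (laplacian_operator h)"
proof -
  have "(\<lambda>_. 0) \<in> L2" by (simp add: L2_def)
  from laplacian_operator_ratio_le_onorm[OF h this] show ?thesis
    by (simp add: L2_norm_def L2_inner_def)
qed

lemma graphon_measurable_pair:
  "graphon h \<Longrightarrow> (\<lambda>z. h (fst z) (snd z)) \<in> borel_measurable (unit_interval \<Otimes>\<^sub>M unit_interval)"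
  by (simp add: graphon_def case_prod_beta')

lemma degree_function_measurable:
  assumes h: "graphon h"
  shows "(\<lambda>x. \<integral>y. h x y \<partial>unit_interval) \<in> borel_measurable unit_interval"
  using graphon_measurable_pair[OF h]
  by (intro unit_interval.borel_measurable_lebesgue_integral) (simp add: case_prod_beta')

text \<open>
  Testing the operator norm with the indicator of a small set on which the degree function is
  large bounds the degree function almost everywhere: on that set the averaging part of the
  Laplacian contributes at most the measure of the set.
\<close>

lemma AE_degree_function_le_onorm:
  assumes h: "graphon h"
  shows "AE x in unit_interval. (\<integral>y. h x y \<partial>unit_interval) \<le> L2_onorm (laplacian_operator h)"
proof -
  let ?C = "L2_onorm (laplacian_operator h)"
  let ?d = "\<lambda>x. \<integral>y. h x y \<partial>unit_interval"
  note [measurable] = graphon_measurable_pair[OF h] degree_function_measurable[OF h]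
  have C0: "0 \<le> ?C" by (rule L2_onorm_laplacian_nonneg[OF h])
  have null: "AE x in unit_interval. x \<in> block M i \<longrightarrow> ?d x \<le> ?C + 1 / real M" if i: "i < M" for i M
  proof -
    \<comment> \<open>Cutting with a block of measure 1/M bounds the averaging part by 1/M, exactly
      the excess that membership in \<open>B\<close> demands.\<close>
    define B where "B = {x \<in> space unit_interval. x \<in> block M i \<and> ?C + 1 / real M < ?d x}"
    note [measurable] = sets_block[OF i]
    have B [measurable]: "B \<in> sets unit_interval" unfolding B_def by measurable
    have B01: "B \<subseteq> {0..1}" by (auto simp: B_def)
    have mB: "measure unit_interval B \<le> 1 / real M"
    proof -
      have "measure unit_interval B \<le> measure unit_interval (block M i)"
        by (intro unit_interval.finite_measure_mono sets_block[OF i]) (auto simp: B_def)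
      also have "\<dots> = 1 / real M" by (simp add: measure_def emeasure_block[OF i])
      finally show ?thesis .
    qed
    have "emeasure unit_interval B = 0"
    proof (rule ccontr)
      assume pos: "emeasure unit_interval B \<noteq> 0"
      let ?u = "indicator B :: real \<Rightarrow> real"
      let ?Lu = "laplacian_operator h ?u"
      have usq: "(?u x)\<^sup>2 = ?u x" for x by (simp add: indicator_def)
      have uint: "integrable unit_interval ?u"
        using B B01 by (simp add: integrable_indicator_iff Int_absorb2 unit_interval.emeasure_finite less_top[symmetric])
      have u: "?u \<in> L2" using uint by (simp add: L2_def usq)
      have normu: "L2_norm ?u = sqrt (measure unit_interval B)"
        using B01 by (simp add: L2_norm_def L2_inner_def usq Int_absorb2 flip: power2_eq_square)
      have mpos: "measure unit_interval B > 0"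
        using pos by (simp add: unit_interval.emeasure_eq_measure zero_less_measure_iff)
      have hsec: "(\<lambda>y. h x y) \<in> borel_measurable unit_interval" if "x \<in> {0..1}" for x
        by (rule graphon_section_measurable[OF h that])
      have hint: "integrable unit_interval (\<lambda>y. h x y)" if "x \<in> {0..1}" for x
        using graphon_bounds[OF h that] by (intro integrable_unit_interval_bounded[where B = 1] hsec that) auto
      have huint: "integrable unit_interval (\<lambda>y. h x y * ?u y)" if "x \<in> {0..1}" for x
        using graphon_bounds[OF h that] B
        by (intro integrable_unit_interval_bounded[where B = 1] borel_measurable_times hsec that)
          (auto simp: indicator_def)
      have Lu_B: "?C < ?Lu x" if x: "x \<in> B" for x
      proof -
        have x01: "x \<in> {0..1}" using x B01 by auto
        have "?Lu x = (\<integral>y. h x y - h x y * ?u y \<partial>unit_interval)"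
          unfolding laplacian_operator_def using x by (simp add: right_diff_distrib)
        also have "\<dots> = ?d x - (\<integral>y. h x y * ?u y \<partial>unit_interval)"
          by (rule Bochner_Integration.integral_diff[OF hint[OF x01] huint[OF x01]])
        finally have 1: "?Lu x = ?d x - (\<integral>y. h x y * ?u y \<partial>unit_interval)" .
        have "(\<integral>y. h x y * ?u y \<partial>unit_interval) \<le> (\<integral>y. ?u y \<partial>unit_interval)"
          using graphon_bounds[OF h x01]
          by (intro integral_unit_interval_mono huint x01 uint) (auto simp: indicator_def)
        also have "\<dots> = measure unit_interval B" using B01 by (simp add: Int_absorb2)
        finally have "(\<integral>y. h x y * ?u y \<partial>unit_interval) \<le> 1 / real M" using mB by simp
        moreover have "?C + 1 / real M < ?d x" using x by (simp add: B_def)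
        ultimately show ?thesis using 1 by linarith
      qed
      have Lu_meas: "?Lu \<in> borel_measurable unit_interval"
        unfolding laplacian_operator_def
        by (intro unit_interval.borel_measurable_lebesgue_integral) (simp add: case_prod_beta', measurable)
      have Lu_bound: "\<bar>?Lu x\<bar> \<le> 1" if x: "x \<in> {0..1}" for x
        unfolding laplacian_operator_def
      proof (rule abs_integral_unit_interval_le)
        show "AE y in unit_interval. \<bar>h x y * (?u x - ?u y)\<bar> \<le> 1"
          using graphon_bounds[OF h x] by (intro AE_unit_intervalI) (auto simp: indicator_def)
        show "(\<lambda>y. h x y * (?u x - ?u y)) \<in> borel_measurable unit_interval"
          using hsec[OF x] B by measurable
      qed
      \<comment> \<open>On \<open>B\<close> the image exceeds the operator norm strictly, and
        elsewhere its square is nonnegative; if \<open>B\<close> had positive measure, its indicator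
        would have a quotient above the supremum.\<close>
      have "(\<integral>x. ?C\<^sup>2 * ?u x \<partial>unit_interval) < (\<integral>x. (?Lu x)\<^sup>2 \<partial>unit_interval)"
      proof (rule unit_interval.integral_less_AE[where A = B])
        show "integrable unit_interval (\<lambda>x. (?Lu x)\<^sup>2)"
          using Lu_meas Lu_bound
          by (intro integrable_unit_interval_bounded[where B = 1]) (auto simp: abs_square_le_1)
        have less: "?C\<^sup>2 < (?Lu x)\<^sup>2" if "x \<in> B" for x
          using Lu_B[OF that] C0 by (intro power_strict_mono) auto
        then show "AE x in unit_interval. x \<in> B \<longrightarrow> ?C\<^sup>2 * ?u x \<noteq> (?Lu x)\<^sup>2"
          by (intro AE_I2) force
        show "AE x in unit_interval. ?C\<^sup>2 * ?u x \<le> (?Lu x)\<^sup>2"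
          using less by (intro AE_I2) (auto simp: indicator_def less_imp_le)
      qed (use pos B uint in auto)
      then have "?C\<^sup>2 * measure unit_interval B < (\<integral>x. (?Lu x)\<^sup>2 \<partial>unit_interval)"
        using B01 by (simp add: Int_absorb2)
      then have "sqrt (?C\<^sup>2 * measure unit_interval B) < L2_norm ?Lu"
        unfolding L2_norm_def L2_inner_def by (simp add: power2_eq_square)
      then have "?C * L2_norm ?u < L2_norm ?Lu"
        using C0 by (simp add: real_sqrt_mult normu)
      then have "?C < L2_norm ?Lu / L2_norm ?u"
        using mpos by (simp add: normu field_simps)
      with laplacian_operator_ratio_le_onorm[OF h u] show False by simp
    qed
    then have "AE x in unit_interval. x \<notin> B"
      using B by (intro AE_not_in) (auto simp: null_sets_def)
    then show ?thesis
      by (rule AE_mp) (auto intro!: AE_I2 simp: B_def not_less)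
  qed
  have "AE x in unit_interval. ?d x \<le> ?C + 1 / real (Suc M)" for M
  proof -
    have "AE x in unit_interval. \<forall>i\<in>{..<Suc M}. x \<in> block (Suc M) i \<longrightarrow> ?d x \<le> ?C + 1 / real (Suc M)"
      by (intro AE_finite_allI null) simp_all
    then show ?thesis
    proof (rule AE_mp, intro AE_I2 impI)
      fix x assume "x \<in> space unit_interval"
        and le: "\<forall>i\<in>{..<Suc M}. x \<in> block (Suc M) i \<longrightarrow> ?d x \<le> ?C + 1 / real (Suc M)"
      then have "x \<in> {0..1}" by simp
      from bspec[OF le, of "block_index (Suc M) x"] block_index[OF _ this, of "Suc M"]
      show "?d x \<le> ?C + 1 / real (Suc M)" by (simp del: of_nat_Suc)
    qed
  qed
  then have "AE x in unit_interval. \<forall>M. ?d x \<le> ?C + 1 / real (Suc M)"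
    by (subst AE_all_countable) auto
  then show ?thesis
  proof (rule AE_mp, intro AE_I2 impI)
    fix x assume *: "\<forall>M. ?d x \<le> ?C + 1 / real (Suc M)"
    have "(\<lambda>M. ?C + 1 / real (Suc M)) \<longlonglongrightarrow> ?C + 0"
      by (intro tendsto_add tendsto_const LIMSEQ_Suc[OF lim_1_over_n])
    then show "?d x \<le> ?C" using * by (intro LIMSEQ_le_const) auto
  qed
qed

section \<open>Block averages and almost everywhere close sections\<close>

lemma integral_block_section:
  fixes F :: "real \<Rightarrow> real"
  assumes bc: "block_constant N h" and N: "N \<ge> 1" and i: "i < N" and x: "x \<in> block N i"
  shows "(\<integral>y. F (h x y) \<partial>unit_interval) = (\<Sum>k<N. F (h (real i / real N) (real k / real N))) / real N"
    and "integrable unit_interval (\<lambda>y. F (h x y))"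
proof -
  have x01: "x \<in> {0..1}" using x block_subset[OF i] by auto
  have eq: "F (h x y) = F (h (real i / real N) (real (block_index N y) / real N))"
    if "y \<in> space unit_interval" for y
    using block_constant_eq[OF bc N x01, of y] that block_index_eq[OF i x] by simp
  show "(\<integral>y. F (h x y) \<partial>unit_interval) = (\<Sum>k<N. F (h (real i / real N) (real k / real N))) / real N"
    using integral_step[OF N, of "\<lambda>k. F (h (real i / real N) (real k / real N))"]
      Bochner_Integration.integral_cong[OF refl eq, of unit_interval "\<lambda>y. y"] by simp
  show "integrable unit_interval (\<lambda>y. F (h x y))"
    using integrable_step[OF N, of "\<lambda>k. F (h (real i / real N) (real k / real N))"]
      Bochner_Integration.integrable_cong[OF refl eq, of unit_interval "\<lambda>y. y"] by simp
qed

text \<open>The row of the vertex \<open>block_index N x\<close> is the section of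
  \<open>rN N\<close> at x itself, so the average is an exact integral and dominated convergence
  applies at every x. The shift to \<open>Suc N\<close> respects the condition N \<ge> 1.\<close>

lemma block_average_tendsto:
  fixes F :: "real \<Rightarrow> real"
  assumes F: "continuous_on {0..1} F"
    and graphon: "\<And>N. N \<ge> 1 \<Longrightarrow> graphon (rN N)" "graphon r"
    and bc: "\<And>N. N \<ge> 1 \<Longrightarrow> block_constant N (rN N)"
    and lim: "\<And>y. y \<in> {0..1} \<Longrightarrow> (\<lambda>N. rN N x y) \<longlonglongrightarrow> r x y"
    and x: "x \<in> {0..1}"
  shows "(\<lambda>N. (\<Sum>k<N. F (rN N (real (block_index N x) / real N) (real k / real N))) / real N)
    \<longlonglongrightarrow> (\<integral>y. F (r x y) \<partial>unit_interval)"
proof -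
  have "bounded (F ` {0..1})"
    by (intro compact_imp_bounded compact_continuous_image F) simp
  then obtain K where "\<forall>z\<in>F ` {0..1}. norm z \<le> K"
    unfolding bounded_iff by blast
  then have K: "\<bar>F b\<bar> \<le> K" if "b \<in> {0..1}" for b
    using that by auto
  have step: "(\<integral>y. F (rN (Suc N) x y) \<partial>unit_interval) =
        (\<Sum>k<Suc N. F (rN (Suc N) (real (block_index (Suc N) x) / real (Suc N)) (real k / real (Suc N)))) / real (Suc N)"
      "integrable unit_interval (\<lambda>y. F (rN (Suc N) x y))" for N
    using integral_block_section[OF bc[of "Suc N"] _ block_index[of "Suc N" x], of F] x by simp_all
  have pt: "(\<lambda>N. F (rN (Suc N) x y)) \<longlonglongrightarrow> F (r x y)" if y: "y \<in> {0..1}" for y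
  proof (rule continuous_on_tendsto_compose[OF F LIMSEQ_Suc[OF lim[OF y]]])
    show "r x y \<in> {0..1}" using graphon_bounds[OF graphon(2) x y] by simp
    show "\<forall>\<^sub>F N in sequentially. rN (Suc N) x y \<in> {0..1}"
      using graphon_bounds[OF graphon(1) x y] by (intro always_eventually) simp
  qed
  have "(\<lambda>N. \<integral>y. F (rN (Suc N) x y) \<partial>unit_interval) \<longlonglongrightarrow> (\<integral>y. F (r x y) \<partial>unit_interval)"
  proof (rule integral_dominated_convergence[where w = "\<lambda>_. K"])
    show m: "(\<lambda>y. F (rN (Suc N) x y)) \<in> borel_measurable unit_interval" for N
      using step(2) by (rule borel_measurable_integrable)
    show "(\<lambda>y. F (r x y)) \<in> borel_measurable unit_interval"
      by (rule borel_measurable_LIMSEQ_real[OF _ m]) (use pt in simp)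
    show "AE y in unit_interval. (\<lambda>N. F (rN (Suc N) x y)) \<longlonglongrightarrow> F (r x y)"
      by (intro AE_unit_intervalI pt)
    show "AE y in unit_interval. norm (F (rN (Suc N) x y)) \<le> K" for N
      using graphon_bounds[OF graphon(1) x] K by (intro AE_unit_intervalI) auto
  qed simp
  then show ?thesis unfolding step(1) by (rule LIMSEQ_imp_Suc)
qed

text \<open>Fubini splits the bound on the square into a property of x about almost every y. Holding
  for almost every x, it can be realised by a point in any given block.\<close>

definition close_sections :: "real \<Rightarrow> (real \<Rightarrow> real \<Rightarrow> real) \<Rightarrow> (real \<Rightarrow> real \<Rightarrow> real) \<Rightarrow> real \<Rightarrow> bool" where
  "close_sections \<epsilon> h r x \<longleftrightarrow> (AE y in unit_interval. \<bar>h x y - r x y\<bar> \<le> \<epsilon>)"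

interpretation unit_square: pair_sigma_finite unit_interval unit_interval ..

lemma esssup_close_sections:
  assumes lim: "(\<lambda>N. esssup (unit_interval \<Otimes>\<^sub>M unit_interval)
        (\<lambda>(x, y). ereal \<bar>rN N x y - r x y\<bar>)) \<longlonglongrightarrow> 0" and \<epsilon>: "0 < \<epsilon>"
  shows "\<forall>\<^sub>F N in sequentially. AE x in unit_interval. close_sections \<epsilon> (rN N) r x"
proof -
  have "\<forall>\<^sub>F N in sequentially. esssup (unit_interval \<Otimes>\<^sub>M unit_interval)
      (\<lambda>(x, y). ereal \<bar>rN N x y - r x y\<bar>) < ereal \<epsilon>"
    using \<epsilon> by (intro order_tendstoD(2)[OF lim]) simp
  then show ?thesis
  proof eventually_elim
    case (elim N)
    have "AE z in unit_interval \<Otimes>\<^sub>M unit_interval. (case z of (x, y) \<Rightarrow> ereal \<bar>rN N x y - r x y\<bar>) \<le>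
        esssup (unit_interval \<Otimes>\<^sub>M unit_interval) (\<lambda>(x, y). ereal \<bar>rN N x y - r x y\<bar>)"
      by (rule esssup_AE)
    then have "AE z in unit_interval \<Otimes>\<^sub>M unit_interval. \<bar>rN N (fst z) (snd z) - r (fst z) (snd z)\<bar> \<le> \<epsilon>"
    proof (rule AE_mp, intro AE_I2 impI)
      fix z assume "(case z of (x, y) \<Rightarrow> ereal \<bar>rN N x y - r x y\<bar>) \<le>
        esssup (unit_interval \<Otimes>\<^sub>M unit_interval) (\<lambda>(x, y). ereal \<bar>rN N x y - r x y\<bar>)"
      with elim have "(case z of (x, y) \<Rightarrow> ereal \<bar>rN N x y - r x y\<bar>) < ereal \<epsilon>"
        by (rule le_less_trans[rotated])
      then show "\<bar>rN N (fst z) (snd z) - r (fst z) (snd z)\<bar> \<le> \<epsilon>"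
        by (simp add: case_prod_beta)
    qed
    from unit_square.AE_pair[OF this] show ?case
      unfolding close_sections_def by simp
  qed
qed

lemma close_sections_integral:
  assumes "close_sections \<epsilon> h r x" "x \<in> {0..1}" "graphon h" "graphon r" "0 \<le> L"
    and f: "integrable unit_interval (\<lambda>y. f (h x y))" "integrable unit_interval (\<lambda>y. f (r x y))"
    and Lip: "\<And>a b. 0 \<le> a \<Longrightarrow> a \<le> 1 \<Longrightarrow> 0 \<le> b \<Longrightarrow> b \<le> 1 \<Longrightarrow> f a - f b \<le> L * \<bar>a - b\<bar>"
  shows "(\<integral>y. f (h x y) \<partial>unit_interval) \<le> (\<integral>y. f (r x y) \<partial>unit_interval) + L * \<epsilon>"
proof -
  have "(\<integral>y. f (h x y) \<partial>unit_interval) \<le> (\<integral>y. f (r x y) + L * \<epsilon> \<partial>unit_interval)"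
  proof (rule integral_mono_AE)
    show "AE y in unit_interval. f (h x y) \<le> f (r x y) + L * \<epsilon>"
      using assms(1) unfolding close_sections_def
    proof (rule AE_mp, intro AE_I2 impI)
      fix y assume "y \<in> space unit_interval" and c: "\<bar>h x y - r x y\<bar> \<le> \<epsilon>"
      then have "f (h x y) - f (r x y) \<le> L * \<bar>h x y - r x y\<bar>"
        using graphon_bounds[OF assms(3,2)] graphon_bounds[OF assms(4,2)] by (intro Lip) auto
      also have "\<dots> \<le> L * \<epsilon>" by (rule mult_left_mono[OF c assms(5)])
      finally show "f (h x y) \<le> f (r x y) + L * \<epsilon>" by simp
    qed
  qed (use f in auto)
  also have "\<dots> = (\<integral>y. f (r x y) \<partial>unit_interval) + L * \<epsilon>"
    using f(2) unit_interval.prob_space by (subst Bochner_Integration.integral_add) auto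
  finally show ?thesis .
qed

text \<open>
  Pointwise convergence and the block structure extend the almost everywhere bound on the degree
  function to all points, so null sets do not matter for the infimum in the rate function.
\<close>

lemma degree_function_le_everywhere:
  assumes graphon: "\<And>N. N \<ge> 1 \<Longrightarrow> graphon (rN N)" "graphon r"
    and bc: "\<And>N. N \<ge> 1 \<Longrightarrow> block_constant N (rN N)"
    and lim: "\<And>y. y \<in> {0..1} \<Longrightarrow> (\<lambda>N. rN N x y) \<longlonglongrightarrow> r x y"
    and esslim: "(\<lambda>N. esssup (unit_interval \<Otimes>\<^sub>M unit_interval)
        (\<lambda>(x, y). ereal \<bar>rN N x y - r x y\<bar>)) \<longlonglongrightarrow> 0"
    and d: "AE x in unit_interval. (\<integral>y. r x y \<partial>unit_interval) \<le> \<beta>"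
    and x: "x \<in> {0..1}"
  shows "(\<integral>y. r x y \<partial>unit_interval) \<le> \<beta>"
proof (rule field_le_epsilon)
  fix \<epsilon> :: real assume \<epsilon>: "0 < \<epsilon>"
  have "\<forall>\<^sub>F N in sequentially. (\<Sum>k<N. rN N (real (block_index N x) / real N) (real k / real N)) / real N \<le> \<beta> + \<epsilon>"
    using esssup_close_sections[OF esslim \<epsilon>] eventually_ge_at_top[of 1]
  proof eventually_elim
    case (elim N)
    note i = block_index[OF elim(2) x]
    have "AE x in unit_interval. close_sections \<epsilon> (rN N) r x \<and> (\<integral>y. r x y \<partial>unit_interval) \<le> \<beta>"
      using elim(1) d by eventually_elim simp
    \<comment> \<open>\<open>z\<close> lies in the block of x, so \<open>rN N\<close> has the same
      section at both points, but \<open>z\<close> avoids the exceptional null sets.\<close>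
    from AE_unit_interval_block[OF this i(1)] obtain z where z: "z \<in> block N (block_index N x)"
      "close_sections \<epsilon> (rN N) r z" "(\<integral>y. r z y \<partial>unit_interval) \<le> \<beta>" by auto
    have z01: "z \<in> {0..1}" using z(1) block_subset[OF i(1)] by auto
    have "(\<integral>y. rN N z y \<partial>unit_interval) \<le> (\<integral>y. r z y \<partial>unit_interval) + 1 * \<epsilon>"
      using z(2) z01 graphon(1)[OF elim(2)] graphon(2)
    proof (rule close_sections_integral[where f = "\<lambda>a. a"])
      show "integrable unit_interval (\<lambda>y. rN N z y)"
        by (rule integral_block_section(2)[OF bc[OF elim(2)] elim(2) i(1) z(1)])
      show "integrable unit_interval (\<lambda>y. r z y)"
        using graphon_bounds[OF graphon(2) z01]
        by (intro integrable_unit_interval_bounded[where B = 1] graphon_section_measurable graphon(2) z01) auto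
    qed auto
    with z(3) integral_block_section(1)[OF bc[OF elim(2)] elim(2) i(1) z(1), of "\<lambda>a. a"]
    show ?case by simp
  qed
  with block_average_tendsto[where F = "\<lambda>a. a", OF continuous_on_id graphon bc lim x]
  show "(\<integral>y. r x y \<partial>unit_interval) \<le> \<beta> + \<epsilon>"
    by (intro tendsto_upperbound[where F = sequentially]) auto
qed

text \<open>The form at v is N^2 times the form of the operator of h at the step function u with
  values v. Replacing h by r changes the latter by at most \<epsilon> times the squared L1 norm of
  u, and the form of r is nonnegative.\<close>

lemma nonneg_definite_block_form:
  assumes r: "graphon r" "nonneg_definite r" and h: "graphon h" "block_constant N h"
    and N: "N \<ge> 1" and close: "AE x in unit_interval. close_sections \<epsilon> h r x" and \<epsilon>: "0 \<le> \<epsilon>"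
  shows "- (\<epsilon> * real N) * (\<Sum>i<N. (v i)\<^sup>2) \<le>
    (\<Sum>i<N. \<Sum>j<N. v i * v j * h (real i / real N) (real j / real N))"
proof -
  define u where "u x = v (block_index N x)" for x
  define c where "c = (\<integral>x. \<bar>u x\<bar> \<partial>unit_interval)"
  \<comment> \<open>The value on block i of the operator of \<open>h\<close> applied to
    \<open>u\<close>.\<close>
  define H where "H i = (\<Sum>j<N. h (real i / real N) (real j / real N) * v j) / real N" for i
  define V where "V = (\<Sum>i<N. \<bar>v i\<bar>)"
  have Npos: "0 < real N" using N by simp
  have um [measurable]: "u \<in> borel_measurable unit_interval"
    unfolding u_def by (rule measurable_step[OF N])
  have uint: "integrable unit_interval u"
    unfolding u_def by (rule integrable_step[OF N])
  have uV: "\<bar>u x\<bar> \<le> V" if "x \<in> {0..1}" for x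
    unfolding u_def V_def using block_index[OF N that] by (intro member_le_sum) auto
  have V0: "0 \<le> V" by (simp add: V_def sum_nonneg)
  have uL2: "u \<in> L2"
    unfolding L2_def using um integrable_step[OF N, of "\<lambda>i. (v i)\<^sup>2"] by (simp add: u_def)
  have c: "c = V / real N"
    unfolding c_def u_def V_def by (rule integral_step[OF N])
  have c0: "0 \<le> c" by (simp add: c_def)
  let ?T = "integral_operator r u"
  note [measurable] = graphon_measurable_pair[OF r(1)]
  have Tm [measurable]: "?T \<in> borel_measurable unit_interval"
    unfolding integral_operator_def
    by (intro unit_interval.borel_measurable_lebesgue_integral) (simp add: case_prod_beta', measurable)
  have ruV: "\<bar>r x y * u y\<bar> \<le> V" if "x \<in> {0..1}" "y \<in> {0..1}" for x y
    using mult_mono[of "\<bar>r x y\<bar>" 1 "\<bar>u y\<bar>" V] graphon_bounds[OF r(1) that] uV[OF that(2)] V0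
    by (simp add: abs_mult)
  have rum: "(\<lambda>y. r x y * u y) \<in> borel_measurable unit_interval" if "x \<in> {0..1}" for x
    using graphon_section_measurable[OF r(1) that] um by measurable
  have TV: "\<bar>?T x\<bar> \<le> V" if x: "x \<in> {0..1}" for x
    unfolding integral_operator_def
    using ruV[OF x] by (intro abs_integral_unit_interval_le AE_unit_intervalI rum x)
  have uTint: "integrable unit_interval (\<lambda>x. u x * ?T x)"
  proof (rule integrable_unit_interval_bounded[where B = "V * V"])
    fix x :: real assume x: "x \<in> {0..1}"
    show "\<bar>u x * ?T x\<bar> \<le> V * V"
      unfolding abs_mult using uV[OF x] TV[OF x] V0 by (intro mult_mono) auto
  qed measurable
  have TH: "\<bar>?T x - H (block_index N x)\<bar> \<le> \<epsilon> * c" if x: "x \<in> {0..1}" and cl: "close_sections \<epsilon> h r x" for x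
  proof -
    have "H (block_index N x) = (\<integral>y. h (real (block_index N x) / real N) (real (block_index N y) / real N) *
        v (block_index N y) \<partial>unit_interval)"
      unfolding H_def by (rule integral_step[OF N, symmetric])
    also have "\<dots> = (\<integral>y. h x y * u y \<partial>unit_interval)"
      unfolding u_def using block_constant_eq[OF h(2) N x]
      by (intro Bochner_Integration.integral_cong refl) simp
    finally have H: "H (block_index N x) = (\<integral>y. h x y * u y \<partial>unit_interval)" .
    have hm: "(\<lambda>y. h x y * u y) \<in> borel_measurable unit_interval"
      using graphon_section_measurable[OF h(1) x] um by measurable
    have "integrable unit_interval (\<lambda>y. r x y * u y)"
      using ruV[OF x] by (intro integrable_unit_interval_bounded[where B = V] rum x)
    moreover have "integrable unit_interval (\<lambda>y. h x y * u y)"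
    proof (rule integrable_unit_interval_bounded[OF hm, where B = V])
      fix y :: real assume y: "y \<in> {0..1}"
      show "\<bar>h x y * u y\<bar> \<le> V"
        using mult_mono[of "\<bar>h x y\<bar>" 1 "\<bar>u y\<bar>" V] graphon_bounds[OF h(1) x y] uV[OF y] V0
        by (simp add: abs_mult)
    qed
    ultimately have diff: "?T x - H (block_index N x) = (\<integral>y. r x y * u y - h x y * u y \<partial>unit_interval)"
      and int: "integrable unit_interval (\<lambda>y. r x y * u y - h x y * u y)"
      unfolding H integral_operator_def by auto
    have "\<bar>\<integral>y. r x y * u y - h x y * u y \<partial>unit_interval\<bar> \<le>
        (\<integral>y. \<bar>r x y * u y - h x y * u y\<bar> \<partial>unit_interval)"
      using integral_norm_bound[of unit_interval "\<lambda>y. r x y * u y - h x y * u y"] by simp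
    also have "\<dots> \<le> (\<integral>y. \<epsilon> * \<bar>u y\<bar> \<partial>unit_interval)"
    proof (rule integral_mono_AE)
      show "AE y in unit_interval. \<bar>r x y * u y - h x y * u y\<bar> \<le> \<epsilon> * \<bar>u y\<bar>"
        using cl unfolding close_sections_def
      proof (rule AE_mp, intro AE_I2 impI)
        fix y assume "\<bar>h x y - r x y\<bar> \<le> \<epsilon>"
        then have "\<bar>r x y - h x y\<bar> * \<bar>u y\<bar> \<le> \<epsilon> * \<bar>u y\<bar>"
          by (intro mult_right_mono) auto
        then show "\<bar>r x y * u y - h x y * u y\<bar> \<le> \<epsilon> * \<bar>u y\<bar>"
          by (simp flip: abs_mult left_diff_distrib)
      qed
    qed (use int uint in auto)
    also have "\<dots> = \<epsilon> * c" by (simp add: c_def)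
    finally show ?thesis unfolding diff .
  qed
  have step_int: "integrable unit_interval (\<lambda>x. u x * H (block_index N x) + \<epsilon> * c * \<bar>u x\<bar>)"
    unfolding u_def by (rule integrable_step[OF N])
  have "0 \<le> (\<integral>x. u x * ?T x \<partial>unit_interval)"
    using r(2) uL2 by (simp add: nonneg_definite_def L2_inner_def)
  also have "\<dots> \<le> (\<integral>x. u x * H (block_index N x) + \<epsilon> * c * \<bar>u x\<bar> \<partial>unit_interval)"
  proof (rule integral_mono_AE[OF uTint step_int])
    show "AE x in unit_interval. u x * ?T x \<le> u x * H (block_index N x) + \<epsilon> * c * \<bar>u x\<bar>"
      using close
    proof (rule AE_mp, intro AE_I2 impI)
      fix x assume x: "x \<in> space unit_interval" and "close_sections \<epsilon> h r x"
      then have "\<bar>?T x - H (block_index N x)\<bar> * \<bar>u x\<bar> \<le> \<epsilon> * c * \<bar>u x\<bar>"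
        by (intro mult_right_mono TH) auto
      moreover have "u x * ?T x - u x * H (block_index N x) \<le> \<bar>?T x - H (block_index N x)\<bar> * \<bar>u x\<bar>"
        unfolding mult.commute[of "u x"] left_diff_distrib[symmetric] abs_mult[symmetric] by (rule abs_ge_self)
      ultimately show "u x * ?T x \<le> u x * H (block_index N x) + \<epsilon> * c * \<bar>u x\<bar>" by linarith
    qed
  qed
  also have "\<dots> = (\<Sum>i<N. v i * H i + \<epsilon> * c * \<bar>v i\<bar>) / real N"
    unfolding u_def by (rule integral_step[OF N])
  finally have "0 \<le> (\<Sum>i<N. v i * H i) + \<epsilon> * c * V"
    using Npos by (simp add: zero_le_divide_iff sum.distrib V_def sum_distrib_left)
  moreover have "(\<Sum>i<N. v i * H i) = (\<Sum>i<N. \<Sum>j<N. v i * v j * h (real i / real N) (real j / real N)) / real N"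
    unfolding H_def by (simp add: sum_distrib_left sum_divide_distrib mult_ac)
  moreover have "\<epsilon> * c * V = \<epsilon> * V\<^sup>2 / real N"
    by (simp add: c power2_eq_square)
  ultimately have "0 \<le> ((\<Sum>i<N. \<Sum>j<N. v i * v j * h (real i / real N) (real j / real N)) + \<epsilon> * V\<^sup>2) / real N"
    by (simp add: add_divide_distrib)
  then have 1: "0 \<le> (\<Sum>i<N. \<Sum>j<N. v i * v j * h (real i / real N) (real j / real N)) + \<epsilon> * V\<^sup>2"
    using Npos by (simp add: zero_le_divide_iff)
  \<comment> \<open>Passing from the sum of absolute values to the sum of squares costs the factor N
    in the statement.\<close>
  have "V\<^sup>2 \<le> real N * (\<Sum>i<N. (v i)\<^sup>2)"
    using Cauchy_Schwarz_ineq_sum[of "\<lambda>_. 1" "\<lambda>i. \<bar>v i\<bar>" "{..<N}"] by (simp add: V_def)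
  from mult_left_mono[OF this \<epsilon>] 1 show ?thesis by (simp add: mult.assoc)
qed

section \<open>The large deviation limit\<close>

lemma (in edge_probabilities) exceedance_subset:
  assumes N: "N \<ge> 1" and \<kappa>: "0 < \<kappa>" "1 < 2 * \<kappa> * real N"
    and psd: "\<And>v. - (\<kappa> * real N) * (\<Sum>i<N. (v i)\<^sup>2) \<le> (\<Sum>i<N. \<Sum>j<N. v i * v j * p i j)"
  shows "{G. \<beta> \<le> largest_eigenvalue (laplacian_matrix N G) / real N} \<subseteq>
    (\<Union>i<N. {G. (\<beta> - 4 * \<kappa>) * real N \<le> degree_of N G i}) \<union>
    {G. \<exists>S\<subseteq>{..<N}. \<exists>T\<subseteq>{..<N}. \<kappa> ^ 4 * (real N)\<^sup>2 \<le> sign_cut G S T}"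
proof (rule subsetI, rule ccontr)
  fix G
  assume "G \<in> {G. \<beta> \<le> largest_eigenvalue (laplacian_matrix N G) / real N}"
  then have ge: "\<beta> * real N \<le> largest_eigenvalue (laplacian_matrix N G)"
    using N by (simp add: field_simps)
  assume "G \<notin> (\<Union>i<N. {G. (\<beta> - 4 * \<kappa>) * real N \<le> degree_of N G i}) \<union>
    {G. \<exists>S\<subseteq>{..<N}. \<exists>T\<subseteq>{..<N}. \<kappa> ^ 4 * (real N)\<^sup>2 \<le> sign_cut G S T}"
  then have deg: "\<And>i. i < N \<Longrightarrow> degree_of N G i \<le> (\<beta> - 4 * \<kappa>) * real N"
    and cut: "\<And>S T. S \<subseteq> {..<N} \<Longrightarrow> T \<subseteq> {..<N} \<Longrightarrow> sign_cut G S T \<le> \<kappa> ^ 4 * (real N)\<^sup>2"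
    by (auto simp: not_le less_imp_le)
  \<comment> \<open>Of the margin 4 \<kappa> N, one \<kappa> N pays for the failure of definiteness
    and one for the cuts; the other two exceed the remaining 1.\<close>
  have "largest_eigenvalue (laplacian_matrix N G) \<le>
      (\<beta> - 4 * \<kappa>) * real N + \<kappa> * real N + 1 + \<kappa> * real N"
    by (rule largest_eigenvalue_le[OF N deg cut less_imp_le[OF \<kappa>(1)] psd])
  also have "\<dots> = \<beta> * real N + (1 - 2 * \<kappa> * real N)" by (simp add: algebra_simps)
  finally show False using ge \<kappa>(2) by simp
qed

lemma (in edge_probabilities) exceedance_upper_bound:
  assumes N: "N \<ge> 1" and \<kappa>: "0 < \<kappa>" "\<kappa> \<le> 1" "1 < 2 * \<kappa> * real N"
    and psd: "\<And>v. - (\<kappa> * real N) * (\<Sum>i<N. (v i)\<^sup>2) \<le> (\<Sum>i<N. \<Sum>j<N. v i * v j * p i j)"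
    and deg: "\<And>i. i < N \<Longrightarrow>
      measure_pmf.prob random_graph {G. (\<beta> - 4 * \<kappa>) * real N \<le> degree_of N G i} \<le> B"
  shows "measure_pmf.prob random_graph {G. \<beta> \<le> largest_eigenvalue (laplacian_matrix N G) / real N}
    \<le> real N * B + 4 ^ N * exp (- (\<kappa> ^ 8) * (real N)\<^sup>2 / 16)"
proof -
  let ?D = "\<lambda>i. {G. (\<beta> - 4 * \<kappa>) * real N \<le> degree_of N G i}"
  let ?C = "{G. \<exists>S\<subseteq>{..<N}. \<exists>T\<subseteq>{..<N}. \<kappa> ^ 4 * (real N)\<^sup>2 \<le> sign_cut G S T}"
  have "measure_pmf.prob random_graph {G. \<beta> \<le> largest_eigenvalue (laplacian_matrix N G) / real N}
      \<le> measure_pmf.prob random_graph ((\<Union>i<N. ?D i) \<union> ?C)"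
    by (intro measure_pmf.finite_measure_mono exceedance_subset N \<kappa> psd) simp
  also have "\<dots> \<le> measure_pmf.prob random_graph (\<Union>i<N. ?D i) + measure_pmf.prob random_graph ?C"
    by (rule measure_Un_le) auto
  also have "measure_pmf.prob random_graph (\<Union>i<N. ?D i) \<le> (\<Sum>i<N. measure_pmf.prob random_graph (?D i))"
    by (rule measure_pmf.finite_measure_subadditive_finite) auto
  also have "\<dots> \<le> (\<Sum>i<N. B)" using deg by (intro sum_mono) auto
  also have "measure_pmf.prob random_graph ?C \<le> 4 ^ N * exp (- (\<kappa> ^ 4)\<^sup>2 * (real N)\<^sup>2 / 16)"
  proof (rule all_cuts_tail)
    have "\<kappa> ^ 4 \<le> 1" using \<kappa> by (intro power_le_one) auto
    then show "\<kappa> ^ 4 \<le> 4" by simp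
  qed (use \<kappa> in simp)
  finally show ?thesis by (simp flip: power_mult)
qed

lemma prob_eigenvalue_law:
  "measure_pmf.prob (eigenvalue_law N h) {l. \<beta> \<le> l / real N} =
    measure_pmf.prob (erdos_renyi N h) {G. \<beta> \<le> largest_eigenvalue (laplacian_matrix N G) / real N}"
  unfolding eigenvalue_law_def measure_map_pmf by (simp add: vimage_def)

text \<open>The quadratic exponent beats every linear one, so the cut event is negligible against
  any prescribed exponential rate. The factor 1/2 comes from exp (-1) \<le> 1/2.\<close>

lemma eventually_geometric_cut_negligible:
  fixes a K :: real
  assumes "0 < a"
  shows "\<forall>\<^sub>F N in sequentially. 4 ^ N * exp (- a * (real N)\<^sup>2) \<le> exp (- K * real N) / 2"
proof -
  have "\<forall>\<^sub>F N in sequentially. (ln 4 + K + 1) / a \<le> real N"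
    by (rule eventually_compose_filterlim[OF eventually_ge_at_top filterlim_real_sequentially])
  then show ?thesis
    using eventually_ge_at_top[of 1]
  proof eventually_elim
    case (elim N)
    have "4 ^ N * exp (- a * (real N)\<^sup>2) * exp (K * real N) = exp (real N * (ln 4 + K - a * real N))"
      by (simp add: exp_of_nat_mult power2_eq_square algebra_simps exp_add exp_diff exp_minus divide_inverse)
    also have "\<dots> \<le> exp (- 1)"
    proof -
      have "ln 4 + K - a * real N \<le> - 1" using elim(1) assms by (simp add: field_simps)
      from mult_left_mono[OF this, of "real N"] elim(2) show ?thesis by simp
    qed
    also have "exp (- 1 :: real) \<le> 1 / 2"
      using exp_ge_add_one_self[of "1 :: real"] by (simp add: exp_minus field_simps)
    finally show ?case by (simp add: exp_minus field_simps)
  qed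
qed

lemma mult_ln_ratio_ge:
  fixes x y :: real
  assumes "0 \<le> x" "0 < y"
  shows "x - y \<le> x * ln (x / y)"
proof (cases "x = 0")
  case False
  with assms have x: "0 < x" by simp
  have "ln (y / x) \<le> y / x - 1" using x assms by (intro ln_le_minus_one) simp
  then have "1 - y / x \<le> ln (x / y)" using x assms by (simp add: ln_div)
  then have "x * (1 - y / x) \<le> x * ln (x / y)" using x by (intro mult_left_mono) auto
  also have "x * (1 - y / x) = x - y" using x by (simp add: right_diff_distrib)
  finally show ?thesis .
qed (use assms in simp)

text \<open>The lower bounds a - b and b - a of the two summands cancel.\<close>

lemma rel_entropy_nonneg: "0 \<le> a \<Longrightarrow> a \<le> 1 \<Longrightarrow> 0 < b \<Longrightarrow> b < 1 \<Longrightarrow> 0 \<le> rel_entropy a b"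
  using mult_ln_ratio_ge[of a b] mult_ln_ratio_ge[of "1 - a" "1 - b"] by (simp add: rel_entropy_def)

text \<open>Bounds the set in \<open>rate_inf\<close> from below, so that its infimum lies below
  each of its members.\<close>

lemma rate_J_nonneg:
  assumes "\<And>y. y \<in> {0..1} \<Longrightarrow> 0 < r x y \<and> r x y < 1"
  shows "0 \<le> rate_J r x \<beta>"
  unfolding rate_J_def
proof (rule Bochner_Integration.integral_nonneg)
  fix y assume "y \<in> space unit_interval"
  then have "0 < r x y \<and> r x y < 1" using assms by simp
  then show "0 \<le> rel_entropy (tilted_graphon r \<beta> x y) (r x y)"
    using tilt_bounds[of "r x y"] by (intro rel_entropy_nonneg) (auto simp: tilted_graphon_def)
qed

text \<open>Positivity alone does not keep the logarithms of \<open>rN N\<close> bounded. Choosing a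
  good x in one block and then a good y in the other carries the lower bound of r over to the block
  value.\<close>

lemma block_values_lower_bound:
  assumes close: "AE x in unit_interval. close_sections \<epsilon> h r x" and bc: "block_constant N h"
    and N: "N \<ge> 1" and i: "i < N" and j: "j < N"
    and r: "\<And>x y. x \<in> {0..1} \<Longrightarrow> y \<in> {0..1} \<Longrightarrow> \<delta> \<le> r x y"
  shows "\<delta> - \<epsilon> \<le> h (real i / real N) (real j / real N)"
proof -
  obtain x where x: "x \<in> block N i" "close_sections \<epsilon> h r x"
    using AE_unit_interval_block[OF close i] by blast
  obtain y where y: "y \<in> block N j" "\<bar>h x y - r x y\<bar> \<le> \<epsilon>"
    using AE_unit_interval_block[OF x(2)[unfolded close_sections_def] j] by blast
  have "x \<in> {0..1}" "y \<in> {0..1}"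
    using x(1) y(1) block_subset[OF i] block_subset[OF j] by auto
  with block_constant_eq[OF bc N this] block_index_eq[OF i x(1)] block_index_eq[OF j y(1)] r[of x y] y(2)
  show ?thesis by simp
qed

section \<open>Matching exponential bounds for the exceedance probability\<close>

locale convergent_graphons =
  fixes r :: "real \<Rightarrow> real \<Rightarrow> real" and rN :: "nat \<Rightarrow> real \<Rightarrow> real \<Rightarrow> real" and \<delta> \<beta> :: real
  assumes graphon_r: "graphon r"
    and delta_pos: "\<delta> > 0"
    and r_bounds: "\<And>x y. x \<in> {0..1} \<Longrightarrow> y \<in> {0..1} \<Longrightarrow> \<delta> \<le> r x y \<and> r x y \<le> 1 - \<delta>"
    and nonneg_definite_r: "nonneg_definite r"
    and graphon_rN: "\<And>N. N \<ge> 1 \<Longrightarrow> graphon (rN N)"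
    and rN_bounds: "\<And>N x y. N \<ge> 1 \<Longrightarrow> x \<in> {0..1} \<Longrightarrow> y \<in> {0..1} \<Longrightarrow> 0 < rN N x y \<and> rN N x y < 1"
    and block_constant_rN: "\<And>N. N \<ge> 1 \<Longrightarrow> block_constant N (rN N)"
    and rN_pointwise: "\<And>x y. x \<in> {0..1} \<Longrightarrow> y \<in> {0..1} \<Longrightarrow> (\<lambda>N. rN N x y) \<longlonglongrightarrow> r x y"
    and rN_uniform: "(\<lambda>N. esssup (unit_interval \<Otimes>\<^sub>M unit_interval)
                (\<lambda>(x, y). ereal \<bar>rN N x y - r x y\<bar>)) \<longlonglongrightarrow> 0"
    and onorm_le: "L2_onorm (laplacian_operator r) \<le> \<beta>"
    and beta_le_1: "\<beta> \<le> 1"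
begin

abbreviation "p N i j \<equiv> rN N (real i / real N) (real j / real N)"

abbreviation "exceedance N \<equiv> measure_pmf.prob (eigenvalue_law N (rN N)) {l. \<beta> \<le> l / real N}"

lemma edge_probabilities: "N \<ge> 1 \<Longrightarrow> edge_probabilities N (p N)"
  using left_endpoint_in_unit rN_bounds graphon_sym[OF graphon_rN] by unfold_locales blast+

lemma exceedance_eq:
  assumes "N \<ge> 1"
  shows "exceedance N = measure_pmf.prob (edge_probabilities.random_graph N (p N))
    {G. \<beta> \<le> largest_eigenvalue (laplacian_matrix N G) / real N}"
  unfolding prob_eigenvalue_law erdos_renyi_def
    edge_probabilities.random_graph_def[OF edge_probabilities[OF assms]] edges_def
  by (simp only: case_prod_beta')

lemma r_section_measurable: "x \<in> {0..1} \<Longrightarrow> (\<lambda>y. r x y) \<in> borel_measurable unit_interval"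
  by (rule graphon_section_measurable[OF graphon_r])

lemma degree_function_le:
  assumes x: "x \<in> {0..1}"
  shows "(\<integral>y. r x y \<partial>unit_interval) \<le> \<beta>"
proof (rule degree_function_le_everywhere[where rN = rN])
  show "AE x in unit_interval. (\<integral>y. r x y \<partial>unit_interval) \<le> \<beta>"
    using AE_degree_function_le_onorm[OF graphon_r] by eventually_elim (use onorm_le in simp)
qed (use graphon_r graphon_rN block_constant_rN rN_pointwise rN_uniform x in auto)

lemma rate_inf_le:
  assumes x: "x \<in> {0..1}"
  shows "rate_inf r \<beta> \<le> rate_J r x \<beta>"
proof -
  have "bdd_below ((\<lambda>x. rate_J r x \<beta>) ` {0..1})"
  proof (rule bdd_belowI2)
    fix x :: real assume "x \<in> {0..1}"
    then have "0 < r x y \<and> r x y < 1" if "y \<in> {0..1}" for y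
      using r_bounds[OF _ that] delta_pos by force
    then show "0 \<le> rate_J r x \<beta>" by (rule rate_J_nonneg)
  qed
  then show ?thesis
    unfolding rate_inf_def using x by (rule cINF_lower)
qed

lemma block_form_lower_bound:
  assumes "AE x in unit_interval. close_sections \<kappa> (rN N) r x" "N \<ge> 1" "0 \<le> \<kappa>"
  shows "- (\<kappa> * real N) * (\<Sum>i<N. (v i)\<^sup>2) \<le> (\<Sum>i<N. \<Sum>j<N. v i * v j * p N i j)"
  using assms graphon_r nonneg_definite_r graphon_rN block_constant_rN
  by (intro nonneg_definite_block_form)

lemma exceedance_upper:
  assumes \<epsilon>: "0 < \<epsilon>"
  shows "\<forall>\<^sub>F N in sequentially. exceedance N \<le> exp (- (rate_inf r \<beta> - \<epsilon>) * real N)"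
proof -
  let ?I = "rate_inf r \<beta>"
  have "0 < \<epsilon> / 4" using \<epsilon> by simp
  from rate_J_le_Legendre[OF delta_pos beta_le_1 this] obtain T where T0: "0 \<le> T"
    and T: "\<forall>r x. (\<lambda>y. r x y) \<in> borel_measurable unit_interval \<longrightarrow>
      (\<forall>y\<in>{0..1}. \<delta> \<le> r x y \<and> r x y \<le> 1 - \<delta>) \<longrightarrow> (\<integral>y. r x y \<partial>unit_interval) \<le> \<beta> \<longrightarrow>
      (\<exists>t. 0 \<le> t \<and> t \<le> T \<and>
        rate_J r x \<beta> - \<epsilon> / 4 \<le> t * \<beta> - (\<integral>y. cumulant t (r x y) \<partial>unit_interval))"
    by blast
  \<comment> \<open>Lowering the degree threshold costs at most 4 \<kappa> T and comparing the
    cumulants at most \<kappa> exp T; together they stay below \<epsilon> / 2. With the \<epsilon> /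
    4 from the Legendre bound, \<epsilon> / 4 is left for the union bound.\<close>
  define \<kappa> where "\<kappa> = min 1 (\<epsilon> / (2 * (4 * T + exp T)))"
  have c: "0 < 4 * T + exp T" using T0 by (intro add_nonneg_pos) auto
  have \<kappa>: "0 < \<kappa>" "\<kappa> \<le> 1" using c \<epsilon> by (auto simp: \<kappa>_def)
  have "\<kappa> \<le> \<epsilon> / (2 * (4 * T + exp T))" by (simp add: \<kappa>_def)
  with c have \<kappa>\<epsilon>: "\<kappa> * (4 * T + exp T) \<le> \<epsilon> / 2" by (simp add: field_simps)
  have "\<forall>\<^sub>F N in sequentially. 1 / \<kappa> \<le> real N"
    by (rule eventually_compose_filterlim[OF eventually_ge_at_top filterlim_real_sequentially])
  \<comment> \<open>The remaining \<epsilon> / 4 absorbs the number N of vertices. The degrees get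
    one half of the final bound and the cuts the other.\<close>
  moreover have "((\<lambda>N. real N * exp (- (\<epsilon> / 4) * real N)) \<longlongrightarrow> 0) sequentially"
    using \<epsilon> by real_asymp
  then have "\<forall>\<^sub>F N in sequentially. real N * exp (- (\<epsilon> / 4) * real N) < 1 / 2"
    by (rule order_tendstoD) simp
  moreover have "\<forall>\<^sub>F N in sequentially. 4 ^ N * exp (- (\<kappa> ^ 8 / 16) * (real N)\<^sup>2) \<le> exp (- (?I - \<epsilon>) * real N) / 2"
    using \<kappa> by (intro eventually_geometric_cut_negligible) simp
  ultimately show ?thesis
    using esssup_close_sections[OF rN_uniform \<kappa>(1)] eventually_ge_at_top[of 1]
  proof eventually_elim
    case (elim N)
    interpret edge_probabilities N "p N" by (rule edge_probabilities[OF elim(5)])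
    note N = elim(5) and close = elim(4)
    have Npos: "0 < real N" using N by simp
    have "1 \<le> \<kappa> * real N" using elim(1) \<kappa>(1) by (simp add: field_simps)
    then have N\<kappa>: "1 < 2 * \<kappa> * real N" by simp
    have "exceedance N \<le> real N * exp (- (?I - 3 * \<epsilon> / 4) * real N) + 4 ^ N * exp (- (\<kappa> ^ 8) * (real N)\<^sup>2 / 16)"
      unfolding exceedance_eq[OF N]
    proof (rule exceedance_upper_bound[OF N \<kappa> N\<kappa> block_form_lower_bound[OF close N less_imp_le[OF \<kappa>(1)]]])
      fix i assume i: "i < N"
      \<comment> \<open>The vertex is represented by a good point of its block, where r and
        \<open>rN N\<close> have close sections; the infimum bounds the rate at that point from
        below.\<close>
      obtain x where x: "x \<in> block N i" "close_sections \<kappa> (rN N) r x"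
        using AE_unit_interval_block[OF close i] by blast
      have x01: "x \<in> {0..1}" using x(1) block_subset[OF i] by auto
      obtain t where t: "0 \<le> t" "t \<le> T"
        "rate_J r x \<beta> - \<epsilon> / 4 \<le> t * \<beta> - (\<integral>y. cumulant t (r x y) \<partial>unit_interval)"
        using T r_section_measurable[OF x01] r_bounds[OF x01] degree_function_le[OF x01] by blast
      have r01: "0 \<le> r x y \<and> r x y \<le> 1" if "y \<in> {0..1}" for y
        by (rule graphon_bounds[OF graphon_r x01 that])
      note avg = integral_block_section[OF block_constant_rN[OF N] N i x(1), of "cumulant t"]
      have "(\<Sum>k<N. cumulant t (p N i k)) / real N \<le>
          (\<integral>y. cumulant t (r x y) \<partial>unit_interval) + (exp t - 1) * \<kappa>"
        unfolding avg(1)[symmetric] using t(1) cumulant_Lipschitz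
        by (intro close_sections_integral[OF x(2) x01 graphon_rN[OF N] graphon_r _ avg(2)]
            integrable_cumulant r_section_measurable x01 r01) auto
      also have "\<dots> \<le> (\<integral>y. cumulant t (r x y) \<partial>unit_interval) + exp T * \<kappa>"
      proof -
        have "exp t - 1 \<le> exp T" using exp_le_cancel_iff[of t T] t(2) by linarith
        then have "(exp t - 1) * \<kappa> \<le> exp T * \<kappa>" using \<kappa>(1) by (intro mult_right_mono) auto
        then show ?thesis by simp
      qed
      also have "\<dots> \<le> t * \<beta> - (?I - \<epsilon> / 4) + exp T * \<kappa>"
        using t(3) rate_inf_le[OF x01] by simp
      finally have 1: "(\<Sum>k<N. cumulant t (p N i k)) / real N \<le> t * \<beta> - (?I - \<epsilon> / 4) + exp T * \<kappa>" .
      have "t * (4 * \<kappa>) \<le> T * (4 * \<kappa>)" using t(2) \<kappa>(1) by (intro mult_right_mono) auto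
      with 1 \<kappa>\<epsilon> have "(\<Sum>k<N. cumulant t (p N i k)) / real N \<le> t * (\<beta> - 4 * \<kappa>) - (?I - 3 * \<epsilon> / 4)"
        by (simp add: algebra_simps)
      then have "(\<Sum>k<N. cumulant t (p N i k)) \<le> (t * (\<beta> - 4 * \<kappa>) - (?I - 3 * \<epsilon> / 4)) * real N"
        using Npos by (simp add: field_simps)
      then have 2: "- (t * ((\<beta> - 4 * \<kappa>) * real N)) + (\<Sum>k<N. cumulant t (p N i k)) \<le> - (?I - 3 * \<epsilon> / 4) * real N"
        by (simp add: algebra_simps)
      have "measure_pmf.prob random_graph {G. (\<beta> - 4 * \<kappa>) * real N \<le> degree_of N G i} \<le>
          exp (- (t * ((\<beta> - 4 * \<kappa>) * real N)) + (\<Sum>k<N. cumulant t (p N i k)))"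
        by (rule degree_upper_tail[OF i t(1)])
      also have "\<dots> \<le> exp (- (?I - 3 * \<epsilon> / 4) * real N)" using 2 by simp
      finally show "measure_pmf.prob random_graph {G. (\<beta> - 4 * \<kappa>) * real N \<le> degree_of N G i}
        \<le> exp (- (?I - 3 * \<epsilon> / 4) * real N)" .
    qed
    also have "real N * exp (- (?I - 3 * \<epsilon> / 4) * real N) =
        (real N * exp (- (\<epsilon> / 4) * real N)) * exp (- (?I - \<epsilon>) * real N)"
      by (simp add: algebra_simps flip: exp_add)
    also have "\<dots> \<le> 1 / 2 * exp (- (?I - \<epsilon>) * real N)"
      using elim(2) by (intro mult_right_mono) auto
    finally show ?case using elim(3) by simp
  qed
qed

lemma block_averages:
  assumes "x \<in> {0..1}" "continuous_on {0..1} F"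
  shows "(\<lambda>N. (\<Sum>k<N. F (p N (block_index N x) k)) / real N) \<longlonglongrightarrow> (\<integral>y. F (r x y) \<partial>unit_interval)"
  using assms graphon_rN graphon_r block_constant_rN rN_pointwise
  by (intro block_average_tendsto[where rN = rN and r = r]) auto

lemma exceedance_lower_less_1:
  assumes \<epsilon>: "0 < \<epsilon>" and x: "x \<in> {0..1}" and \<beta>: "\<beta> < 1"
  shows "\<forall>\<^sub>F N in sequentially. exp (- (rate_J r x \<beta> + \<epsilon>) * real N) \<le> exceedance N"
proof -
  define J where "J = rate_J r x \<beta>"
  have "0 < \<epsilon> / 4" using \<epsilon> by simp
  from overshooting_tilt[where r = r and x = x, OF r_section_measurable[OF x] r_bounds[OF x] delta_pos degree_function_le[OF x] \<beta> this]
  obtain t where t: "0 \<le> t" and m: "\<beta> < (\<integral>y. tilt t (r x y) \<partial>unit_interval)" and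
    J: "t * (\<integral>y. tilt t (r x y) \<partial>unit_interval) - (\<integral>y. cumulant t (r x y) \<partial>unit_interval) \<le> J + \<epsilon> / 4"
    unfolding J_def by blast
  define m where "m = (\<integral>y. tilt t (r x y) \<partial>unit_interval)"
  define L where "L = (\<integral>y. cumulant t (r x y) \<partial>unit_interval)"
  define mN where "mN N = (\<Sum>k<N. tilt t (p N (block_index N x) k))" for N
  define LN where "LN N = (\<Sum>k<N. cumulant t (p N (block_index N x) k))" for N
  have mlim: "(\<lambda>N. mN N / real N) \<longlonglongrightarrow> m"
    unfolding mN_def m_def by (rule block_averages[OF x continuous_on_tilt])
  have Llim: "(\<lambda>N. LN N / real N) \<longlonglongrightarrow> L"
    unfolding LN_def L_def by (rule block_averages[OF x continuous_on_cumulant])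
  \<comment> \<open>The three bounds make \<open>degree_lower_bound\<close> applicable, keep the
    fluctuation within the overshoot m - \<beta>, and limit its cost t \<eta> to \<epsilon> / 8; t +
    1 avoids dividing by zero.\<close>
  define \<eta> where "\<eta> = min 2 (min ((m - \<beta>) / 4) (\<epsilon> / (8 * (t + 1))))"
  have \<eta>: "0 < \<eta>" "\<eta> \<le> 2" "\<eta> \<le> (m - \<beta>) / 4"
  proof -
    have "0 < m - \<beta>" using m by (simp add: m_def)
    then show "0 < \<eta>" unfolding \<eta>_def using \<epsilon> t by simp
    show "\<eta> \<le> 2" unfolding \<eta>_def by (rule min.cobounded1)
    show "\<eta> \<le> (m - \<beta>) / 4" unfolding \<eta>_def by (intro min.coboundedI2 min.cobounded1)
  qed
  have t\<eta>: "t * \<eta> \<le> \<epsilon> / 8"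
  proof -
    have "t * \<eta> \<le> (t + 1) * (\<epsilon> / (8 * (t + 1)))"
      using t \<eta>(1) by (intro mult_mono) (auto simp: \<eta>_def)
    also have "\<dots> = \<epsilon> / 8" using t by (simp add: field_simps)
    finally show ?thesis .
  qed
  have "\<forall>\<^sub>F N in sequentially. 4 / (m - \<beta>) \<le> real N"
    by (rule eventually_compose_filterlim[OF eventually_ge_at_top filterlim_real_sequentially])
  moreover have "\<forall>\<^sub>F N in sequentially. 16 * t / \<epsilon> \<le> real N"
    by (rule eventually_compose_filterlim[OF eventually_ge_at_top filterlim_real_sequentially])
  moreover have "\<forall>\<^sub>F N in sequentially. m - (m - \<beta>) / 4 < mN N / real N"
    using m by (intro order_tendstoD(1)[OF mlim]) (simp add: m_def)
  moreover have "\<forall>\<^sub>F N in sequentially. t * (mN N / real N) < t * m + \<epsilon> / 16"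
    using \<epsilon> by (intro order_tendstoD(2)[OF tendsto_mult_left[OF mlim]]) simp
  moreover have "\<forall>\<^sub>F N in sequentially. L - \<epsilon> / 16 < LN N / real N"
    using \<epsilon> by (intro order_tendstoD(1)[OF Llim]) simp
  moreover have "((\<lambda>N. 1 - 2 * exp (- \<eta>\<^sup>2 * real N / 4) - exp (- (\<epsilon> / 16) * real N)) \<longlongrightarrow> 1) sequentially"
    using \<epsilon> \<eta>(1) by real_asymp
  then have "\<forall>\<^sub>F N in sequentially. 0 < 1 - 2 * exp (- \<eta>\<^sup>2 * real N / 4) - exp (- (\<epsilon> / 16) * real N)"
    by (rule order_tendstoD) simp
  ultimately show ?thesis
    using eventually_ge_at_top[of 1]
  proof eventually_elim
    case (elim N)
    note N = elim(7)
    interpret edge_probabilities N "p N" by (rule edge_probabilities[OF N])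
    let ?i = "block_index N x"
    have i: "?i < N" by (rule block_index(1)[OF N x])
    have Npos: "0 < real N" using N by simp
    \<comment> \<open>One quarter each of the overshoot (m - \<beta>) N covers the deviation of the
      mean, the diagonal 1 and the fluctuation.\<close>
    have big: "\<beta> * real N \<le> mN N - 1 - \<eta> * real N"
    proof -
      have "1 \<le> (m - \<beta>) / 4 * real N" using elim(1) m by (simp add: field_simps m_def)
      moreover have "(m - (m - \<beta>) / 4) * real N \<le> mN N" using elim(3) Npos by (simp add: field_simps)
      moreover have "\<eta> * real N \<le> (m - \<beta>) / 4 * real N" using \<eta>(3) by (intro mult_right_mono) auto
      moreover have "0 \<le> (m - \<beta>) / 4 * real N" using m Npos by (simp add: m_def)
      moreover have "(m - (m - \<beta>) / 4) * real N - (m - \<beta>) / 4 * real N - (m - \<beta>) / 4 * real N =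
          \<beta> * real N + (m - \<beta>) / 4 * real N" by (simp add: field_simps)
      ultimately show ?thesis by linarith
    qed
    \<comment> \<open>The losses are \<epsilon> / 4 for overshooting, \<epsilon> / 8 for the
      fluctuation and \<epsilon> / 16 each for the cumulants, the mean and the diagonal. The
      \<epsilon> / 16 kept back pays for the prefactor.\<close>
    have expo: "- (J + 15 * \<epsilon> / 16) * real N \<le> LN N - t - t * (mN N + \<eta> * real N)"
    proof -
      have 1: "(L - \<epsilon> / 16) * real N \<le> LN N" using elim(5) Npos by (simp add: field_simps)
      have 2: "t \<le> \<epsilon> / 16 * real N" using elim(2) \<epsilon> by (simp add: field_simps)
      have 3: "t * mN N \<le> (t * m + \<epsilon> / 16) * real N" using elim(4) Npos by (simp add: field_simps)
      have 4: "t * \<eta> * real N \<le> \<epsilon> / 8 * real N" using t\<eta> by (intro mult_right_mono) auto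
      have 5: "(t * m - L) * real N \<le> (J + \<epsilon> / 4) * real N"
        using J by (intro mult_right_mono) (auto simp: m_def L_def)
      have 6: "0 \<le> \<epsilon> * real N" using \<epsilon> by simp
      show ?thesis using 1 2 3 4 5 6 by (simp add: algebra_simps)
    qed
    have "exp (- (J + \<epsilon>) * real N) = exp (- (\<epsilon> / 16) * real N) * exp (- (J + 15 * \<epsilon> / 16) * real N)"
      by (simp add: algebra_simps flip: exp_add)
    also have "\<dots> \<le> (1 - 2 * exp (- \<eta>\<^sup>2 * real N / 4)) * exp (LN N - t - t * (mN N + \<eta> * real N))"
    proof -
      have le: "exp (- (\<epsilon> / 16) * real N) \<le> 1 - 2 * exp (- \<eta>\<^sup>2 * real N / 4)"
        using elim(6) by simp
      show ?thesis
        using expo by (intro mult_mono[OF le] order_trans[OF exp_ge_zero le]) auto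
    qed
    also have "\<dots> \<le> measure_pmf.prob random_graph {G. mN N - 1 - \<eta> * real N \<le> degree_of N G ?i}"
      unfolding mN_def LN_def by (rule degree_lower_bound[OF i t less_imp_le[OF \<eta>(1)] \<eta>(2)])
    also have "\<dots> \<le> exceedance N"
      unfolding exceedance_eq[OF N]
    proof (intro measure_pmf.finite_measure_mono subsetI CollectI)
      fix G assume "G \<in> {G. mN N - 1 - \<eta> * real N \<le> degree_of N G ?i}"
      with big degree_le_largest_eigenvalue[OF i, of G]
      have "\<beta> * real N \<le> largest_eigenvalue (laplacian_matrix N G)" by simp
      then show "\<beta> \<le> largest_eigenvalue (laplacian_matrix N G) / real N"
        using Npos by (simp add: field_simps)
    qed simp
    finally show ?case unfolding J_def .
  qed
qed

lemma exceedance_lower_1: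
  assumes \<epsilon>: "0 < \<epsilon>" and x: "x \<in> {0..1}" and \<beta>: "\<beta> = 1"
  shows "\<forall>\<^sub>F N in sequentially. exp (- (rate_J r x \<beta> + \<epsilon>) * real N) \<le> exceedance N"
proof -
  \<comment> \<open>The logarithm is truncated to be continuous on the closed interval, as the
    convergence of block averages requires.\<close>
  let ?F = "\<lambda>b. ln (max (\<delta> / 2) b)"
  have d2: "0 < \<delta> / 2" using delta_pos by simp
  have r2: "\<delta> / 2 \<le> r x y" if "y \<in> {0..1}" for y using r_bounds[OF x that] delta_pos by simp
  have "continuous_on {0..1} ?F"
    using d2 by (intro continuous_intros) (auto simp: max_def)
  note lim = block_averages[OF x this]
  have "(\<integral>y. ?F (r x y) \<partial>unit_interval) = (\<integral>y. - (- ln (r x y)) \<partial>unit_interval)"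
    using r2 by (intro Bochner_Integration.integral_cong refl) (simp add: max_absorb2)
  also have "\<dots> = - rate_J r x \<beta>"
  proof -
    have "0 < r x y" if "y \<in> {0..1}" for y using r2[OF that] d2 by linarith
    then show ?thesis unfolding \<beta> by (subst rate_J_1) auto
  qed
  finally have J: "(\<integral>y. ?F (r x y) \<partial>unit_interval) = - rate_J r x \<beta>" .
  have "\<forall>\<^sub>F N in sequentially. - (rate_J r x \<beta> + \<epsilon>) < (\<Sum>k<N. ?F (p N (block_index N x) k)) / real N"
    using \<epsilon> by (intro order_tendstoD(1)[OF lim[unfolded J]]) simp
  then show ?thesis
    using esssup_close_sections[OF rN_uniform d2] eventually_ge_at_top[of 2]
  proof eventually_elim
    case (elim N)
    have N: "N \<ge> 1" using elim(3) by simp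
    interpret edge_probabilities N "p N" by (rule edge_probabilities[OF N])
    let ?i = "block_index N x"
    have i: "?i < N" by (rule block_index(1)[OF N x])
    have Npos: "0 < real N" using N by simp
    \<comment> \<open>Closeness within \<delta> / 2 keeps all edge probabilities at least \<delta> /
      2, so the truncation is inactive.\<close>
    have "?F (p N ?i k) = ln (p N ?i k)" if "k < N" for k
      using block_values_lower_bound[OF elim(2) block_constant_rN[OF N] N i that, of \<delta>] r_bounds
      by (simp add: max_absorb2)
    then have "(\<Sum>k<N. ?F (p N ?i k)) = (\<Sum>k<N. ln (p N ?i k))" by simp
    with elim(1) Npos have "- (rate_J r x \<beta> + \<epsilon>) * real N \<le> (\<Sum>k<N. ln (p N ?i k))"
      by (simp add: field_simps)
    then have "exp (- (rate_J r x \<beta> + \<epsilon>) * real N) \<le> exp (\<Sum>k<N. ln (p N ?i k))" by simp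
    also have "\<dots> \<le> measure_pmf.prob random_graph {G. \<forall>k<N. k \<noteq> ?i \<longrightarrow> adjacent G ?i k}"
      by (rule full_degree_probability[OF i])
    also have "\<dots> \<le> exceedance N"
      unfolding exceedance_eq[OF N]
    proof (intro measure_pmf.finite_measure_mono subsetI CollectI)
      fix G assume "G \<in> {G. \<forall>k<N. k \<noteq> ?i \<longrightarrow> adjacent G ?i k}"
      then have "real N \<le> largest_eigenvalue (laplacian_matrix N G)"
        by (intro full_degree_largest_eigenvalue[OF i elim(3)]) simp
      then show "\<beta> \<le> largest_eigenvalue (laplacian_matrix N G) / real N"
        using Npos by (simp add: field_simps \<beta>)
    qed simp
    finally show ?case .
  qed
qed

lemma exceedance_lower:
  assumes \<epsilon>: "0 < \<epsilon>"
  shows "\<forall>\<^sub>F N in sequentially. exp (- (rate_inf r \<beta> + \<epsilon>) * real N) \<le> exceedance N"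
proof -
  have "\<exists>z\<in>(\<lambda>x. rate_J r x \<beta>) ` {0..1}. z < rate_inf r \<beta> + \<epsilon> / 2"
    unfolding rate_inf_def using \<epsilon> by (intro cInf_lessD) auto
  then obtain x where x: "x \<in> {0..1}" "rate_J r x \<beta> < rate_inf r \<beta> + \<epsilon> / 2" by blast
  have "0 < \<epsilon> / 2" using \<epsilon> by simp
  then have "\<forall>\<^sub>F N in sequentially. exp (- (rate_J r x \<beta> + \<epsilon> / 2) * real N) \<le> exceedance N"
    using exceedance_lower_less_1[OF _ x(1)] exceedance_lower_1[OF _ x(1)] beta_le_1 by (cases "\<beta> = 1") auto
  then show ?thesis
  proof eventually_elim
    case (elim N)
    have "- (rate_inf r \<beta> + \<epsilon>) * real N \<le> - (rate_J r x \<beta> + \<epsilon> / 2) * real N"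
      using x(2) by (intro mult_right_mono) auto
    then have "exp (- (rate_inf r \<beta> + \<epsilon>) * real N) \<le> exp (- (rate_J r x \<beta> + \<epsilon> / 2) * real N)" by simp
    with elim show ?case by linarith
  qed
qed

lemma log_exceedance_tendsto: "(\<lambda>N. ln (exceedance N) / real N) \<longlonglongrightarrow> - rate_inf r \<beta>"
proof (rule tendstoI)
  fix \<epsilon> :: real assume "0 < \<epsilon>"
  then have \<epsilon>: "0 < \<epsilon> / 2" by simp
  show "\<forall>\<^sub>F N in sequentially. dist (ln (exceedance N) / real N) (- rate_inf r \<beta>) < \<epsilon>"
    using exceedance_lower[OF \<epsilon>] exceedance_upper[OF \<epsilon>] eventually_ge_at_top[of 1]
  proof eventually_elim
    case (elim N)
    have Npos: "0 < real N" using elim(3) by simp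
    \<comment> \<open>The lower bound makes the probability positive, so its logarithm is a genuine
      one.\<close>
    have pos: "0 < exceedance N" using elim(1) exp_gt_zero less_le_trans by blast
    have "- (rate_inf r \<beta> + \<epsilon> / 2) * real N \<le> ln (exceedance N)"
      using elim(1) pos by (subst ln_ge_iff) auto
    moreover have "ln (exceedance N) \<le> - (rate_inf r \<beta> - \<epsilon> / 2) * real N"
      using elim(2) pos by (metis exp_le_cancel_iff exp_ln)
    ultimately have "- (rate_inf r \<beta> + \<epsilon> / 2) \<le> ln (exceedance N) / real N"
      "ln (exceedance N) / real N \<le> - (rate_inf r \<beta> - \<epsilon> / 2)"
      using Npos by (simp_all only: pos_le_divide_eq pos_divide_le_eq)
    with \<open>0 < \<epsilon>\<close> show ?case unfolding dist_real_def by linarith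
  qed
qed

end

theorem theorem5:
  fixes r :: "real \<Rightarrow> real \<Rightarrow> real"
    and rN :: "nat \<Rightarrow> real \<Rightarrow> real \<Rightarrow> real"
    and \<delta> \<beta> :: real
  assumes "graphon r"
    and "\<delta> > 0"
    and "\<And>x y. x \<in> {0..1} \<Longrightarrow> y \<in> {0..1} \<Longrightarrow> \<delta> \<le> r x y \<and> r x y \<le> 1 - \<delta>"
    and "nonneg_definite r"
    and "\<And>N. N \<ge> 1 \<Longrightarrow> graphon (rN N)"
    and "\<And>N x y. N \<ge> 1 \<Longrightarrow> x \<in> {0..1} \<Longrightarrow> y \<in> {0..1} \<Longrightarrow> 0 < rN N x y \<and> rN N x y < 1"
    and "\<And>N. N \<ge> 1 \<Longrightarrow> block_constant N (rN N)"
    and "\<And>x y. x \<in> {0..1} \<Longrightarrow> y \<in> {0..1} \<Longrightarrow> (\<lambda>N. rN N x y) \<longlonglongrightarrow> r x y"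
    and "(\<lambda>N. esssup (unit_interval \<Otimes>\<^sub>M unit_interval)
                (\<lambda>(x, y). ereal \<bar>rN N x y - r x y\<bar>)) \<longlonglongrightarrow> 0"
    and "L2_onorm (laplacian_operator r) \<le> \<beta>"
    and "\<beta> \<le> 1"
  shows "(\<lambda>N. ln (measure_pmf.prob (eigenvalue_law N (rN N)) {l. l / real N \<ge> \<beta>}) / real N)
           \<longlonglongrightarrow> - rate_inf r \<beta>"
proof -
  interpret convergent_graphons r rN \<delta> \<beta>
    by unfold_locales (fact assms)+
  show ?thesis by (rule log_exceedance_tendsto)
qed

end
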